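(* The uplink ergodic rate $R_{lk}(p_r,\alpha)=\mathbb E[\log_2(1+\gamma_k)]$ from the $k$th terminal in the $l$th cell to its base station, considering delayed channels (with $\gamma_k$ the zero-forcing SINR defined in the context), is lower bounded by $R_L(p_r,\alpha)$: $R_{lk}(p_r,\alpha)\ge R_L(p_r,\alpha)$, where $$R_L(p_r,\alpha)=\log_2\left(1+\frac{1}{C+\frac{1}{(N-K)\alpha^2\hat\beta_{llk}}\left(\sum_{i=1}^L\sum_{j=1}^K\left(\beta_{lij}-\alpha^2\hat\beta_{lij}\right)+\frac1{p_r}\right)}\right),$$ and $C=\sum_{i\neq l}(\beta_{lik}/\beta_{llk})^2$.
   Context: Setting: the uplink of a cellular network with $L$ cells, each with one $N$-antenna base station and $K$ single-antenna terminals, $N\ge K$, all terminals sharing the same time-frequency resource. $p_r$ is the average transmit power of each terminal; the noise at the base stations has unit-variance circularly symmetric complex Gaussian entries. $\mathcal{CN}(0,\Sigma)$ denotes the circularly symmetric complex Gaussian law. The channel at symbol $n$ from terminal $j$ of cell $i$ to base station $l$ is $g_{lij}[n]=\sqrt{\beta_{lij}}\,h_{lij}[n]\in\mathbb C^N$, with large-scale fading coefficient $\beta_{lij}$ and $h_{lij}[n]\sim\mathcal{CN}(0,I_N)$. Training: all cells reuse the same $K$ orthogonal pilot sequences of length $\tau\ge K$; $p_{\mathrm{tr}}=\tau p_r$. The MMSE estimate of $g_{lij}[n]$ is $\hat g_{lij}[n]=\beta_{lij}\big(\tfrac1{p_{\mathrm{tr}}}+\sum_{i'=1}^L\beta_{li'j}\big)^{-1}\big(\sum_{i'=1}^L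 g_{li'j}[n]+\tfrac1{\sqrt{p_{\mathrm{tr}}}}\tilde z_{lj}[n]\big)$, with $\tilde z_{lj}[n]\sim\mathcal{CN}(0,I_N)$ independent of the channels. With $\hat\beta_{lij}=\beta_{lij}^2/\big(\sum_{i'=1}^L\beta_{li'j}+1/p_{\mathrm{tr}}\big)$, one has $\hat g_{lij}[n]\sim\mathcal{CN}(0,\hat\beta_{lij}I_N)$, and the estimation error $\tilde g_{lij}[n]=g_{lij}[n]-\hat g_{lij}[n]\sim\mathcal{CN}(0,(\beta_{lij}-\hat\beta_{lij})I_N)$ is independent of $\hat g_{lij}[n]$. Delayed channel: $g_{lij}[n]=\alpha g_{lij}[n-1]+e_{lij}[n]$ with $e_{lij}[n]\sim\mathcal{CN}(0,(1-\alpha^2)\beta_{lij}I_N)$ independent of $g_{lij}[n-1]$, where $\alpha=J_0(2\pi f_DT_s)$ is the temporal correlation parameter ($J_0$ the zeroth-order Bessel function of the first kind, $f_D$ the maximum Doppler shift, $T_s$ the channel sampling period). Thus $g_{lij}[n]=\alpha\hat g_{lij}[n-1]+\tilde e_{lij}[n]$, where $\tilde e_{lij}[n]=\alpha\tilde g_{lij}[n-1]+e_{lij}[n]\sim\mathcal{CN}(0,(\beta_{lij}-\alpha^2\hat\beta_{lij})I_N)$ is independent of $\hat g_{lij}[n-1]$. Let $\hat G_{li}[n]$ and $\tilde E_{li}[n]$ be the $N\times K$ matrices with $j$th columns $\hat g_{lij}[n]$ and $\tilde e_{lij}[n]$; then $\hat G_{li}[n]=\hat G_{ll}[n]D_i$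 with $D_i=\mathrm{diag}(\beta_{li1}/\beta_{ll1},\dots,\beta_{liK}/\beta_{llK})$. SINR: the received signal at base station $l$ is multiplied by $\alpha^{-1}\hat G_{ll}^\dagger[n-1]$ ($\dagger$ is the pseudo-inverse). With $[A]_k$ the $k$th row of $A$ and $\|\cdot\|$ the Euclidean norm, $$\gamma_k=\frac{\alpha^2p_r}{\alpha^2p_r\sum_{i\ne l}\big\|[\hat G_{ll}^\dagger[n-1]]_k\hat G_{li}[n-1]\big\|^2+p_r\sum_{i=1}^L\big\|[\hat G_{ll}^\dagger[n-1]]_k\tilde E_{li}[n]\big\|^2+\big\|[\hat G_{ll}^\dagger[n-1]]_k\big\|^2}.$$ *)

theory Defs
  imports "HOL-Probability.Probability"
begin

(* Conventions: the finite types 'n, 'k, 'c index the N antennas of a base station, the K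
   terminals of a cell and the L cells; time is an int, so that "n - 1" is not truncated.
   In g n l i j the arguments are: time, receiving base station, cell and terminal of the sender. *)

section \<open>Circularly symmetric complex Gaussian vectors\<close>

(* CN(0, v): independent real and imaginary parts, each N(0, v / 2). Only meaningful for v >= 0;
   v = 0 gives the point mass at 0. *)
definition complex_normal :: "real \<Rightarrow> complex measure" where
  "complex_normal v =
     distr (density lborel (\<lambda>x. ennreal (std_normal_density x)) \<Otimes>\<^sub>M
            density lborel (\<lambda>x. ennreal (std_normal_density x))) borel
       (\<lambda>(x, y). Complex (sqrt (v / 2) * x) (sqrt (v / 2) * y))"

(* CN(0, v I) on the space of vectors indexed by 'n. *)
definition complex_normal_vec :: "real \<Rightarrow> (complex ^ 'n::finite) measure" where
  "complex_normal_vec v = distr (Pi\<^sub>M UNIV (\<lambda>_::'n. complex_normal v)) borel vec_lambda"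

(* 0 <= v is part of the notion: a covariance matrix is positive semidefinite. *)
definition has_CN_law :: "'w measure \<Rightarrow> real \<Rightarrow> ('w \<Rightarrow> complex ^ 'n::finite) \<Rightarrow> bool" where
  "has_CN_law M v X \<longleftrightarrow>
     0 \<le> v \<and> X \<in> borel_measurable M \<and> distr M borel X = complex_normal_vec v"


section \<open>Pseudo-inverse and Bessel function\<close>

definition conj_transpose :: "complex ^ 'b ^ 'a \<Rightarrow> complex ^ 'a ^ 'b" where
  "conj_transpose A = (\<chi> i j. cnj (A $ j $ i))"

(* Moore-Penrose pseudo-inverse, characterised by the four Penrose equations. *)
definition pinv :: "complex ^ 'b ^ 'a \<Rightarrow> complex ^ 'a::finite ^ 'b::finite" where
  "pinv A = (THE X. A ** X ** A = A \<and> X ** A ** X = X \<and>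
                    conj_transpose (A ** X) = A ** X \<and> conj_transpose (X ** A) = X ** A)"

(* Power series of the zeroth-order Bessel function of the first kind. *)
definition bessel_J0 :: "real \<Rightarrow> real" where
  "bessel_J0 x = (\<Sum>m. (- 1) ^ m / (fact m)\<^sup>2 * (x / 2) ^ (2 * m))"


section \<open>Channels and their estimates\<close>

definition channel ::
  "('c \<Rightarrow> 'c \<Rightarrow> 'k \<Rightarrow> real) \<Rightarrow> (int \<Rightarrow> 'c \<Rightarrow> 'c \<Rightarrow> 'k \<Rightarrow> 'w \<Rightarrow> complex ^ 'n)
   \<Rightarrow> int \<Rightarrow> 'c \<Rightarrow> 'c \<Rightarrow> 'k \<Rightarrow> 'w \<Rightarrow> complex ^ 'n" where
  "channel \<beta> h n l i j \<omega> = sqrt (\<beta> l i j) *\<^sub>R h n l i j \<omega>"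

definition beta_hat :: "real \<Rightarrow> ('c \<Rightarrow> 'c \<Rightarrow> 'k \<Rightarrow> real) \<Rightarrow> 'c::finite \<Rightarrow> 'c \<Rightarrow> 'k \<Rightarrow> real" where
  "beta_hat p_tr \<beta> l i j = (\<beta> l i j)\<^sup>2 / ((\<Sum>i'\<in>UNIV. \<beta> l i' j) + 1 / p_tr)"

(* z n l j is the normalised pilot noise at base station l for the j-th pilot. *)
definition channel_est ::
  "real \<Rightarrow> ('c::finite \<Rightarrow> 'c \<Rightarrow> 'k \<Rightarrow> real) \<Rightarrow> (int \<Rightarrow> 'c \<Rightarrow> 'c \<Rightarrow> 'k \<Rightarrow> 'w \<Rightarrow> complex ^ 'n)
   \<Rightarrow> (int \<Rightarrow> 'c \<Rightarrow> 'k \<Rightarrow> 'w \<Rightarrow> complex ^ 'n)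
   \<Rightarrow> int \<Rightarrow> 'c \<Rightarrow> 'c \<Rightarrow> 'k \<Rightarrow> 'w \<Rightarrow> complex ^ 'n" where
  "channel_est p_tr \<beta> h z n l i j \<omega> =
     (\<beta> l i j * inverse (1 / p_tr + (\<Sum>i'\<in>UNIV. \<beta> l i' j))) *\<^sub>R
     ((\<Sum>i'\<in>UNIV. channel \<beta> h n l i' j \<omega>) + (1 / sqrt p_tr) *\<^sub>R z n l j \<omega>)"

(* Error of predicting the channel at time n by \<alpha> times its estimate at time n - 1. *)
definition delayed_err ::
  "real \<Rightarrow> real \<Rightarrow> ('c::finite \<Rightarrow> 'c \<Rightarrow> 'k \<Rightarrow> real) \<Rightarrow> (int \<Rightarrow> 'c \<Rightarrow> 'c \<Rightarrow> 'k \<Rightarrow> 'w \<Rightarrow> complex ^ 'n)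
   \<Rightarrow> (int \<Rightarrow> 'c \<Rightarrow> 'k \<Rightarrow> 'w \<Rightarrow> complex ^ 'n) \<Rightarrow> (int \<Rightarrow> 'c \<Rightarrow> 'c \<Rightarrow> 'k \<Rightarrow> 'w \<Rightarrow> complex ^ 'n)
   \<Rightarrow> int \<Rightarrow> 'c \<Rightarrow> 'c \<Rightarrow> 'k \<Rightarrow> 'w \<Rightarrow> complex ^ 'n" where
  "delayed_err \<alpha> p_tr \<beta> h z e n l i j \<omega> =
     \<alpha> *\<^sub>R (channel \<beta> h (n - 1) l i j \<omega> - channel_est p_tr \<beta> h z (n - 1) l i j \<omega>)
     + e n l i j \<omega>"

(* The primitive random vectors on which the reception at one base station at time n depends. *)
datatype ('c, 'k) source = Fading 'c 'k | Innovation 'c 'k | Pilot_Noise 'k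

primrec source_var ::
  "(int \<Rightarrow> 'c \<Rightarrow> 'c \<Rightarrow> 'k \<Rightarrow> 'w \<Rightarrow> complex ^ 'n) \<Rightarrow> (int \<Rightarrow> 'c \<Rightarrow> 'k \<Rightarrow> 'w \<Rightarrow> complex ^ 'n)
   \<Rightarrow> (int \<Rightarrow> 'c \<Rightarrow> 'c \<Rightarrow> 'k \<Rightarrow> 'w \<Rightarrow> complex ^ 'n)
   \<Rightarrow> int \<Rightarrow> 'c \<Rightarrow> ('c, 'k) source \<Rightarrow> 'w \<Rightarrow> complex ^ 'n" where
  "source_var h z e n l (Fading i j) = h (n - 1) l i j"
| "source_var h z e n l (Innovation i j) = e n l i j"
| "source_var h z e n l (Pilot_Noise j) = z (n - 1) l j"


section \<open>Zero-forcing SINR, ergodic rate and its lower bound\<close>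

definition of_columns :: "('k \<Rightarrow> complex ^ 'n) \<Rightarrow> complex ^ 'k ^ 'n" where
  "of_columns v = (\<chi> a j. v j $ a)"

definition zf_sinr ::
  "real \<Rightarrow> real \<Rightarrow> ('c::finite \<Rightarrow> complex ^ 'k::finite ^ 'n::finite) \<Rightarrow> ('c \<Rightarrow> complex ^ 'k ^ 'n)
   \<Rightarrow> 'c \<Rightarrow> 'k \<Rightarrow> real" where
  "zf_sinr p \<alpha> G E l k =
     \<alpha>\<^sup>2 * p /
     (\<alpha>\<^sup>2 * p * (\<Sum>i\<in>UNIV - {l}. (norm (row k (pinv (G l)) v* G i))\<^sup>2)
      + p * (\<Sum>i\<in>UNIV. (norm (row k (pinv (G l)) v* E i))\<^sup>2)
      + (norm (row k (pinv (G l))))\<^sup>2)"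

definition ergodic_rate ::
  "'w measure \<Rightarrow> nat \<Rightarrow> real \<Rightarrow> real \<Rightarrow> ('c::finite \<Rightarrow> 'c \<Rightarrow> 'k::finite \<Rightarrow> real)
   \<Rightarrow> (int \<Rightarrow> 'c \<Rightarrow> 'c \<Rightarrow> 'k \<Rightarrow> 'w \<Rightarrow> complex ^ 'n::finite)
   \<Rightarrow> (int \<Rightarrow> 'c \<Rightarrow> 'k \<Rightarrow> 'w \<Rightarrow> complex ^ 'n) \<Rightarrow> (int \<Rightarrow> 'c \<Rightarrow> 'c \<Rightarrow> 'k \<Rightarrow> 'w \<Rightarrow> complex ^ 'n)
   \<Rightarrow> int \<Rightarrow> 'c \<Rightarrow> 'k \<Rightarrow> real" where
  "ergodic_rate M \<tau> p \<alpha> \<beta> h z e n l k =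
     (\<integral>\<omega>. log 2 (1 + zf_sinr p \<alpha>
               (\<lambda>i. of_columns (\<lambda>j. channel_est (real \<tau> * p) \<beta> h z (n - 1) l i j \<omega>))
               (\<lambda>i. of_columns (\<lambda>j. delayed_err \<alpha> (real \<tau> * p) \<beta> h z e n l i j \<omega>)) l k) \<partial>M)"

(* For N = K or \<alpha> = 0 the bound contains 1 / 0, which is read as infinity, so that the bound is
   log 2 (1 + 0) = 0; HOL's 1 / 0 = 0 would give a different (wrong) value. *)
definition rate_lower_bound ::
  "nat \<Rightarrow> nat \<Rightarrow> real \<Rightarrow> real \<Rightarrow> ('c::finite \<Rightarrow> 'c \<Rightarrow> 'k::finite \<Rightarrow> real) \<Rightarrow> 'c \<Rightarrow> 'k \<Rightarrow> real" where
  "rate_lower_bound N \<tau> p \<alpha> \<beta> l k =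
     (let K = CARD('k);
          b = beta_hat (real \<tau> * p) \<beta>;
          C = (\<Sum>i\<in>UNIV - {l}. (\<beta> l i k / \<beta> l l k)\<^sup>2)
      in if N = K \<or> \<alpha> = 0 then 0
         else log 2 (1 + 1 / (C + 1 / ((real N - real K) * \<alpha>\<^sup>2 * b l l k) *
                ((\<Sum>i\<in>UNIV. \<Sum>j\<in>UNIV. \<beta> l i j - \<alpha>\<^sup>2 * b l i j) + 1 / p))))"

end

theory Submission
  imports Defs
begin

text \<open>
  Write \<open>w\<close> for row \<open>k\<close> of the pseudo-inverse of the estimated channel matrix. Almost surely
  \<open>1 / \<gamma>\<^sub>k\<close> equals \<open>C\<close> plus a term linear in \<open>\<parallel>w\<parallel>\<^sup>2\<close> and in the squares \<open>\<bar>w \<cdot> e\<bar>\<^sup>2\<close>, \<open>e\<close> ranging over the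
  prediction errors, and \<open>t \<mapsto> log 2 (1 + 1 / t)\<close> is convex and decreasing. By Jensen's inequality it
  suffices to bound the mean of \<open>1 / \<gamma>\<^sub>k\<close> from above. Each error \<open>e\<close> is independent of the estimates
  and circularly symmetric, so \<open>\<bar>w \<cdot> e\<bar>\<^sup>2\<close> has mean \<open>Var e\<close> times the mean of \<open>\<parallel>w\<parallel>\<^sup>2\<close>. Given the other
  columns, \<open>\<parallel>w\<parallel>\<^sup>2 \<le> 1 / q\<close>, where \<open>q\<close> is the squared length of the projection of column \<open>k\<close> to
  their orthogonal complement, of complex dimension at least \<open>N - K + 1\<close>; Gaussian integration by
  parts bounds the mean of \<open>1 / q\<close> by \<open>1 / ((N - K) b)\<close> for columns of variance \<open>b\<close>. Integrability
  of the rate follows from \<open>1 \<le> \<parallel>w\<parallel> \<parallel>g\<parallel>\<close> for the column \<open>g\<close>, which bounds \<open>\<gamma>\<^sub>k\<close> by a multiple of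
  \<open>\<parallel>g\<parallel>\<^sup>2\<close>.
\<close>

section \<open>The pseudo-inverse of a matrix with independent columns\<close>

text \<open>The bound has N - K where the complement has complex dimension at least N - K + 1. The
  reason is the divergence of x / |x|^2 in real dimension d, which is (d - 2) / |x|^2: the lost 2 is
  exactly one complex dimension, and real coordinates of variance b / 2 turn d - 2 >= 2 (N - K) into
  1 / ((N - K) b). For N = K this method gives no finite mean of 1 / q, which is why that case has
  bound 0 and is treated apart. Jensen asks only for an upper bound on the mean of 1 / \<gamma>, so
  an estimate valid for each fixed choice of the other columns, dependent or not, is enough. The
  main obstacle is dependence: the same pilot observation enters the estimate and the error of a
  terminal. Their independence is derived from the independent sources, by rotating a Gaussian pair
  into its sum and the residual of the regression on that sum. Integrability of the rate is part of
  the claim, since the Bochner integral of a non-integrable function is 0 and would fall below the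
  bound.\<close>

lemma conj_transpose_mult:
  fixes A :: "complex ^ 'b::finite ^ 'a::finite" and B :: "complex ^ 'c::finite ^ 'b"
  shows "conj_transpose (A ** B) = conj_transpose B ** conj_transpose A"
  by (simp add: conj_transpose_def matrix_matrix_mult_def vec_eq_iff mult.commute)

lemma conj_transpose_conj_transpose [simp]: "conj_transpose (conj_transpose A) = A"
  by (simp add: conj_transpose_def vec_eq_iff)

definition is_pinv :: "complex ^ 'b ^ 'a \<Rightarrow> complex ^ 'a::finite ^ 'b::finite \<Rightarrow> bool" where
  "is_pinv A X \<longleftrightarrow> A ** X ** A = A \<and> X ** A ** X = X \<and>
     conj_transpose (A ** X) = A ** X \<and> conj_transpose (X ** A) = X ** A"

text \<open>Taking adjoints reverses a product of Hermitian matrices. The product of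
  \<open>A ** Y\<close> and \<open>A ** X\<close> is \<open>A ** X\<close> in one order and
  \<open>A ** Y\<close> in the other, so the two agree; likewise \<open>X ** A\<close> and
  \<open>Y ** A\<close>. Then X is recovered from these two projections.\<close>

lemma is_pinv_unique:
  assumes "is_pinv A X" "is_pinv A Y"
  shows "X = Y"
proof -
  note X = assms(1)[unfolded is_pinv_def] and Y = assms(2)[unfolded is_pinv_def]
  have "A ** X = A ** Y ** (A ** X)" using Y by (simp add: matrix_mul_assoc)
  also have "\<dots> = conj_transpose (A ** Y) ** conj_transpose (A ** X)" using X Y by simp
  also have "\<dots> = conj_transpose (A ** X ** A ** Y)"
    by (simp add: conj_transpose_mult[symmetric] matrix_mul_assoc)
  also have "\<dots> = A ** Y" using X Y by simp
  finally have 1: "A ** X = A ** Y" .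
  have "X ** A = X ** (A ** Y ** A)" using Y by simp
  also have "\<dots> = X ** A ** (Y ** A)" by (simp only: matrix_mul_assoc)
  also have "\<dots> = conj_transpose (X ** A) ** conj_transpose (Y ** A)" using X Y by simp
  also have "\<dots> = conj_transpose (Y ** (A ** X ** A))"
    by (simp add: conj_transpose_mult[symmetric] matrix_mul_assoc)
  also have "\<dots> = Y ** A" using X Y by simp
  finally have 2: "X ** A = Y ** A" .
  have "X = X ** A ** X" using X by simp
  also have "\<dots> = Y ** A ** Y" using 1 2 by (metis matrix_mul_assoc)
  also have "\<dots> = Y" using Y by simp
  finally show ?thesis .
qed

lemma pinv_eq: "is_pinv A X \<Longrightarrow> pinv A = X"
  unfolding pinv_def is_pinv_def[symmetric] by (blast intro: is_pinv_unique)

lemma norm_vec_complex_sq: "complex_of_real ((norm x)\<^sup>2) = (\<Sum>i\<in>UNIV. cnj (x $ i) * x $ i)"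
  for x :: "complex ^ 'a::finite"
proof -
  have "(norm x)\<^sup>2 = (\<Sum>i\<in>UNIV. (cmod (x $ i))\<^sup>2)"
    by (simp add: norm_vec_def L2_set_def sum_nonneg)
  then show ?thesis
    by (simp add: of_real_power[symmetric] complex_norm_square mult.commute del: of_real_power)
qed

lemma norm_sum_mult_le:
  fixes a b :: "complex ^ 'a::finite"
  shows "cmod (\<Sum>i\<in>UNIV. a $ i * b $ i) \<le> norm a * norm b"
proof -
  have "cmod (\<Sum>i\<in>UNIV. a $ i * b $ i) \<le> (\<Sum>i\<in>UNIV. \<bar>cmod (a $ i)\<bar> * \<bar>cmod (b $ i)\<bar>)"
    by (rule order_trans[OF norm_sum]) (simp add: norm_mult)
  also have "\<dots> \<le> norm a * norm b"
    unfolding norm_vec_def by (rule L2_set_mult_ineq)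
  finally show ?thesis .
qed

text \<open>A left inverse makes A injective. If the Gram matrix kills v, then the squared norm of A
  v, which is the inner product of v with the Gram matrix applied to v, is 0, so v = 0. For a square
  matrix injectivity gives a two-sided inverse.\<close>

lemma gram_left_inverse:
  fixes A :: "complex ^ 'b::finite ^ 'a::finite"
  assumes "B ** A = mat 1"
  obtains C where "C ** (conj_transpose A ** A) = mat 1" "conj_transpose A ** A ** C = mat 1"
proof -
  have "inj ((*v) (conj_transpose A ** A))"
  proof (rule injI)
    fix x y :: "complex ^ 'b"
    assume eq: "conj_transpose A ** A *v x = conj_transpose A ** A *v y"
    define v where "v = x - y"
    have 0: "conj_transpose A *v (A *v v) = 0"
      using eq by (simp add: v_def matrix_vector_mult_diff_distrib matrix_vector_mul_assoc)
    have "complex_of_real ((norm (A *v v))\<^sup>2) = (\<Sum>i\<in>UNIV. \<Sum>j\<in>UNIV. cnj (A $ i $ j) * cnj (v $ j) * (A *v v) $ i)"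
      unfolding norm_vec_complex_sq
      by (simp add: matrix_vector_mult_def sum_distrib_right)
    also have "\<dots> = (\<Sum>j\<in>UNIV. cnj (v $ j) * (conj_transpose A *v (A *v v)) $ j)"
      by (subst sum.swap) (simp add: conj_transpose_def matrix_vector_mult_def[of "conj_transpose A"]
          matrix_vector_mult_def[of "\<chi> i j. cnj (A $ j $ i)"] sum_distrib_left mult_ac)
    also have "\<dots> = 0" using 0 by simp
    finally have "A *v v = 0" by simp
    then have "B ** A *v v = 0" by (simp flip: matrix_vector_mul_assoc)
    then show "x = y" using assms by (simp add: v_def)
  qed
  then obtain C where "C ** (conj_transpose A ** A) = mat 1"
    using matrix_left_invertible_injective by blast
  then show ?thesis using that matrix_left_right_inverse by blast
qed

lemma is_pinv_pinv:
  fixes A :: "complex ^ 'b::finite ^ 'a::finite"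
  assumes "B ** A = mat 1"
  shows "is_pinv A (pinv A)" and "pinv A ** A = mat 1"
proof -
  obtain C where C: "C ** (conj_transpose A ** A) = mat 1" "conj_transpose A ** A ** C = mat 1"
    by (rule gram_left_inverse[OF assms])
  have ctone: "conj_transpose (mat 1 :: complex ^ 'b ^ 'b) = mat 1"
    by (simp add: conj_transpose_def mat_def vec_eq_iff)
  have "conj_transpose (conj_transpose A ** A ** C) = mat 1" using C ctone by simp
  then have "conj_transpose C ** (conj_transpose A ** A) = mat 1"
    by (simp add: conj_transpose_mult)
  \<comment> \<open>The inverse of a Hermitian matrix is Hermitian: the adjoint of \<open>C\<close>
    is another left inverse of the Gram matrix.\<close>
  then have Cs: "conj_transpose C = C"
    using C by (metis matrix_mul_assoc matrix_mul_lid matrix_mul_rid)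
  have 1: "C ** conj_transpose A ** A = mat 1" using C by (simp add: matrix_mul_assoc)
  have "is_pinv A (C ** conj_transpose A)"
    unfolding is_pinv_def using 1 Cs
    by (simp add: matrix_mul_assoc[symmetric] ctone conj_transpose_mult)
  then show "is_pinv A (pinv A)" "pinv A ** A = mat 1" using 1 by (simp_all add: pinv_eq)
qed

lemma row_matrix_mult: "row k (X ** A) = row k X v* A"
  for X :: "'a::comm_semiring_1 ^ 'b::finite ^ 'c" and A :: "'a ^ 'd ^ 'b"
  by (simp add: row_def matrix_matrix_mult_def vector_matrix_mult_def vec_eq_iff mult.commute)

lemma vector_matrix_mult_assoc: "(w v* A) v* B = w v* (A ** B)"
  for w :: "'a::comm_semiring_1 ^ 'b::finite" and A :: "'a ^ 'c::finite ^ 'b"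
proof -
  have "((w v* A) v* B) $ j = (w v* (A ** B)) $ j" for j
    unfolding vector_matrix_mult_def matrix_matrix_mult_def
    by (simp add: sum_distrib_left sum_distrib_right) (subst sum.swap, simp add: mult_ac)
  then show ?thesis by (simp add: vec_eq_iff)
qed

text \<open>A Hermitian idempotent is an orthogonal projection: the squared norm of the image u is
  the inner product of w and u, and Cauchy-Schwarz cancels one factor.\<close>

lemma norm_hermitian_idempotent_le:
  fixes H :: "complex ^ 'a::finite ^ 'a"
  assumes "conj_transpose H = H" "H ** H = H"
  shows "norm (w v* H) \<le> norm w"
proof -
  define u where "u = w v* H"
  have uH: "u v* H = u" by (simp add: u_def vector_matrix_mult_assoc assms)
  have H: "cnj (H $ i $ j) = H $ j $ i" for i j
    using assms(1) by (simp add: conj_transpose_def vec_eq_iff)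
  have "complex_of_real ((norm u)\<^sup>2) = (\<Sum>j\<in>UNIV. \<Sum>i\<in>UNIV. cnj (w $ i) * (H $ j $ i * u $ j))"
    unfolding norm_vec_complex_sq
    by (subst (1) u_def) (simp add: vector_matrix_mult_def sum_distrib_right sum_distrib_left H mult_ac)
  also have "\<dots> = (\<Sum>i\<in>UNIV. (\<chi> i. cnj (w $ i)) $ i * (u v* H) $ i)"
    by (subst sum.swap) (simp add: vector_matrix_mult_def sum_distrib_left mult_ac)
  finally have "(norm u)\<^sup>2 = cmod (\<Sum>i\<in>UNIV. (\<chi> i. cnj (w $ i)) $ i * u $ i)"
    unfolding uH by (metis norm_of_real abs_of_nonneg zero_le_power2)
  also have "\<dots> \<le> norm (\<chi> i. cnj (w $ i)) * norm u"
    by (rule norm_sum_mult_le)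
  also have "norm (\<chi> i. cnj (w $ i)) = norm w" by (simp add: norm_vec_def)
  finally have "norm u * norm u \<le> norm w * norm u" by (simp add: power2_eq_square)
  then show ?thesis unfolding u_def[symmetric]
    by (cases "norm u = 0") auto
qed

text \<open>Among all zero-forcing rows the one of the pseudo-inverse has minimal norm, being the
  image of any other one under the orthogonal projection \<open>A ** pinv A\<close>. This lets an
  explicit row stand in for the pseudo-inverse.\<close>

lemma norm_row_pinv_le:
  fixes A :: "complex ^ 'b::finite ^ 'a::finite"
  assumes "B ** A = mat 1" and w: "w v* A = axis k 1"
  shows "norm (row k (pinv A)) \<le> norm w"
proof -
  have P: "is_pinv A (pinv A)" "pinv A ** A = mat 1" using is_pinv_pinv[OF assms(1)] by auto
  have "w v* (A ** pinv A) = axis k 1 v* pinv A"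
    by (simp add: vector_matrix_mult_assoc[symmetric] w)
  also have "\<dots> = row k (pinv A)"
    by (simp add: vector_matrix_mult_def row_def axis_def vec_eq_iff if_distrib if_distribR cong: if_cong)
  finally have "row k (pinv A) = w v* (A ** pinv A)" ..
  moreover have "norm (w v* (A ** pinv A)) \<le> norm w"
    using P by (intro norm_hermitian_idempotent_le)
      (auto simp: is_pinv_def matrix_mul_assoc)
  ultimately show ?thesis by simp
qed

text \<open>Splits full column rank into one condition per column, each of which can be shown to
  hold almost surely by varying that column alone.\<close>

lemma left_inverse_iff_rows:
  fixes A :: "complex ^ 'b::finite ^ 'a::finite"
  shows "(\<exists>B. B ** A = mat 1) \<longleftrightarrow> (\<forall>k. \<exists>w. w v* A = axis k 1)"
proof
  assume "\<exists>B. B ** A = mat 1"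
  then obtain B where B: "B ** A = mat 1" by blast
  have "row k B v* A = axis k 1" for k
    by (simp add: row_matrix_mult[symmetric] B) (simp add: row_def mat_def axis_def vec_eq_iff)
  then show "\<forall>k. \<exists>w. w v* A = axis k 1" by blast
next
  assume "\<forall>k. \<exists>w. w v* A = axis k 1"
  then obtain w where w: "\<And>k. w k v* A = axis k 1" by metis
  have "(\<chi> k. w k) ** A = mat 1"
  proof -
    have "row k ((\<chi> k. w k) ** A) = row k (mat 1)" for k
      unfolding row_matrix_mult
      by (simp add: w row_def[of k "\<chi> k. w k"]) (simp add: row_def mat_def axis_def vec_eq_iff w)
    then show ?thesis by (simp add: row_def vec_eq_iff)
  qed
  then show "\<exists>B. B ** A = mat 1" by blast
qed

section \<open>Gaussian integration by parts\<close>

lemma nn_integral_lborel_shift: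
  fixes f :: "'a::euclidean_space \<Rightarrow> ennreal"
  assumes [measurable]: "f \<in> borel_measurable borel"
  shows "(\<integral>\<^sup>+x. f (x + c) \<partial>lborel) = (\<integral>\<^sup>+x. f x \<partial>lborel)"
proof -
  have "(\<integral>\<^sup>+x. f x \<partial>lborel) = (\<integral>\<^sup>+x. f x \<partial>distr lborel borel ((+) c))"
    by (simp add: lborel_distr_plus)
  also have "\<dots> = (\<integral>\<^sup>+x. f (x + c) \<partial>lborel)"
    by (subst nn_integral_distr) (auto simp: add.commute)
  finally show ?thesis ..
qed

text \<open>Translation invariance of Lebesgue measure gives \<open>F (x + b) - F x\<close> the integral 0;
  by Fubini this is also the integral of the directional derivative.\<close>
lemma integral_directional_derivative_eq_0:
  fixes F F' :: "'a::euclidean_space \<Rightarrow> real"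
  assumes der: "\<And>x. ((\<lambda>t. F (x + t *\<^sub>R b)) has_real_derivative F' x) (at 0)"
    and F: "integrable lborel F" and F': "integrable lborel F'"
    and cont: "continuous_on UNIV F'"
  shows "(\<integral>x. F' x \<partial>lborel) = 0"
proof -
  have tr: "integral\<^sup>L lborel (\<lambda>x. g (x + c)) = integral\<^sup>L lborel g"
    if "integrable lborel g" for g :: "'a \<Rightarrow> real" and c
  proof -
    have "integral\<^sup>L lborel g = integral\<^sup>L (distr lborel borel ((+) c)) g"
      by (simp add: lborel_distr_plus)
    also have "\<dots> = integral\<^sup>L lborel (\<lambda>x. g (c + x))"
      using that by (subst integral_distr) auto
    finally show ?thesis by (simp add: add.commute)
  qed
  have tri: "integrable lborel (\<lambda>x. g (x + c))" if "integrable lborel g" for g :: "'a \<Rightarrow> real" and c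
  proof -
    have "integrable (distr lborel borel ((+) c)) g" using that by (simp add: lborel_distr_plus)
    then show ?thesis using that by (subst (asm) integrable_distr_eq) (auto simp: add.commute)
  qed
  have [measurable]: "F' \<in> borel_measurable borel" using F' by auto
  have trn: "(\<integral>\<^sup>+x. ennreal (norm (F' (x + c))) \<partial>lborel) = (\<integral>\<^sup>+x. ennreal (norm (F' x)) \<partial>lborel)" for c
    using nn_integral_lborel_shift[of "\<lambda>x. ennreal (norm (F' x))" c] by simp
  have dert: "((\<lambda>t. F (x + t *\<^sub>R b)) has_real_derivative F' (x + t *\<^sub>R b)) (at t)" for x t
  proof -
    have "((\<lambda>s. F ((x + t *\<^sub>R b) + s *\<^sub>R b)) has_real_derivative F' (x + t *\<^sub>R b)) (at 0)"
      by (rule der)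
    then show ?thesis
      by (subst DERIV_at_within_shift_lemma | (simp add: DERIV_shift[of _ _ 0 t, simplified] algebra_simps scaleR_add_left))
  qed
  have contb: "continuous_on UNIV (\<lambda>t. F' (x + t *\<^sub>R b))" for x
    by (rule continuous_on_compose2[OF cont]) (auto intro!: continuous_intros)
  have ftc: "(\<integral>t\<in>{0..1}. F' (x + t *\<^sub>R b) \<partial>lborel) = F (x + b) - F x" for x
  proof -
    have "(\<integral>t. F' (x + t *\<^sub>R b) * indicator {0..1} t \<partial>lborel) = F (x + 1 *\<^sub>R b) - F (x + 0 *\<^sub>R b)"
    proof (rule integral_FTC_Icc_real)
      show "isCont (\<lambda>t. F' (x + t *\<^sub>R b)) t" for t
        using contb by (simp add: continuous_on_eq_continuous_at)
    qed (use dert in auto)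
    then show ?thesis by (simp add: set_lebesgue_integral_def mult.commute)
  qed
  \<comment> \<open>Fubini needs absolute integrability on the strip with t in [0, 1]. By
    translation invariance each slice in t contributes the same finite integral of the norm of
    \<open>F'\<close>.\<close>
  have int2: "integrable (lborel \<Otimes>\<^sub>M lborel) (\<lambda>(x, t). indicator {0..1::real} t *\<^sub>R F' (x + t *\<^sub>R b))"
    (is "integrable _ ?h")
  proof (rule integrableI_bounded)
    show "?h \<in> borel_measurable (lborel \<Otimes>\<^sub>M lborel)" by measurable
    have "(\<integral>\<^sup>+z. ennreal (norm (?h z)) \<partial>(lborel \<Otimes>\<^sub>M lborel))
        = (\<integral>\<^sup>+t. \<integral>\<^sup>+x. ennreal (norm (?h (x, t))) \<partial>lborel \<partial>lborel)"
      by (subst lborel_pair.nn_integral_snd[symmetric]) auto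
    also have "\<dots> = (\<integral>\<^sup>+t. indicator {0..1::real} t * (\<integral>\<^sup>+x. ennreal (norm (F' x)) \<partial>lborel) \<partial>lborel)"
      by (intro nn_integral_cong) (auto simp: indicator_def trn[simplified])
    also have "\<dots> = (\<integral>\<^sup>+x. ennreal (norm (F' x)) \<partial>lborel)"
      by (subst nn_integral_multc) auto
    also have "\<dots> < \<infinity>" using F' by (simp add: integrable_iff_bounded)
    finally show "(\<integral>\<^sup>+z. ennreal (norm (?h z)) \<partial>(lborel \<Otimes>\<^sub>M lborel)) < \<infinity>" .
  qed
  have "(\<integral>x. F (x + b) - F x \<partial>lborel) = (\<integral>x. (\<integral>t. ?h (x, t) \<partial>lborel) \<partial>lborel)"
    using ftc by (simp add: set_lebesgue_integral_def)
  also have "\<dots> = (\<integral>t. (\<integral>x. ?h (x, t) \<partial>lborel) \<partial>lborel)"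
    using lborel_pair.Fubini_integral[OF int2] by simp
  also have "\<dots> = (\<integral>t. indicator {0..1::real} t * (\<integral>x. F' x \<partial>lborel) \<partial>lborel)"
    using tr[OF F'] by simp
  also have "\<dots> = (\<integral>x. F' x \<partial>lborel)" by simp
  finally show ?thesis using tr[OF F] tri[OF F, of b] F by simp
qed

text \<open>Stein's method: integrate the divergence of
  \<open>(\<Sum>b\<in>B. (x \<bullet> b) *\<^sub>R b) / (q x + \<epsilon>)\<close>, \<open>q\<close> being the quadratic form below, against the Gaussian
  density and let \<open>\<epsilon>\<close> tend to 0. As \<open>inverse (ennreal 0) = top\<close>, the bound also shows that
  \<open>q\<close> vanishes almost nowhere.\<close>
lemma gaussian_integral_inverse_quadratic:
  fixes B :: "'a::euclidean_space set" and v :: real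
  assumes B: "pairwise orthogonal B" "\<And>b. b \<in> B \<Longrightarrow> norm b = 1" and fin: "finite B"
    and v: "0 < v" and d: "2 < card B"
    and int: "integrable lborel (\<lambda>x::'a. exp (- (norm x)\<^sup>2 / v))"
  shows "(\<integral>\<^sup>+x. ennreal (exp (- (norm x)\<^sup>2 / v)) * inverse (ennreal (\<Sum>b\<in>B. (x \<bullet> b)\<^sup>2)) \<partial>lborel)
    \<le> ennreal (2 / (v * (real (card B) - 2)) * (\<integral>x. exp (- (norm (x::'a))\<^sup>2 / v) \<partial>lborel))"
proof -
  define q where "q x = (\<Sum>b\<in>B. (x \<bullet> b)\<^sup>2)" for x
  define p where "p x = exp (- (norm x)\<^sup>2 / v)" for x :: 'a
  have q0: "0 \<le> q x" for x by (auto simp: q_def intro: sum_nonneg)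
  have p0: "0 < p x" for x by (simp add: p_def)
  have intp: "integrable lborel p" using int by (simp add: p_def[abs_def])
  have contq: "continuous_on UNIV q" and contp: "continuous_on UNIV p"
    unfolding q_def[abs_def] p_def[abs_def] by (auto intro!: continuous_intros simp: v[THEN less_imp_neq, symmetric])
  have [measurable]: "q \<in> borel_measurable borel" "p \<in> borel_measurable borel"
    using contq contp by (auto intro: borel_measurable_continuous_onI)
  have ortho: "b \<bullet> c = (if b = c then 1 else 0)" if "b \<in> B" "c \<in> B" for b c
    using B that by (auto simp: pairwise_def orthogonal_def norm_eq_1)
  \<comment> \<open>Along a direction of B both \<open>q\<close> and the squared norm are quadratic
    polynomials in t, which reduces the directional derivatives to calculus in one variable.\<close>
  have qshift: "q (x + t *\<^sub>R b) = q x + 2 * t * (x \<bullet> b) + t\<^sup>2" if b: "b \<in> B" for x t b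
  proof -
    have "q (x + t *\<^sub>R b) = (\<Sum>c\<in>B. (x \<bullet> c)\<^sup>2 + (if c = b then 2 * t * (x \<bullet> b) + t\<^sup>2 else 0))"
      unfolding q_def using b
      by (intro sum.cong) (auto simp: inner_add_left ortho power2_eq_square algebra_simps)
    also have "\<dots> = q x + 2 * t * (x \<bullet> b) + t\<^sup>2"
      using fin b by (simp add: sum.distrib q_def)
    finally show ?thesis .
  qed
  have pshift: "p (x + t *\<^sub>R b) = exp (- ((norm x)\<^sup>2 + 2 * t * (x \<bullet> b) + t\<^sup>2) / v)" if b: "b \<in> B" for x t b
  proof -
    have "(norm (x + t *\<^sub>R b))\<^sup>2 = (norm x)\<^sup>2 + 2 * t * (x \<bullet> b) + t\<^sup>2 * (b \<bullet> b)"
      by (simp only: power2_norm_eq_inner) (simp add: inner_add_left inner_add_right inner_commute power2_eq_square)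
    then show ?thesis using ortho[OF b b] by (simp add: p_def)
  qed
  have coord: "(x \<bullet> b)\<^sup>2 \<le> q x" if "b \<in> B" for x b
    unfolding q_def using that fin by (intro member_le_sum) auto
  define D where "D = real (card B)"
  have D: "2 < D" using d by (simp add: D_def)
  define Z where "Z = (\<integral>x. p x \<partial>lborel)"
  \<comment> \<open>Adding \<epsilon> removes the singularity of the field where \<open>q\<close>
    vanishes. The bound does not contain \<epsilon> and so survives the limit.\<close>
  have key: "(\<integral>\<^sup>+x. ennreal (p x / (q x + \<epsilon>)) \<partial>lborel) \<le> ennreal (2 / (v * (D - 2)) * Z)"
    if e: "0 < \<epsilon>" for \<epsilon>
  proof -
    have qe: "0 < q x + \<epsilon>" for x using q0[of x] e by simp
    have qe': "q x + \<epsilon> \<noteq> 0" for x using qe[of x] by simp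
    define F where "F b x = (x \<bullet> b) / (q x + \<epsilon>) * p x" for b x
    define F' where "F' b x = (1 / (q x + \<epsilon>) - 2 * (x \<bullet> b)\<^sup>2 / (q x + \<epsilon>)\<^sup>2
       - 2 * (x \<bullet> b)\<^sup>2 / (v * (q x + \<epsilon>))) * p x" for b x
    \<comment> \<open>Every integrand below is a bounded continuous factor times the Gaussian
      \<open>p\<close>.\<close>
    have bnd: "integrable lborel (\<lambda>x. g x * p x)"
      if "continuous_on UNIV g" "\<And>x. \<bar>g x\<bar> \<le> K" for g :: "'a \<Rightarrow> real" and K
    proof (rule Bochner_Integration.integrable_bound)
      show "integrable lborel (\<lambda>x. K * p x)" using intp by simp
      show "(\<lambda>x. g x * p x) \<in> borel_measurable lborel"
        using that(1) contp by (simp add: borel_measurable_continuous_onI continuous_on_mult)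
      show "AE x in lborel. norm (g x * p x) \<le> norm (K * p x)"
        using that(2) p0 by (intro AE_I2) (auto simp: abs_mult intro!: mult_right_mono order_trans[OF that(2)])
    qed
    have coordq: "(x \<bullet> b)\<^sup>2 / (q x + \<epsilon>) \<le> 1" if "b \<in> B" for x b
      using coord[OF that, of x] qe[of x] e by simp
    have inve: "1 / (q x + \<epsilon>) \<le> 1 / \<epsilon>" for x using q0[of x] e by (simp add: frac_le)
    have iF: "integrable lborel (F b)" if b: "b \<in> B" for b
      unfolding F_def[abs_def]
    proof (rule bnd)
      show "continuous_on UNIV (\<lambda>x. x \<bullet> b / (q x + \<epsilon>))"
        by (intro continuous_intros contq) (simp add: qe')
      \<comment> \<open>The numerator is bounded through |s| <= 1 + s^2, whose two terms give the
        two summands 1 / \<epsilon> and 1.\<close>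
      show "\<bar>x \<bullet> b / (q x + \<epsilon>)\<bar> \<le> 1 / \<epsilon> + 1" for x
      proof -
        have "\<bar>x \<bullet> b\<bar> \<le> 1 + (x \<bullet> b)\<^sup>2"
          using zero_le_power2[of "\<bar>x \<bullet> b\<bar> - 1"] abs_ge_zero[of "x \<bullet> b"] by (simp add: power2_diff)
        then have "\<bar>x \<bullet> b\<bar> / (q x + \<epsilon>) \<le> (1 + (x \<bullet> b)\<^sup>2) / (q x + \<epsilon>)"
          using qe[of x] by (simp add: divide_right_mono)
        also have "\<dots> \<le> 1 / \<epsilon> + 1" using coordq[OF b, of x] inve[of x] by (simp add: add_divide_distrib)
        finally show ?thesis using abs_div_pos[OF qe, of "x \<bullet> b" x] by linarith
      qed
    qed
    have cF': "continuous_on UNIV (F' b)" for b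
      unfolding F'_def[abs_def] using v by (intro continuous_intros contq contp) (auto simp: qe')
    have iF': "integrable lborel (F' b)" if b: "b \<in> B" for b
      unfolding F'_def[abs_def]
    proof (rule bnd)
      show "continuous_on UNIV (\<lambda>x. 1 / (q x + \<epsilon>) - 2 * (x \<bullet> b)\<^sup>2 / (q x + \<epsilon>)\<^sup>2 - 2 * (x \<bullet> b)\<^sup>2 / (v * (q x + \<epsilon>)))"
        using v by (intro continuous_intros contq) (auto simp: qe')
      fix x
      have a: "0 \<le> 1 / (q x + \<epsilon>)" "1 / (q x + \<epsilon>) \<le> 1 / \<epsilon>" using inve[of x] qe[of x] by auto
      have c: "0 \<le> (x \<bullet> b)\<^sup>2 / (q x + \<epsilon>)" "(x \<bullet> b)\<^sup>2 / (q x + \<epsilon>) \<le> 1"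
        using coordq[OF b, of x] qe[of x] by auto
      have "((x \<bullet> b)\<^sup>2 / (q x + \<epsilon>)) * (1 / (q x + \<epsilon>)) \<le> 1 * (1 / \<epsilon>)"
        using a c by (intro mult_mono) auto
      then have m: "2 * (x \<bullet> b)\<^sup>2 / (q x + \<epsilon>)\<^sup>2 \<le> 2 / \<epsilon>" "0 \<le> 2 * (x \<bullet> b)\<^sup>2 / (q x + \<epsilon>)\<^sup>2"
        by (auto simp: power2_eq_square[of "q x + \<epsilon>"])
      have "2 / v * ((x \<bullet> b)\<^sup>2 / (q x + \<epsilon>)) \<le> 2 / v * 1" using c v by (intro mult_left_mono) auto
      then have "2 * (x \<bullet> b)\<^sup>2 / (v * (q x + \<epsilon>)) \<le> 2 / v" "0 \<le> 2 * (x \<bullet> b)\<^sup>2 / (v * (q x + \<epsilon>))"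
        using v qe[of x] by auto
      with a m show "\<bar>1 / (q x + \<epsilon>) - 2 * (x \<bullet> b)\<^sup>2 / (q x + \<epsilon>)\<^sup>2 - 2 * (x \<bullet> b)\<^sup>2 / (v * (q x + \<epsilon>))\<bar>
          \<le> 1 / \<epsilon> + 2 / \<epsilon> + 2 / v" unfolding abs_le_iff by linarith
    qed
    have der: "((\<lambda>t. F b (x + t *\<^sub>R b)) has_real_derivative F' b x) (at 0)" if b: "b \<in> B" for b x
    proof -
      define s where "s = x \<bullet> b"
      have "(\<lambda>t. F b (x + t *\<^sub>R b)) = (\<lambda>t. (s + t) / (q x + 2 * t * s + t\<^sup>2 + \<epsilon>)
           * exp (- ((norm x)\<^sup>2 + 2 * t * s + t\<^sup>2) / v))"
        using b ortho[OF b b] by (auto simp: F_def qshift pshift s_def inner_add_left)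
      moreover have "((\<lambda>t. (s + t) / (q x + 2 * t * s + t\<^sup>2 + \<epsilon>)
           * exp (- ((norm x)\<^sup>2 + 2 * t * s + t\<^sup>2) / v)) has_real_derivative F' b x) (at 0)"
      proof -
        have 1: "((\<lambda>t. (s + t) / (q x + 2 * t * s + t\<^sup>2 + \<epsilon>)) has_real_derivative
            (q x + \<epsilon> - s * (2 * s)) / ((q x + \<epsilon>) * (q x + \<epsilon>))) (at 0)"
          using qe'[of x] by (auto intro!: derivative_eq_intros)
        have 2: "((\<lambda>t. exp (- ((norm x)\<^sup>2 + 2 * t * s + t\<^sup>2) / v)) has_real_derivative
            p x * (- (2 * s) / v)) (at 0)"
          using v by (auto intro!: derivative_eq_intros simp: p_def)
        have 3: "(q x + \<epsilon> - s * (2 * s)) / ((q x + \<epsilon>) * (q x + \<epsilon>))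
            = 1 / (q x + \<epsilon>) - 2 * s\<^sup>2 / (q x + \<epsilon>)\<^sup>2"
          using qe'[of x] by (simp add: power2_eq_square diff_divide_distrib)
        show ?thesis
          by (rule DERIV_cong[OF DERIV_mult[OF 1[unfolded 3] 2]])
            (simp add: F'_def p_def s_def[symmetric] left_diff_distrib right_diff_distrib power2_eq_square[of s] mult_ac)
      qed
      ultimately show ?thesis by simp
    qed
    define G where "G x = (\<Sum>b\<in>B. F' b x)" for x
    have iG: "integrable lborel G" unfolding G_def[abs_def] by (intro Bochner_Integration.integrable_sum iF')
    have G0: "(\<integral>x. G x \<partial>lborel) = 0"
      unfolding G_def using der iF iF' cF'
      by (subst Bochner_Integration.integral_sum) (auto intro!: sum.neutral integral_directional_derivative_eq_0[where F="F _"])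
    have Geq: "G x = (D / (q x + \<epsilon>) - 2 * q x / (q x + \<epsilon>)\<^sup>2 - 2 * q x / (v * (q x + \<epsilon>))) * p x" for x
      unfolding G_def F'_def
      by (simp add: sum_subtractf sum_distrib_right[symmetric] sum_divide_distrib[symmetric]
          sum_distrib_left[symmetric] q_def[symmetric] D_def)
    \<comment> \<open>Since q / (q + \<epsilon>) <= 1, differentiating the denominator costs at most
      2 of the \<open>D\<close> copies of 1 / (q + \<epsilon>), and differentiating the Gaussian
      costs at most 2 / v. As \<open>G\<close> has integral 0, what remains bounds the wanted
      integral.\<close>
    have le: "(D - 2) * (p x / (q x + \<epsilon>)) \<le> G x + 2 / v * p x" for x
    proof -
      have r: "0 \<le> q x / (q x + \<epsilon>)" "q x / (q x + \<epsilon>) \<le> 1" using q0[of x] qe[of x] e by auto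
      have "2 * (q x / (q x + \<epsilon>)) \<le> 2" using r(2) by linarith
      from mult_right_mono[OF this, of "1 / (q x + \<epsilon>)"] qe[of x]
      have "2 * (q x / (q x + \<epsilon>)) * (1 / (q x + \<epsilon>)) \<le> 2 * (1 / (q x + \<epsilon>))" by simp
      then have 1: "2 * q x / (q x + \<epsilon>)\<^sup>2 \<le> 2 / (q x + \<epsilon>)" by (simp add: power2_eq_square)
      have "2 / v * (q x / (q x + \<epsilon>)) \<le> 2 / v * 1" using r v by (intro mult_left_mono) auto
      then have 2: "2 * q x / (v * (q x + \<epsilon>)) \<le> 2 / v" by simp
      have "(D - 2) / (q x + \<epsilon>) \<le> D / (q x + \<epsilon>) - 2 * q x / (q x + \<epsilon>)\<^sup>2 - 2 * q x / (v * (q x + \<epsilon>)) + 2 / v"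
        using 1 2 by (simp add: diff_divide_distrib)
      from mult_right_mono[OF this, of "p x"] p0[of x] show ?thesis
        by (simp add: Geq algebra_simps)
    qed
    have ipq: "integrable lborel (\<lambda>x. (1 / (q x + \<epsilon>)) * p x)"
      using inve qe by (intro bnd[where K="1 / \<epsilon>"]) (auto intro!: continuous_intros contq simp: qe' abs_of_pos)
    then have ipq': "integrable lborel (\<lambda>x. p x / (q x + \<epsilon>))" by (simp add: field_simps)
    have "(\<integral>x. (D - 2) * (p x / (q x + \<epsilon>)) \<partial>lborel) \<le> (\<integral>x. G x + 2 / v * p x \<partial>lborel)"
      by (intro integral_mono Bochner_Integration.integrable_add integrable_mult_right ipq' iG intp le)
    also have "\<dots> = 2 / v * Z" using iG intp G0 by (simp add: Z_def)
    finally have "(D - 2) * (\<integral>x. p x / (q x + \<epsilon>) \<partial>lborel) \<le> 2 / v * Z"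
      by (simp only: integral_mult_right_zero)
    then have "(\<integral>x. p x / (q x + \<epsilon>) \<partial>lborel) \<le> 2 / (v * (D - 2)) * Z"
      using D v by (simp add: field_simps)
    then show ?thesis
      using ipq' p0 qe by (subst nn_integral_eq_integral) (auto intro!: ennreal_leI divide_nonneg_nonneg less_imp_le[OF p0] less_imp_le[OF qe])
  qed
  \<comment> \<open>Where \<open>q x = 0\<close> the limit is top, matching the value of
    \<open>inverse\<close> there; the pointwise limit therefore holds everywhere, and Fatou's lemma
    transfers the uniform bound.\<close>
  have lim: "(\<lambda>n. ennreal (p x / (q x + 1 / real (Suc n)))) \<longlonglongrightarrow> ennreal (p x) * inverse (ennreal (q x))" for x
  proof (cases "q x = 0")
    case True
    have "filterlim (\<lambda>n. p x * real (Suc n)) at_top sequentially"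
      by (rule filterlim_tendsto_pos_mult_at_top[OF tendsto_const p0]) 
         (rule filterlim_compose[OF filterlim_real_sequentially filterlim_Suc])
    then have "(\<lambda>n. ennreal (p x * real (Suc n))) \<longlonglongrightarrow> top"
      by (simp add: ennreal_tendsto_top_eq_at_top)
    then show ?thesis using True p0[of x] by (simp add: ennreal_mult_top)
  next
    case False
    then have "0 < q x" using q0[of x] by simp
    have "(\<lambda>n. p x / (q x + 1 / real (Suc n))) \<longlonglongrightarrow> p x / (q x + 0)"
      using False by (intro tendsto_intros LIMSEQ_inverse_real_of_nat[simplified inverse_eq_divide]) auto
    then have "(\<lambda>n. ennreal (p x / (q x + 1 / real (Suc n)))) \<longlonglongrightarrow> ennreal (p x / q x)"
      by (intro tendsto_ennrealI) simp
    then show ?thesis using \<open>0 < q x\<close> p0[of x] 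
      by (simp add: inverse_ennreal divide_inverse ennreal_mult'')
  qed
  have "(\<integral>\<^sup>+x. ennreal (p x) * inverse (ennreal (q x)) \<partial>lborel)
     = (\<integral>\<^sup>+x. liminf (\<lambda>n. ennreal (p x / (q x + 1 / real (Suc n)))) \<partial>lborel)"
    using lim by (intro nn_integral_cong) (metis lim_imp_Liminf trivial_limit_sequentially)
  also have "\<dots> \<le> liminf (\<lambda>n. \<integral>\<^sup>+x. ennreal (p x / (q x + 1 / real (Suc n))) \<partial>lborel)"
    by (rule nn_integral_liminf) simp
  also have "\<dots> \<le> ennreal (2 / (v * (D - 2)) * Z)"
    using key by (intro Liminf_le) auto
  finally show ?thesis by (simp add: p_def q_def Z_def D_def)
qed

text \<open>The derivative of (x . u) p(x) in direction u is |u|^2 p - (2 / v) (x . u)^2 p, and its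
  integral is 0. For integrability, t <= exp t trades the quadratic factor for half of the exponent;
  the dominating Gaussian has parameter 2 v, which is why integrability is assumed for all
  parameters.\<close>

lemma gaussian_integral_inner_sq:
  fixes u :: "'a::euclidean_space" and v :: real
  assumes v: "0 < v"
    and int: "\<And>v. 0 < v \<Longrightarrow> integrable lborel (\<lambda>x::'a. exp (- (norm x)\<^sup>2 / v))"
  shows "integrable lborel (\<lambda>x. (x \<bullet> u)\<^sup>2 * exp (- (norm x)\<^sup>2 / v))"
    and "(\<integral>x. (x \<bullet> u)\<^sup>2 * exp (- (norm x)\<^sup>2 / v) \<partial>lborel)
      = v / 2 * (norm u)\<^sup>2 * (\<integral>x. exp (- (norm (x::'a))\<^sup>2 / v) \<partial>lborel)"
proof -
  define p where "p x = exp (- (norm x)\<^sup>2 / v)" for x :: 'a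
  have intp: "integrable lborel p" using int[OF v] by (simp add: p_def[abs_def])
  have contp: "continuous_on UNIV p"
    unfolding p_def[abs_def] using v by (auto intro!: continuous_intros)
  have [measurable]: "p \<in> borel_measurable borel"
    using contp by (rule borel_measurable_continuous_onI)
  have i2: "integrable lborel (\<lambda>x. (x \<bullet> u)\<^sup>2 * p x)"
  proof (rule Bochner_Integration.integrable_bound)
    show "integrable lborel (\<lambda>x. (norm u)\<^sup>2 * (2 * v) * exp (- (norm (x::'a))\<^sup>2 / (2 * v)))"
      using int[of "2 * v"] v by simp
    show "(\<lambda>x. (x \<bullet> u)\<^sup>2 * p x) \<in> borel_measurable lborel" by measurable
    show "AE x in lborel. norm ((x \<bullet> u)\<^sup>2 * p x) \<le> norm ((norm u)\<^sup>2 * (2 * v) * exp (- (norm (x::'a))\<^sup>2 / (2 * v)))"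
    proof (rule AE_I2)
      fix x :: 'a
      define t where "t = (norm x)\<^sup>2 / (2 * v)"
      have "(x \<bullet> u)\<^sup>2 \<le> (norm x * norm u)\<^sup>2"
        by (metis Cauchy_Schwarz_ineq2 abs_ge_zero power2_abs power_mono)
      also have "\<dots> = (norm u)\<^sup>2 * (2 * v) * t" using v by (simp add: t_def power_mult_distrib)
      also have "\<dots> \<le> (norm u)\<^sup>2 * (2 * v) * exp t"
        using v order_trans[OF _ exp_ge_add_one_self[of t], of t] by (intro mult_left_mono) auto
      finally have "(x \<bullet> u)\<^sup>2 * p x \<le> (norm u)\<^sup>2 * (2 * v) * exp t * p x"
        by (rule mult_right_mono) (simp add: p_def)
      moreover have "exp t * p x = exp (- (norm x)\<^sup>2 / (2 * v))"
        using v by (simp add: p_def t_def exp_add[symmetric])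
      ultimately have "(x \<bullet> u)\<^sup>2 * p x \<le> (norm u)\<^sup>2 * (2 * v) * exp (- (norm x)\<^sup>2 / (2 * v))"
        by (simp add: mult.assoc)
      then show "norm ((x \<bullet> u)\<^sup>2 * p x) \<le> norm ((norm u)\<^sup>2 * (2 * v) * exp (- (norm (x::'a))\<^sup>2 / (2 * v)))"
        using v by (simp add: p_def abs_mult)
    qed
  qed
  have i1: "integrable lborel (\<lambda>x. (x \<bullet> u) * p x)"
  proof (rule Bochner_Integration.integrable_bound)
    show "integrable lborel (\<lambda>x. p x + (x \<bullet> u)\<^sup>2 * p x)" using intp i2 by simp
    show "(\<lambda>x. (x \<bullet> u) * p x) \<in> borel_measurable lborel" by measurable
    have "\<bar>s\<bar> * p x \<le> (1 + s\<^sup>2) * p x" for s x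
      using zero_le_power2[of "\<bar>s\<bar> - 1"] abs_ge_zero[of s]
      by (intro mult_right_mono) (simp_all add: power2_diff p_def)
    then show "AE x in lborel. norm ((x \<bullet> u) * p x) \<le> norm (p x + (x \<bullet> u)\<^sup>2 * p x)"
      by (intro AE_I2) (auto simp: abs_mult p_def algebra_simps)
  qed
  have "(\<integral>x. (norm u)\<^sup>2 * p x - 2 / v * ((x \<bullet> u)\<^sup>2 * p x) \<partial>lborel) = 0"
  proof (rule integral_directional_derivative_eq_0[where F="\<lambda>x. (x \<bullet> u) * p x" and b=u])
    fix x
    have "(\<lambda>t. ((x + t *\<^sub>R u) \<bullet> u) * p (x + t *\<^sub>R u))
       = (\<lambda>t. (x \<bullet> u + t * (norm u)\<^sup>2) * exp (- ((norm x)\<^sup>2 + 2 * t * (x \<bullet> u) + t\<^sup>2 * (norm u)\<^sup>2) / v))"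
    proof -
      have "(norm (x + t *\<^sub>R u))\<^sup>2 = (norm x)\<^sup>2 + 2 * t * (x \<bullet> u) + t\<^sup>2 * (norm u)\<^sup>2" for t
        unfolding power2_norm_eq_inner
        by (simp add: inner_add_left inner_add_right inner_commute power2_eq_square)
      then show ?thesis by (simp add: p_def inner_add_left power2_norm_eq_inner[of u])
    qed
    moreover have "((\<lambda>t. (x \<bullet> u + t * (norm u)\<^sup>2) * exp (- ((norm x)\<^sup>2 + 2 * t * (x \<bullet> u) + t\<^sup>2 * (norm u)\<^sup>2) / v))
        has_real_derivative ((norm u)\<^sup>2 * p x - 2 / v * ((x \<bullet> u)\<^sup>2 * p x))) (at 0)"
      using v by (auto intro!: derivative_eq_intros simp: p_def power2_eq_square[of "x \<bullet> u"] algebra_simps)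
    ultimately show "((\<lambda>t. ((x + t *\<^sub>R u) \<bullet> u) * p (x + t *\<^sub>R u)) has_real_derivative
        ((norm u)\<^sup>2 * p x - 2 / v * ((x \<bullet> u)\<^sup>2 * p x))) (at 0)" by simp
  qed (use i1 i2 intp contp v in \<open>auto intro!: continuous_intros\<close>)
  then have "(norm u)\<^sup>2 * (\<integral>x. p x \<partial>lborel) = 2 / v * (\<integral>x. (x \<bullet> u)\<^sup>2 * p x \<partial>lborel)"
    using i2 intp by (simp del: times_divide_eq_left)
  then show "integrable lborel (\<lambda>x. (x \<bullet> u)\<^sup>2 * exp (- (norm x)\<^sup>2 / v))"
    "(\<integral>x. (x \<bullet> u)\<^sup>2 * exp (- (norm x)\<^sup>2 / v) \<partial>lborel)
      = v / 2 * (norm u)\<^sup>2 * (\<integral>x. exp (- (norm (x::'a))\<^sup>2 / v) \<partial>lborel)"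
    using v i2 by (auto simp: p_def[abs_def] field_simps)
qed

section \<open>Complex normal vectors\<close>

text \<open>Boxes determine Lebesgue measure. This turns the definition by a pair of real variables
  into a density on the complex plane.\<close>

lemma distr_lborel_Complex:
  "distr (lborel \<Otimes>\<^sub>M lborel) borel (\<lambda>(x, y). Complex x y) = (lborel :: complex measure)"
proof (rule lborel_eqI[symmetric])
  have meas: "(\<lambda>(x, y). Complex x y) \<in> borel \<Otimes>\<^sub>M borel \<rightarrow>\<^sub>M borel"
    unfolding borel_prod Complex_eq split_def
    by (intro borel_measurable_continuous_onI continuous_intros)
  fix l u :: complex assume le: "\<And>b. b \<in> Basis \<Longrightarrow> l \<bullet> b \<le> u \<bullet> b"
  have le': "Re l \<le> Re u" "Im l \<le> Im u"
    using le[of 1] le[of \<i>] by (auto simp: Basis_complex_def inner_complex_def)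
  have "emeasure (distr (lborel \<Otimes>\<^sub>M lborel) borel (\<lambda>(x, y). Complex x y)) (box l u)
     = emeasure (lborel \<Otimes>\<^sub>M lborel) ({Re l<..<Re u} \<times> {Im l<..<Im u})"
    using meas by (subst emeasure_distr) (auto intro!: arg_cong[where f="emeasure _"]
        simp: space_pair_measure box_def Basis_complex_def inner_complex_def)
  also have "\<dots> = ennreal (Re u - Re l) * ennreal (Im u - Im l)"
    using le' by (subst lborel.emeasure_pair_measure_Times) auto
  also have "\<dots> = ennreal (\<Prod>b\<in>Basis. (u - l) \<bullet> b)"
    using le' by (simp add: Basis_complex_def inner_complex_def ennreal_mult'')
  finally show "emeasure (distr (lborel \<Otimes>\<^sub>M lborel) borel (\<lambda>(x, y). Complex x y)) (box l u)
     = ennreal (\<Prod>b\<in>Basis. (u - l) \<bullet> b)" .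
qed simp

section \<open>Measurability and Lebesgue measure on spaces of vectors\<close>

lemma borel_measurable_vec_lambda:
  fixes f :: "'w \<Rightarrow> 'i::finite \<Rightarrow> 'a::euclidean_space"
  assumes "\<And>i. (\<lambda>x. f x i) \<in> borel_measurable M"
  shows "(\<lambda>x. \<chi> i. f x i) \<in> borel_measurable M"
  by (rule borel_measurable_euclidean_space[THEN iffD2])
    (use assms in \<open>auto simp: Basis_vec_def inner_axis\<close>)

lemma borel_measurable_vec_nth [measurable (raw)]:
  fixes f :: "'w \<Rightarrow> 'a::euclidean_space ^ 'i::finite"
  assumes "f \<in> borel_measurable M"
  shows "(\<lambda>x. f x $ i) \<in> borel_measurable M"
  by (rule measurable_compose[OF assms])
    (auto intro!: borel_measurable_continuous_onI continuous_intros)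

lemma measurable_vec_lambda_PiM [measurable]:
  "vec_lambda \<in> (\<Pi>\<^sub>M i\<in>(UNIV :: 'i::finite set). (borel :: 'a::euclidean_space measure)) \<rightarrow>\<^sub>M borel"
  using borel_measurable_vec_lambda[of "\<lambda>x i. x i" "\<Pi>\<^sub>M i\<in>UNIV. borel"] by simp

lemma distr_PiM_lborel_vec_lambda:
  "distr (\<Pi>\<^sub>M i\<in>(UNIV :: 'i::finite set). lborel) borel vec_lambda = (lborel :: ('a::euclidean_space ^ 'i) measure)"
proof (rule lborel_eqI[symmetric])
  interpret product_sigma_finite "\<lambda>_::'i. lborel :: 'a measure" ..
  have sets: "sets (\<Pi>\<^sub>M i\<in>(UNIV :: 'i::finite set). (lborel :: 'a measure)) = sets (\<Pi>\<^sub>M i\<in>UNIV. borel)"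
    by (intro sets_PiM_cong) auto
  have meas: "vec_lambda \<in> (\<Pi>\<^sub>M i\<in>(UNIV :: 'i::finite set). (lborel :: 'a measure)) \<rightarrow>\<^sub>M borel"
    using measurable_vec_lambda_PiM measurable_cong_sets[OF sets refl] by blast
  fix l u :: "'a ^ 'i" assume le: "\<And>b. b \<in> Basis \<Longrightarrow> l \<bullet> b \<le> u \<bullet> b"
  have le': "l $ i \<bullet> b \<le> u $ i \<bullet> b" if "b \<in> Basis" for i b
    using le[of "axis i b"] that by (auto simp: Basis_vec_def inner_axis)
  have "emeasure (distr (\<Pi>\<^sub>M i\<in>(UNIV :: 'i::finite set). lborel) borel vec_lambda) (box l u)
     = emeasure (\<Pi>\<^sub>M i\<in>(UNIV :: 'i set). lborel) (\<Pi>\<^sub>E i\<in>UNIV. box (l $ i) (u $ i))"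
    using meas by (subst emeasure_distr) (auto intro!: arg_cong[where f="emeasure _"]
        simp: space_PiM box_def Basis_vec_def inner_axis PiE_def Pi_def)
  also have "\<dots> = (\<Prod>i\<in>UNIV. ennreal (\<Prod>b\<in>Basis. (u $ i - l $ i) \<bullet> b))"
    using le' by (subst emeasure_PiM) (auto simp: emeasure_lborel_box_eq inner_diff_left)
  also have "\<dots> = ennreal (\<Prod>i\<in>UNIV. \<Prod>b\<in>Basis. (u $ i - l $ i) \<bullet> b)"
    using le' by (intro prod_ennreal prod_nonneg) (auto simp: inner_diff_left)
  also have "(\<Prod>i\<in>UNIV. \<Prod>b\<in>Basis. (u $ i - l $ i) \<bullet> b) = (\<Prod>b\<in>Basis. (u - l) \<bullet> b)"
  proof -
    have "(\<Prod>b\<in>Basis. (u - l) \<bullet> b) = (\<Prod>i\<in>UNIV. \<Prod>b\<in>(\<Union>u\<in>Basis. {axis i u}). (u - l) \<bullet> b)"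
      unfolding Basis_vec_def by (intro prod.UNION_disjoint) (auto simp: axis_eq_axis)
    also have "\<dots> = (\<Prod>i\<in>UNIV. \<Prod>b\<in>axis i ` Basis. (u - l) \<bullet> b)"
      by (intro prod.cong) auto
    also have "\<dots> = (\<Prod>i\<in>UNIV. \<Prod>b\<in>Basis. (u $ i - l $ i) \<bullet> b)"
      by (intro prod.cong refl, subst prod.reindex) (auto simp: inj_on_def axis_eq_axis inner_axis)
    finally show ?thesis ..
  qed
  finally show "emeasure (distr (\<Pi>\<^sub>M i\<in>(UNIV :: 'i set). lborel) borel vec_lambda) (box l u)
     = ennreal (\<Prod>b\<in>Basis. (u - l) \<bullet> b)" .
qed simp

text \<open>Linear change of variables: the power of |c| is the Jacobian of scaling in real
  dimension DIM.\<close>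

lemma density_lborel_eq_distr_scaleR:
  fixes f :: "'a::euclidean_space \<Rightarrow> ennreal"
  assumes "c \<noteq> 0" and [measurable]: "f \<in> borel_measurable borel"
  shows "density lborel f = distr (density lborel (\<lambda>x. ennreal (\<bar>c\<bar> ^ DIM('a)) * f (c *\<^sub>R x))) borel (\<lambda>x. c *\<^sub>R x)"
proof -
  have "density lborel f = density (density (distr lborel borel (\<lambda>x. c *\<^sub>R x)) (\<lambda>_. ennreal (\<bar>c\<bar> ^ DIM('a)))) f"
    using lborel_affine[OF assms(1), of "0::'a"] by simp
  also have "\<dots> = density (distr lborel borel (\<lambda>x. c *\<^sub>R x)) (\<lambda>x. ennreal (\<bar>c\<bar> ^ DIM('a)) * f x)"
    by (rule density_density_eq) auto
  also have "\<dots> = distr (density lborel (\<lambda>x. ennreal (\<bar>c\<bar> ^ DIM('a)) * f (c *\<^sub>R x))) borel (\<lambda>x. c *\<^sub>R x)"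
    by (rule density_distr) auto
  finally show ?thesis .
qed

lemma measurable_Complex_scale [measurable]:
  "(\<lambda>(x, y). Complex (c * x) (c * y)) \<in> borel \<Otimes>\<^sub>M borel \<rightarrow>\<^sub>M borel"
  unfolding borel_prod Complex_eq split_def
  by (intro borel_measurable_continuous_onI continuous_intros)

lemma measurable_Complex_pair [measurable]: "(\<lambda>(x, y). Complex x y) \<in> borel \<Otimes>\<^sub>M borel \<rightarrow>\<^sub>M borel"
  using measurable_Complex_scale[of 1] by simp

lemma sets_complex_normal [simp, measurable_cong]: "sets (complex_normal v) = sets borel"
  by (simp add: complex_normal_def)

lemma sets_complex_normal_vec [simp, measurable_cong]: "sets (complex_normal_vec v) = sets borel"
  by (simp add: complex_normal_vec_def)

lemma prob_space_complex_normal: "prob_space (complex_normal v)"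
proof -
  interpret P: prob_space "density lborel (\<lambda>x. ennreal (std_normal_density x))"
    by (rule prob_space_normal_density) simp
  interpret PP: pair_prob_space "density lborel (\<lambda>x. ennreal (std_normal_density x))"
    "density lborel (\<lambda>x. ennreal (std_normal_density x))" ..
  show ?thesis unfolding complex_normal_def
    by (rule PP.prob_space_distr) simp
qed

lemma measurable_vec_lambda_complex_normal:
  "vec_lambda \<in> (\<Pi>\<^sub>M i\<in>(UNIV :: 'i::finite set). complex_normal v) \<rightarrow>\<^sub>M borel"
proof -
  have "sets (\<Pi>\<^sub>M i\<in>(UNIV :: 'i::finite set). complex_normal v) = sets (\<Pi>\<^sub>M i\<in>UNIV. borel)"
    by (intro sets_PiM_cong) auto
  then show ?thesis using measurable_vec_lambda_PiM measurable_cong_sets by blast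
qed

lemma prob_space_complex_normal_vec: "prob_space (complex_normal_vec v)"
  unfolding complex_normal_vec_def
  by (intro prob_space.prob_space_distr prob_space_PiM prob_space_complex_normal
      measurable_vec_lambda_complex_normal)

text \<open>Real and imaginary part have variance v / 2 each, so the exponents add up to -|z|^2 / v
  and the constant is 1 / (2 pi (v / 2)).\<close>

lemma complex_normal_eq_density:
  assumes v: "0 < v"
  shows "complex_normal v = density lborel (\<lambda>z. ennreal (1 / (pi * v) * exp (- (cmod z)\<^sup>2 / v)))"
proof -
  define c where "c = sqrt (v / 2)"
  have c: "c \<noteq> 0" "c\<^sup>2 = v / 2" using v by (auto simp: c_def)
  define f where "f z = ennreal (1 / (pi * v) * exp (- (cmod z)\<^sup>2 / v))" for z
  define N where "N = density lborel (\<lambda>x. ennreal (std_normal_density x))"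
  interpret N: prob_space N unfolding N_def by (rule prob_space_normal_density) simp
  have [measurable]: "f \<in> borel_measurable borel" unfolding f_def[abs_def] by measurable
  \<comment> \<open>Pulled back along the scaling by the standard deviation \<open>c\<close>, with
    Jacobian v / 2, the density factors into two standard normal ones.\<close>
  have dens: "ennreal (\<bar>c\<bar> ^ DIM(complex)) * f (c *\<^sub>R Complex x y) = ennreal (std_normal_density x) * ennreal (std_normal_density y)" for x y
  proof -
    have "\<bar>c\<bar> ^ DIM(complex) = v / 2" using c by simp
    moreover have "v / 2 * (1 / (pi * v) * exp (- (cmod (c *\<^sub>R Complex x y))\<^sup>2 / v)) = std_normal_density x * std_normal_density y"
    proof -
      have "(cmod (c *\<^sub>R Complex x y))\<^sup>2 = v / 2 * (x\<^sup>2 + y\<^sup>2)"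
        unfolding cmod_power2 by (simp add: power_mult_distrib c distrib_left)
      then have "v / 2 * (1 / (pi * v) * exp (- (cmod (c *\<^sub>R Complex x y))\<^sup>2 / v)) = 1 / (2 * pi) * exp (- (x\<^sup>2 + y\<^sup>2) / 2)"
        using v by (simp add: field_simps)
      also have "\<dots> = std_normal_density x * std_normal_density y"
        by (simp add: std_normal_density_def exp_add[symmetric] field_simps real_sqrt_mult[symmetric])
      finally show ?thesis .
    qed
    ultimately have "\<bar>c\<bar> ^ DIM(complex) * (1 / (pi * v) * exp (- (cmod (c *\<^sub>R Complex x y))\<^sup>2 / v))
        = std_normal_density x * std_normal_density y" by (simp only:)
    moreover have "ennreal (\<bar>c\<bar> ^ DIM(complex)) * f (c *\<^sub>R Complex x y)
        = ennreal (\<bar>c\<bar> ^ DIM(complex) * (1 / (pi * v) * exp (- (cmod (c *\<^sub>R Complex x y))\<^sup>2 / v)))"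
      unfolding f_def by (rule ennreal_mult'[symmetric]) simp
    ultimately show ?thesis by (simp only: ennreal_mult'[OF normal_density_nonneg])
  qed
  have "density lborel f = distr (density lborel (\<lambda>z. ennreal (\<bar>c\<bar> ^ DIM(complex)) * f (c *\<^sub>R z))) borel (\<lambda>z. c *\<^sub>R z)"
    by (rule density_lborel_eq_distr_scaleR) (use c in auto)
  also have "density lborel (\<lambda>z. ennreal (\<bar>c\<bar> ^ DIM(complex)) * f (c *\<^sub>R z))
     = density (distr (lborel \<Otimes>\<^sub>M lborel) borel (\<lambda>(x, y). Complex x y)) (\<lambda>z. ennreal (\<bar>c\<bar> ^ DIM(complex)) * f (c *\<^sub>R z))"
    by (simp add: distr_lborel_Complex)
  also have "\<dots> = distr (density (lborel \<Otimes>\<^sub>M lborel) (\<lambda>p. ennreal (\<bar>c\<bar> ^ DIM(complex)) * f (c *\<^sub>R (case p of (x, y) \<Rightarrow> Complex x y)))) borel (\<lambda>(x, y). Complex x y)"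
    by (rule density_distr) auto
  also have "(\<lambda>p. ennreal (\<bar>c\<bar> ^ DIM(complex)) * f (c *\<^sub>R (case p of (x, y) \<Rightarrow> Complex x y)))
      = (\<lambda>(x, y). ennreal (std_normal_density x) * ennreal (std_normal_density y))"
    using dens by (auto simp: fun_eq_iff)
  also have "density (lborel \<Otimes>\<^sub>M lborel) (\<lambda>(x, y). ennreal (std_normal_density x) * ennreal (std_normal_density y)) = N \<Otimes>\<^sub>M N"
    unfolding N_def
    by (rule pair_measure_density[symmetric]) (auto intro: lborel.sigma_finite_measure_axioms N.sigma_finite_measure_axioms[unfolded N_def])
  also have "distr (distr (N \<Otimes>\<^sub>M N) borel (\<lambda>(x, y). Complex x y)) borel (\<lambda>z. c *\<^sub>R z) = complex_normal v"
    unfolding complex_normal_def N_def[symmetric]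
  proof (subst distr_distr)
    have "(\<lambda>z. c *\<^sub>R z) \<circ> (\<lambda>(x, y). Complex x y) = (\<lambda>(x, y). Complex (sqrt (v / 2) * x) (sqrt (v / 2) * y))"
      by (auto simp: fun_eq_iff complex_eq_iff c_def)
    then show "distr (N \<Otimes>\<^sub>M N) borel ((\<lambda>z. c *\<^sub>R z) \<circ> (\<lambda>(x, y). Complex x y)) = distr (N \<Otimes>\<^sub>M N) borel (\<lambda>(x, y). Complex (sqrt (v / 2) * x) (sqrt (v / 2) * y))"
      by (simp only:)
  qed (simp_all add: N_def)
  finally show ?thesis by (simp add: f_def[abs_def])
qed

text \<open>A density of the law only for \<open>0 < v\<close>. At \<open>v = 0\<close>, division by
  zero makes it vanish identically while the law is a point mass, so this case is treated separately
  wherever it can occur.\<close>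

definition cn_density :: "real \<Rightarrow> complex ^ 'n::finite \<Rightarrow> real" where
  "cn_density v x = (1 / (pi * v)) ^ CARD('n) * exp (- (norm x)\<^sup>2 / v)"

lemma cn_density_nonneg: "0 < v \<Longrightarrow> 0 \<le> cn_density v x"
  by (simp add: cn_density_def)

lemma borel_measurable_cn_density [measurable]: "cn_density v \<in> borel_measurable borel"
  unfolding cn_density_def[abs_def] by measurable

lemma complex_normal_vec_eq_density:
  assumes v: "0 < v"
  shows "(complex_normal_vec v :: (complex ^ 'n::finite) measure) = density lborel (\<lambda>x. ennreal (cn_density v x))"
proof -
  define g where "g z = ennreal (1 / (pi * v) * exp (- (cmod z)\<^sup>2 / v))" for z
  have [measurable]: "g \<in> borel_measurable borel" unfolding g_def[abs_def] by measurable
  have cn: "complex_normal v = density lborel g"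
    unfolding g_def[abs_def] by (rule complex_normal_eq_density[OF v])
  interpret P: product_sigma_finite "\<lambda>_::'n. complex_normal v"
    by (intro product_sigma_finite.intro prob_space_imp_sigma_finite prob_space_complex_normal)
  interpret L: product_sigma_finite "\<lambda>_::'n. lborel :: complex measure" ..
  have sets: "sets (\<Pi>\<^sub>M i\<in>(UNIV :: 'n set). (lborel :: complex measure)) = sets (\<Pi>\<^sub>M i\<in>UNIV. borel)"
    by (intro sets_PiM_cong) auto
  have meas: "vec_lambda \<in> (\<Pi>\<^sub>M i\<in>(UNIV :: 'n set). (lborel :: complex measure)) \<rightarrow>\<^sub>M borel"
    using measurable_vec_lambda_PiM measurable_cong_sets[OF sets refl] by blast
  have gprod: "(\<Prod>i\<in>UNIV. g (x $ i)) = ennreal (cn_density v x)" for x :: "complex ^ 'n"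
  proof -
    have "(\<Prod>i\<in>UNIV. g (x $ i)) = ennreal (\<Prod>i\<in>UNIV. 1 / (pi * v) * exp (- (cmod (x $ i))\<^sup>2 / v))"
      unfolding g_def using v by (intro prod_ennreal) auto
    also have "(\<Prod>i\<in>UNIV. 1 / (pi * v) * exp (- (cmod (x $ i))\<^sup>2 / v))
       = (1 / (pi * v)) ^ CARD('n) * exp (\<Sum>i\<in>UNIV. - (cmod (x $ i))\<^sup>2 / v)"
      by (simp only: prod.distrib prod_constant exp_sum finite)
    also have "(\<Sum>i\<in>UNIV. - (cmod (x $ i))\<^sup>2 / v) = - (norm x)\<^sup>2 / v"
      by (simp add: norm_vec_def L2_set_def sum_nonneg sum_negf sum_divide_distrib)
    finally show ?thesis by (simp add: cn_density_def)
  qed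
  have "density (\<Pi>\<^sub>M i\<in>(UNIV :: 'n set). lborel) (\<lambda>x. \<Prod>i\<in>UNIV. g (x i)) = (\<Pi>\<^sub>M i\<in>UNIV. complex_normal v)"
  proof (rule P.PiM_eqI)
    show "sets (density (\<Pi>\<^sub>M i\<in>(UNIV :: 'n set). lborel) (\<lambda>x. \<Prod>i\<in>UNIV. g (x i))) = sets (\<Pi>\<^sub>M i\<in>UNIV. complex_normal v)"
      by (simp, intro sets_PiM_cong) auto
    fix A :: "'n \<Rightarrow> complex set" assume A: "\<And>i. i \<in> UNIV \<Longrightarrow> A i \<in> sets (complex_normal v)"
    then have [measurable]: "A i \<in> sets borel" for i by simp
    have "emeasure (density (\<Pi>\<^sub>M i\<in>(UNIV :: 'n set). lborel) (\<lambda>x. \<Prod>i\<in>UNIV. g (x i))) (Pi\<^sub>E UNIV A)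
      = (\<integral>\<^sup>+x. (\<Prod>i\<in>UNIV. g (x i)) * indicator (Pi\<^sub>E UNIV A) x \<partial>(\<Pi>\<^sub>M i\<in>(UNIV :: 'n set). lborel))"
      by (rule emeasure_density) (auto intro!: sets_PiM_I_finite)
    also have "\<dots> = (\<integral>\<^sup>+x. (\<Prod>i\<in>UNIV. g (x i) * indicator (A i) (x i)) \<partial>(\<Pi>\<^sub>M i\<in>(UNIV :: 'n set). lborel))"
      by (intro nn_integral_cong) (auto simp: indicator_def PiE_iff prod.distrib)
    also have "\<dots> = (\<Prod>i\<in>UNIV. \<integral>\<^sup>+z. g z * indicator (A i) z \<partial>lborel)"
      by (subst L.product_nn_integral_prod) auto
    also have "\<dots> = (\<Prod>i\<in>UNIV. emeasure (complex_normal v) (A i))"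
      unfolding cn by (simp add: emeasure_density)
    finally show "emeasure (density (\<Pi>\<^sub>M i\<in>(UNIV :: 'n set). lborel) (\<lambda>x. \<Prod>i\<in>UNIV. g (x i))) (Pi\<^sub>E UNIV A)
      = (\<Prod>i\<in>UNIV. emeasure (complex_normal v) (A i))" .
  qed simp
  then have "complex_normal_vec v = distr (density (\<Pi>\<^sub>M i\<in>(UNIV :: 'n set). lborel) (\<lambda>x. \<Prod>i\<in>UNIV. g (x i))) borel vec_lambda"
    by (simp add: complex_normal_vec_def)
  also have "(\<lambda>x::'n \<Rightarrow> complex. \<Prod>i\<in>UNIV. g (x i)) = (\<lambda>x. ennreal (cn_density v (vec_lambda x)))"
    by (simp add: gprod[symmetric])
  also have "distr (density (\<Pi>\<^sub>M i\<in>(UNIV :: 'n set). lborel) (\<lambda>x. ennreal (cn_density v (vec_lambda x)))) borel vec_lambda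
    = density (distr (\<Pi>\<^sub>M i\<in>(UNIV :: 'n set). lborel) borel vec_lambda) (\<lambda>x. ennreal (cn_density v x))"
    using meas by (intro density_distr[symmetric]) auto
  finally show ?thesis by (simp add: distr_PiM_lborel_vec_lambda)
qed

lemma nn_integral_complex_normal_vec:
  assumes "0 < v" and [measurable]: "f \<in> borel_measurable borel"
  shows "(\<integral>\<^sup>+x. f x \<partial>complex_normal_vec v) = (\<integral>\<^sup>+x. ennreal (cn_density v x) * f x \<partial>lborel)"
  unfolding complex_normal_vec_eq_density[OF assms(1)] by (rule nn_integral_density) auto

text \<open>The normalisation is read off from the law being a probability measure; the value of the
  multivariate Gaussian integral then follows without computing it.\<close>

lemma cn_density_integral:
  assumes v: "0 < v"
  shows "integrable lborel (cn_density v :: complex ^ 'n::finite \<Rightarrow> real)"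
    and "(\<integral>x. cn_density v (x :: complex ^ 'n) \<partial>lborel) = 1"
proof -
  interpret prob_space "complex_normal_vec v :: (complex ^ 'n) measure"
    by (rule prob_space_complex_normal_vec)
  have 1: "(\<integral>\<^sup>+x. ennreal (cn_density v (x :: complex ^ 'n)) \<partial>lborel) = 1"
    using nn_integral_complex_normal_vec[OF v, of "\<lambda>x :: complex ^ 'n. 1"] emeasure_space_1 by simp
  then show i: "integrable lborel (cn_density v :: complex ^ 'n \<Rightarrow> real)"
    using cn_density_nonneg[OF v] by (intro integrableI_nonneg) auto
  show "(\<integral>x. cn_density v (x :: complex ^ 'n) \<partial>lborel) = 1"
    using 1 cn_density_nonneg[OF v] by (subst integral_eq_nn_integral) auto
qed

lemma integrable_exp_norm_sq:
  assumes v: "0 < v"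
  shows "integrable lborel (\<lambda>x :: complex ^ 'n::finite. exp (- (norm x)\<^sup>2 / v))"
    and "(\<integral>x. exp (- (norm (x :: complex ^ 'n))\<^sup>2 / v) \<partial>lborel) = (pi * v) ^ CARD('n)"
proof -
  have eq: "(\<lambda>x :: complex ^ 'n. exp (- (norm x)\<^sup>2 / v)) = (\<lambda>x. (pi * v) ^ CARD('n) * cn_density v x)"
    using v by (simp add: cn_density_def fun_eq_iff power_divide)
  show "integrable lborel (\<lambda>x :: complex ^ 'n::finite. exp (- (norm x)\<^sup>2 / v))"
    unfolding eq using cn_density_integral(1)[OF v] by (rule integrable_mult_right)
  show "(\<integral>x. exp (- (norm (x :: complex ^ 'n))\<^sup>2 / v) \<partial>lborel) = (pi * v) ^ CARD('n)"
    unfolding eq by (simp add: cn_density_integral(2)[OF v])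
qed

text \<open>B is orthonormal for the real inner product, and the coordinates along it have variance
  v / 2. The right-hand side is the mean of the inverse of v / 2 times a chi-square variable with
  \<open>card B\<close> degrees of freedom.\<close>

lemma complex_normal_vec_inverse_quadratic:
  fixes B :: "(complex ^ 'n::finite) set"
  assumes B: "pairwise orthogonal B" "\<And>b. b \<in> B \<Longrightarrow> norm b = 1" and fin: "finite B"
    and v: "0 < v" and d: "2 < card B"
  shows "(\<integral>\<^sup>+x. inverse (ennreal (\<Sum>b\<in>B. (x \<bullet> b)\<^sup>2)) \<partial>complex_normal_vec v)
    \<le> ennreal (2 / (v * (real (card B) - 2)))"
proof -
  define k where "k = (1 / (pi * v)) ^ CARD('n)"
  have k: "0 \<le> k" "k * (pi * v) ^ CARD('n) = 1" using v by (auto simp: k_def power_divide)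
  have "(\<integral>\<^sup>+x. inverse (ennreal (\<Sum>b\<in>B. (x \<bullet> b)\<^sup>2)) \<partial>complex_normal_vec v)
    = (\<integral>\<^sup>+x. ennreal k * (ennreal (exp (- (norm x)\<^sup>2 / v)) * inverse (ennreal (\<Sum>b\<in>B. (x \<bullet> b)\<^sup>2))) \<partial>lborel)"
    by (subst nn_integral_complex_normal_vec[OF v])
      (auto simp: cn_density_def k_def[symmetric] ennreal_mult'[OF k(1)] mult.assoc)
  also have "\<dots> = ennreal k * (\<integral>\<^sup>+x. ennreal (exp (- (norm x)\<^sup>2 / v)) * inverse (ennreal (\<Sum>b\<in>B. (x \<bullet> b)\<^sup>2)) \<partial>lborel)"
    by (rule nn_integral_cmult) auto
  also have "\<dots> \<le> ennreal k * ennreal (2 / (v * (real (card B) - 2)) * (pi * v) ^ CARD('n))"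
    by (intro mult_left_mono gaussian_integral_inverse_quadratic[OF B fin v d integrable_exp_norm_sq(1)[OF v],
          unfolded integrable_exp_norm_sq(2)[OF v]]) auto
  also have "\<dots> = ennreal (k * (2 / (v * (real (card B) - 2)) * (pi * v) ^ CARD('n)))"
    by (rule ennreal_mult'[OF k(1), symmetric])
  also have "k * (2 / (v * (real (card B) - 2)) * (pi * v) ^ CARD('n)) = 2 / (v * (real (card B) - 2))"
    using k(2) by (metis mult.left_commute mult.right_neutral)
  finally show ?thesis .
qed

text \<open>Zero variances do occur: a link with \<beta> = 0 has no channel, and for \<alpha>^2 = 1
  there is no innovation.\<close>

lemma complex_normal_vec_0: "complex_normal_vec 0 = return borel 0"
proof -
  interpret P: prob_space "density lborel (\<lambda>x. ennreal (std_normal_density x))"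
    by (rule prob_space_normal_density) simp
  interpret PP: pair_prob_space "density lborel (\<lambda>x. ennreal (std_normal_density x))"
    "density lborel (\<lambda>x. ennreal (std_normal_density x))" ..
  have "complex_normal 0 = distr (density lborel (\<lambda>x. ennreal (std_normal_density x)) \<Otimes>\<^sub>M
            density lborel (\<lambda>x. ennreal (std_normal_density x))) borel (\<lambda>_. 0)"
    unfolding complex_normal_def by (intro distr_cong) (auto simp: complex_eq_iff)
  also have "\<dots> = return borel 0" by (rule PP.distr_const) simp
  finally have 0: "complex_normal 0 = return borel 0" .
  have "complex_normal_vec 0 = distr (return (\<Pi>\<^sub>M i\<in>(UNIV :: 'n set). (borel :: complex measure)) (restrict (\<lambda>i. 0) UNIV)) borel (vec_lambda :: _ \<Rightarrow> complex ^ 'n)"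
    unfolding complex_normal_vec_def 0 by (subst PiM_return) auto
  also have "\<dots> = return borel 0"
    by (subst distr_return) (auto simp: space_PiM vec_eq_iff intro!: arg_cong[where f="return borel"])
  finally show ?thesis .
qed

lemma complex_normal_vec_scaleR:
  fixes c v :: real
  assumes "0 \<le> v"
  shows "distr (complex_normal_vec v) borel (\<lambda>x. c *\<^sub>R x) = (complex_normal_vec (c\<^sup>2 * v) :: (complex ^ 'n::finite) measure)"
proof -
  interpret prob_space "complex_normal_vec v :: (complex ^ 'n) measure"
    by (rule prob_space_complex_normal_vec)
  consider "c = 0" | "v = 0" | "c \<noteq> 0" "0 < v" using assms by fastforce
  then show ?thesis
  proof cases
    assume "c = 0" then show ?thesis by (simp add: complex_normal_vec_0)
  next
    assume "v = 0" then show ?thesis by (simp add: complex_normal_vec_0 distr_return)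
  next
    assume c: "c \<noteq> 0" and v: "0 < v"
    then have cv: "0 < c\<^sup>2 * v" by simp
    have "\<bar>c\<bar> ^ DIM(complex ^ 'n) * cn_density (c\<^sup>2 * v) (c *\<^sub>R x) = cn_density v x" for x :: "complex ^ 'n"
    proof -
      have "\<bar>c\<bar> ^ DIM(complex ^ 'n) = \<bar>c\<bar> ^ (2 * CARD('n))" by (simp add: mult.commute)
      also have "\<dots> = (c\<^sup>2) ^ CARD('n)" by (simp only: power_mult power2_abs)
      finally have "\<bar>c\<bar> ^ DIM(complex ^ 'n) = (c\<^sup>2) ^ CARD('n)" .
      moreover have "(c\<^sup>2) ^ CARD('n) * (1 / (pi * (c\<^sup>2 * v))) ^ CARD('n) = (1 / (pi * v)) ^ CARD('n)"
        using c by (simp add: power_mult_distrib[symmetric])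
      moreover have "(norm (c *\<^sub>R x))\<^sup>2 / (c\<^sup>2 * v) = (norm x)\<^sup>2 / v"
        using c by (simp add: power_mult_distrib)
      ultimately show ?thesis by (simp add: cn_density_def mult.assoc[symmetric])
    qed
    then have "(\<lambda>x :: complex ^ 'n. ennreal (\<bar>c\<bar> ^ DIM(complex ^ 'n)) * ennreal (cn_density (c\<^sup>2 * v) (c *\<^sub>R x)))
        = (\<lambda>x. ennreal (cn_density v x))"
      by (subst ennreal_mult'[symmetric]) (auto simp del: DIM_cart)
    then show ?thesis
      unfolding complex_normal_vec_eq_density[OF cv] complex_normal_vec_eq_density[OF v]
      using density_lborel_eq_distr_scaleR[OF c, of "\<lambda>x :: complex ^ 'n. ennreal (cn_density (c\<^sup>2 * v) x)"]
      by simp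
  qed
qed

lemma complex_normal_vec_second_moment:
  fixes w :: "complex ^ 'n::finite"
  assumes "0 \<le> v"
  shows "(\<integral>\<^sup>+x. ennreal ((cmod (\<Sum>i\<in>UNIV. w $ i * x $ i))\<^sup>2) \<partial>complex_normal_vec v) = ennreal (v * (norm w)\<^sup>2)"
proof (cases "v = 0")
  case True
  then show ?thesis by (simp add: complex_normal_vec_0 nn_integral_return)
next
  case False
  then have v: "0 < v" using assms by simp
  \<comment> \<open>Real and imaginary part of the complex product of w and x are the real inner
    products of x with \<open>u1\<close> and \<open>u2\<close>. Each contributes v / 2 times the
    squared norm of w.\<close>
  define u1 where "u1 = (\<chi> i. cnj (w $ i))"
  define u2 where "u2 = (\<chi> i. \<i> * cnj (w $ i))"
  have u: "norm u1 = norm w" "norm u2 = norm w"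
    by (simp_all add: u1_def u2_def norm_vec_def norm_mult)
  have sq: "(cmod (\<Sum>i\<in>UNIV. w $ i * x $ i))\<^sup>2 = (x \<bullet> u1)\<^sup>2 + (x \<bullet> u2)\<^sup>2" for x
  proof -
    have "Re (\<Sum>i\<in>UNIV. w $ i * x $ i) = x \<bullet> u1" "Im (\<Sum>i\<in>UNIV. w $ i * x $ i) = x \<bullet> u2"
      by (simp_all add: u1_def u2_def inner_vec_def inner_complex_def mult_ac add_ac)
    then show ?thesis by (simp add: cmod_power2)
  qed
  define k where "k = (1 / (pi * v)) ^ CARD('n)"
  have k: "0 \<le> k" "k * (pi * v) ^ CARD('n) = 1" using v by (auto simp: k_def power_divide)
  have m: "integrable lborel (\<lambda>x. (x \<bullet> u)\<^sup>2 * exp (- (norm x)\<^sup>2 / v))"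
    "(\<integral>x. (x \<bullet> u)\<^sup>2 * exp (- (norm x)\<^sup>2 / v) \<partial>lborel) = v / 2 * (norm u)\<^sup>2 * (pi * v) ^ CARD('n)"
    for u :: "complex ^ 'n"
    using gaussian_integral_inner_sq[OF v, of u] integrable_exp_norm_sq[where 'n='n] v by auto
  have i: "integrable lborel (\<lambda>x. k * ((x \<bullet> u)\<^sup>2 * exp (- (norm x)\<^sup>2 / v)))" for u :: "complex ^ 'n"
    by (intro integrable_mult_right m(1))
  have e: "(\<integral>x. k * ((x \<bullet> u)\<^sup>2 * exp (- (norm x)\<^sup>2 / v)) \<partial>lborel) = v / 2 * (norm u)\<^sup>2" for u :: "complex ^ 'n"
    unfolding integral_mult_right_zero m(2)
    by (subst mult.left_commute) (simp only: k(2) mult_1_right)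
  have "(\<integral>\<^sup>+x. ennreal ((cmod (\<Sum>i\<in>UNIV. w $ i * x $ i))\<^sup>2) \<partial>complex_normal_vec v)
     = (\<integral>\<^sup>+x. ennreal (k * ((x \<bullet> u1)\<^sup>2 * exp (- (norm x)\<^sup>2 / v)) + k * ((x \<bullet> u2)\<^sup>2 * exp (- (norm x)\<^sup>2 / v))) \<partial>lborel)"
  proof -
    have "cn_density v x * ((x \<bullet> u1)\<^sup>2 + (x \<bullet> u2)\<^sup>2)
      = k * ((x \<bullet> u1)\<^sup>2 * exp (- (norm x)\<^sup>2 / v)) + k * ((x \<bullet> u2)\<^sup>2 * exp (- (norm x)\<^sup>2 / v))" for x
      unfolding cn_density_def k_def by (simp add: algebra_simps)
    then show ?thesis unfolding sq
      by (subst nn_integral_complex_normal_vec[OF v])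
        (simp_all only: ennreal_mult'[OF cn_density_nonneg[OF v], symmetric], measurable)
  qed
  also have "\<dots> = ennreal (\<integral>x. k * ((x \<bullet> u1)\<^sup>2 * exp (- (norm x)\<^sup>2 / v)) + k * ((x \<bullet> u2)\<^sup>2 * exp (- (norm x)\<^sup>2 / v)) \<partial>lborel)"
    using k(1) by (intro nn_integral_eq_integral Bochner_Integration.integrable_add i) auto
  also have "(\<integral>x. k * ((x \<bullet> u1)\<^sup>2 * exp (- (norm x)\<^sup>2 / v)) + k * ((x \<bullet> u2)\<^sup>2 * exp (- (norm x)\<^sup>2 / v)) \<partial>lborel) = v * (norm w)\<^sup>2"
    using e[of u1] e[of u2] unfolding u by (subst Bochner_Integration.integral_add[OF i i]) linarith
  finally show ?thesis .
qed

text \<open>Completing the square. With x = r + (a / (a + b)) s and y = s - x, the factor a / (a +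
  b) is the regression coefficient of x on the sum s, and a b / (a + b) is the variance of the
  residual r. The mixed terms in r and s cancel.\<close>

lemma cn_density_rotate:
  fixes r s :: "complex ^ 'n::finite"
  assumes a: "0 < a" and b: "0 < b"
  shows "cn_density a (r + (a / (a + b)) *\<^sub>R s) * cn_density b (s - (r + (a / (a + b)) *\<^sub>R s))
    = cn_density (a + b) s * cn_density (a * b / (a + b)) r"
proof -
  define d where "d = a + b"
  have d: "0 < d" and b': "b = d - a" using a b by (auto simp: d_def)
  have 1: "(norm (r + (a / d) *\<^sub>R s))\<^sup>2 = r \<bullet> r + 2 * (a / d) * (r \<bullet> s) + (a / d)\<^sup>2 * (s \<bullet> s)"
    unfolding power2_norm_eq_inner
    by (simp add: inner_add_left inner_add_right inner_commute power2_eq_square)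
  have e: "s - (r + (a / d) *\<^sub>R s) = (b / d) *\<^sub>R s - r"
    using d by (simp add: b' diff_divide_distrib scaleR_diff_left)
  have 2: "(norm (s - (r + (a / d) *\<^sub>R s)))\<^sup>2 = r \<bullet> r - 2 * (b / d) * (r \<bullet> s) + (b / d)\<^sup>2 * (s \<bullet> s)"
    unfolding power2_norm_eq_inner e
    by (simp add: inner_diff_left inner_diff_right inner_commute power2_eq_square)
  have "(r \<bullet> r + 2 * (a / d) * (r \<bullet> s) + (a / d)\<^sup>2 * (s \<bullet> s)) / a
     + (r \<bullet> r - 2 * (b / d) * (r \<bullet> s) + (b / d)\<^sup>2 * (s \<bullet> s)) / b
     = (r \<bullet> r) * (1 / a + 1 / b) + (s \<bullet> s) * ((a + b) / d\<^sup>2)"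
    using a b d by (simp add: add_divide_distrib diff_divide_distrib power2_eq_square distrib_left mult.commute)
  also have "1 / a + 1 / b = 1 / (a * b / d)" using a b by (simp add: d_def field_simps)
  also have "(a + b) / d\<^sup>2 = 1 / d" using d by (simp add: d_def[symmetric] power2_eq_square)
  finally have ex: "(norm (r + (a / d) *\<^sub>R s))\<^sup>2 / a + (norm (s - (r + (a / d) *\<^sub>R s)))\<^sup>2 / b
     = (norm s)\<^sup>2 / d + (norm r)\<^sup>2 / (a * b / d)"
    unfolding 1 2 by (simp add: power2_norm_eq_inner)
  have c: "(1 / (pi * a)) ^ CARD('n) * (1 / (pi * b)) ^ CARD('n) = (1 / (pi * d)) ^ CARD('n) * (1 / (pi * (a * b / d))) ^ CARD('n)"
  proof -
    have "1 / (pi * a) * (1 / (pi * b)) = 1 / (pi * d) * (1 / (pi * (a * b / d)))"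
      using a b d by (simp add: field_simps)
    then show ?thesis by (simp only: power_mult_distrib[symmetric])
  qed
  have "cn_density a (r + (a / d) *\<^sub>R s) * cn_density b (s - (r + (a / d) *\<^sub>R s))
    = ((1 / (pi * a)) ^ CARD('n) * (1 / (pi * b)) ^ CARD('n))
      * exp (- ((norm (r + (a / d) *\<^sub>R s))\<^sup>2 / a + (norm (s - (r + (a / d) *\<^sub>R s)))\<^sup>2 / b))"
    unfolding cn_density_def by (simp add: exp_add[symmetric] mult_ac)
  also have "\<dots> = cn_density d s * cn_density (a * b / d) r"
    unfolding ex c cn_density_def minus_add_distrib exp_add by (simp only: minus_divide_left mult_ac)
  finally show ?thesis by (simp only: d_def)
qed

text \<open>The map replaces \<open>(X, Y)\<close> by \<open>X + Y\<close> and the error of the linear estimate of \<open>X\<close>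
  from \<open>X + Y\<close>. It is a composition of two shears, so that no Jacobian is needed.\<close>
lemma complex_normal_vec_rotate:
  assumes a: "0 \<le> a" and b: "0 < b"
  shows "distr (complex_normal_vec a \<Otimes>\<^sub>M complex_normal_vec b) (borel \<Otimes>\<^sub>M borel)
      (\<lambda>(x, y). (x + y, x - (a / (a + b)) *\<^sub>R (x + y)))
    = complex_normal_vec (a + b) \<Otimes>\<^sub>M (complex_normal_vec (a * b / (a + b)) :: (complex ^ 'n::finite) measure)"
proof -
  define c where "c = a / (a + b)"
  define v where "v = a * b / (a + b)"
  let ?N = "\<lambda>v. complex_normal_vec v :: (complex ^ 'n::finite) measure"
  interpret A: prob_space "?N a" by (rule prob_space_complex_normal_vec)
  interpret B: prob_space "?N b" by (rule prob_space_complex_normal_vec)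
  interpret V: prob_space "?N v" by (rule prob_space_complex_normal_vec)
  have key: "(\<integral>\<^sup>+x. \<integral>\<^sup>+y. g (x + y, x - c *\<^sub>R (x + y)) \<partial>?N b \<partial>?N a) = (\<integral>\<^sup>+s. \<integral>\<^sup>+r. g (s, r) \<partial>?N v \<partial>?N (a + b))"
    if [measurable]: "g \<in> borel_measurable (borel \<Otimes>\<^sub>M borel)" for g
  proof (cases "a = 0")
    \<comment> \<open>Here X is almost surely 0, and both the coefficient \<open>c\<close> and the
      residual variance \<open>v\<close> are 0.\<close>
    case True
    then show ?thesis
      by (simp add: c_def v_def complex_normal_vec_0 nn_integral_return)
  next
    case False
    then have a: "0 < a" using a by simp
    have ab: "0 < a + b" and v: "0 < v" using a b by (auto simp: v_def)
    have nb: "0 \<le> cn_density b x" and na: "0 \<le> cn_density a x" and ns: "0 \<le> cn_density (a+b) x"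
      for x :: "complex ^ 'n" using a b ab by (auto intro: cn_density_nonneg)
    have "(\<integral>\<^sup>+x. \<integral>\<^sup>+y. g (x + y, x - c *\<^sub>R (x + y)) \<partial>?N b \<partial>?N a)
        = (\<integral>\<^sup>+x. ennreal (cn_density a x) * (\<integral>\<^sup>+y. ennreal (cn_density b y) * g (x + y, x - c *\<^sub>R (x + y)) \<partial>lborel) \<partial>lborel)"
      using a b by (simp add: nn_integral_complex_normal_vec)
    also have "\<dots> = (\<integral>\<^sup>+x. ennreal (cn_density a x) * (\<integral>\<^sup>+s. ennreal (cn_density b (s - x)) * g (s, x - c *\<^sub>R s) \<partial>lborel) \<partial>lborel)"
    proof -
      have "(\<integral>\<^sup>+y. ennreal (cn_density b y) * g (x + y, x - c *\<^sub>R (x + y)) \<partial>lborel)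
         = (\<integral>\<^sup>+s. ennreal (cn_density b (s - x)) * g (s, x - c *\<^sub>R s) \<partial>lborel)" for x
        by (subst nn_integral_lborel_shift[of "\<lambda>s. ennreal (cn_density b (s - x)) * g (s, x - c *\<^sub>R s)" x, symmetric])
          (auto simp: add.commute)
      then show ?thesis by simp
    qed
    also have "\<dots> = (\<integral>\<^sup>+x. \<integral>\<^sup>+s. ennreal (cn_density a x) * (ennreal (cn_density b (s - x)) * g (s, x - c *\<^sub>R s)) \<partial>lborel \<partial>lborel)"
      by (simp add: nn_integral_cmult)
    \<comment> \<open>The first shear replaced y by s = x + y for fixed x. Exchanging the integrals
      fixes s, so that x can be shifted by c s in the second.\<close>
    also have "\<dots> = (\<integral>\<^sup>+s. \<integral>\<^sup>+x. ennreal (cn_density a x) * (ennreal (cn_density b (s - x)) * g (s, x - c *\<^sub>R s)) \<partial>lborel \<partial>lborel)"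
      by (rule lborel_pair.Fubini'[symmetric]) measurable
    also have "\<dots> = (\<integral>\<^sup>+s. \<integral>\<^sup>+r. ennreal (cn_density a (r + c *\<^sub>R s)) * (ennreal (cn_density b (s - (r + c *\<^sub>R s))) * g (s, r)) \<partial>lborel \<partial>lborel)"
    proof -
      have "(\<integral>\<^sup>+x. ennreal (cn_density a x) * (ennreal (cn_density b (s - x)) * g (s, x - c *\<^sub>R s)) \<partial>lborel)
         = (\<integral>\<^sup>+r. ennreal (cn_density a (r + c *\<^sub>R s)) * (ennreal (cn_density b (s - (r + c *\<^sub>R s))) * g (s, r)) \<partial>lborel)" for s
        by (subst nn_integral_lborel_shift[of "\<lambda>x. ennreal (cn_density a x) * (ennreal (cn_density b (s - x)) * g (s, x - c *\<^sub>R s))" "c *\<^sub>R s", symmetric])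
          auto
      then show ?thesis by simp
    qed
    also have "\<dots> = (\<integral>\<^sup>+s. \<integral>\<^sup>+r. ennreal (cn_density (a + b) s) * (ennreal (cn_density v r) * g (s, r)) \<partial>lborel \<partial>lborel)"
      unfolding c_def v_def mult.assoc[symmetric]
      by (simp only: ennreal_mult'[OF na, symmetric] ennreal_mult'[OF ns, symmetric] cn_density_rotate[OF a b])
    also have "\<dots> = (\<integral>\<^sup>+s. ennreal (cn_density (a + b) s) * (\<integral>\<^sup>+r. ennreal (cn_density v r) * g (s, r) \<partial>lborel) \<partial>lborel)"
      by (simp add: nn_integral_cmult)
    also have "\<dots> = (\<integral>\<^sup>+s. \<integral>\<^sup>+r. g (s, r) \<partial>?N v \<partial>?N (a + b))"
      using ab v by (simp add: nn_integral_complex_normal_vec)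
    finally show ?thesis .
  qed
  show ?thesis
    unfolding c_def[symmetric] v_def[symmetric]
  proof (rule measure_eqI)
    show "sets (distr (?N a \<Otimes>\<^sub>M ?N b) (borel \<Otimes>\<^sub>M borel) (\<lambda>(x, y). (x + y, x - c *\<^sub>R (x + y)))) = sets (?N (a + b) \<Otimes>\<^sub>M ?N v)"
      by (simp cong: sets_pair_measure_cong)
    fix S assume "S \<in> sets (distr (?N a \<Otimes>\<^sub>M ?N b) (borel \<Otimes>\<^sub>M borel) (\<lambda>(x, y). (x + y, x - c *\<^sub>R (x + y))))"
    then have [measurable]: "S \<in> sets (borel \<Otimes>\<^sub>M borel)" by simp
    have "emeasure (distr (?N a \<Otimes>\<^sub>M ?N b) (borel \<Otimes>\<^sub>M borel) (\<lambda>(x, y). (x + y, x - c *\<^sub>R (x + y)))) S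
      = (\<integral>\<^sup>+p. indicator S p \<partial>distr (?N a \<Otimes>\<^sub>M ?N b) (borel \<Otimes>\<^sub>M borel) (\<lambda>(x, y). (x + y, x - c *\<^sub>R (x + y))))"
      by simp
    also have "\<dots> = (\<integral>\<^sup>+p. indicator S (case p of (x, y) \<Rightarrow> (x + y, x - c *\<^sub>R (x + y))) \<partial>(?N a \<Otimes>\<^sub>M ?N b))"
      by (rule nn_integral_distr) auto
    also have "\<dots> = (\<integral>\<^sup>+x. \<integral>\<^sup>+y. indicator S (x + y, x - c *\<^sub>R (x + y)) \<partial>?N b \<partial>?N a)"
      by (subst B.nn_integral_fst[symmetric]) auto
    also have "\<dots> = (\<integral>\<^sup>+s. \<integral>\<^sup>+r. indicator S (s, r) \<partial>?N v \<partial>?N (a + b))"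
      by (rule key) auto
    also have "\<dots> = (\<integral>\<^sup>+p. indicator S p \<partial>(?N (a + b) \<Otimes>\<^sub>M ?N v))"
      by (subst V.nn_integral_fst[symmetric]) auto
    also have "\<dots> = emeasure (?N (a + b) \<Otimes>\<^sub>M ?N v) S"
      by (rule nn_integral_indicator) (simp cong: sets_pair_measure_cong)
    finally show "emeasure (distr (?N a \<Otimes>\<^sub>M ?N b) (borel \<Otimes>\<^sub>M borel) (\<lambda>(x, y). (x + y, x - c *\<^sub>R (x + y)))) S
      = emeasure (?N (a + b) \<Otimes>\<^sub>M ?N v) S" .
  qed
qed

text \<open>For \<open>0 < b\<close> the law of the sum is the first marginal of the rotated pair.
  For \<open>b = 0\<close> the second summand is a point mass at 0.\<close>

lemma complex_normal_vec_add:
  assumes a: "0 \<le> a" and b: "0 \<le> b"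
  shows "distr (complex_normal_vec a \<Otimes>\<^sub>M complex_normal_vec b) borel (\<lambda>(x, y). x + y)
    = (complex_normal_vec (a + b) :: (complex ^ 'n::finite) measure)"
proof -
  let ?N = "\<lambda>v. complex_normal_vec v :: (complex ^ 'n::finite) measure"
  interpret A: prob_space "?N a" by (rule prob_space_complex_normal_vec)
  interpret B: prob_space "?N b" by (rule prob_space_complex_normal_vec)
  interpret V: prob_space "?N (a * b / (a + b))" by (rule prob_space_complex_normal_vec)
  show ?thesis
  proof (cases "b = 0")
    case False
    then have b: "0 < b" using b by simp
    have "?N (a + b) = distr (?N (a + b) \<Otimes>\<^sub>M ?N (a * b / (a + b))) (?N (a + b)) fst"
      by (rule V.distr_pair_fst[symmetric])
    also have "\<dots> = distr (?N (a + b) \<Otimes>\<^sub>M ?N (a * b / (a + b))) borel fst"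
      by (intro distr_cong) auto
    also have "\<dots> = distr (?N a \<Otimes>\<^sub>M ?N b) borel (\<lambda>(x, y). x + y)"
      unfolding complex_normal_vec_rotate[OF a b, symmetric]
      by (subst distr_distr) (auto simp: comp_def split_def)
    finally show ?thesis ..
  next
    case True
    show ?thesis
    proof (rule measure_eqI)
      fix S assume "S \<in> sets (distr (?N a \<Otimes>\<^sub>M ?N b) borel (\<lambda>(x, y). x + y))"
      then have [measurable]: "S \<in> sets borel" by simp
      have "emeasure (distr (?N a \<Otimes>\<^sub>M ?N b) borel (\<lambda>(x, y). x + y)) S
        = (\<integral>\<^sup>+z. indicator S z \<partial>distr (?N a \<Otimes>\<^sub>M ?N b) borel (\<lambda>(x, y). x + y))" by simp
      also have "\<dots> = (\<integral>\<^sup>+p. indicator S (case p of (x, y) \<Rightarrow> x + y) \<partial>(?N a \<Otimes>\<^sub>M ?N b))"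
        by (rule nn_integral_distr) auto
      also have "\<dots> = (\<integral>\<^sup>+x. \<integral>\<^sup>+y. indicator S (x + y) \<partial>?N b \<partial>?N a)"
        by (subst B.nn_integral_fst[symmetric]) auto
      also have "\<dots> = emeasure (?N (a + b)) S"
        unfolding True by (simp add: complex_normal_vec_0 nn_integral_return)
      finally show "emeasure (distr (?N a \<Otimes>\<^sub>M ?N b) borel (\<lambda>(x, y). x + y)) S = emeasure (?N (a + b)) S" .
    qed simp
  qed
qed

section \<open>Zero-forcing rows\<close>

lemma of_columns_component [simp]: "of_columns v $ a $ j = v j $ a"
  by (simp add: of_columns_def)

lemma vector_matrix_mult_of_columns: "(w v* of_columns v) $ j = (\<Sum>a\<in>UNIV. w $ a * v j $ a)"
  by (simp add: vector_matrix_mult_def mult.commute)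

lemma cnj_dot_product:
  fixes y x :: "complex ^ 'n::finite"
  shows "(\<Sum>a\<in>UNIV. cnj (y $ a) * x $ a) = Complex (y \<bullet> x) ((\<chi> a. \<i> * y $ a) \<bullet> x)"
  by (simp add: complex_eq_iff inner_vec_def inner_complex_def algebra_simps)

text \<open>B is a real orthonormal basis of the complement of the other columns and is chosen
  before x, so that x can be integrated while B stays fixed. The row is the conjugate of the
  projection u of x, divided by its squared length. The dimension bound is written additively to
  avoid subtraction of naturals; it says that B has at least 2 (N - K + 1) elements.\<close>

lemma zero_forcing_row_exists:
  fixes v :: "'k::finite \<Rightarrow> complex ^ 'n::finite" and k :: 'k
  obtains B :: "(complex ^ 'n) set"
  where "pairwise orthogonal B" "\<And>b. b \<in> B \<Longrightarrow> norm b = 1" "finite B"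
    "2 * CARD('n) + 2 \<le> card B + 2 * CARD('k)"
    "\<And>x. 0 < (\<Sum>b\<in>B. (x \<bullet> b)\<^sup>2) \<Longrightarrow>
       \<exists>w. w v* of_columns (v(k := x)) = axis k 1 \<and> (norm w)\<^sup>2 = 1 / (\<Sum>b\<in>B. (x \<bullet> b)\<^sup>2)"
proof -
  define im where "im y = (\<chi> a. \<i> * y $ a)" for y :: "complex ^ 'n"
  \<comment> \<open>Including the multiples by the imaginary unit makes real orthogonality to
    \<open>T\<close> the same as complex orthogonality to the columns, and makes \<open>W\<close>
    closed under \<open>im\<close>.\<close>
  define T where "T = v ` (UNIV - {k}) \<union> (im \<circ> v) ` (UNIV - {k})"
  define W where "W = {y. \<forall>x\<in>T. orthogonal x y}"
  have W: "subspace W" unfolding W_def by (rule subspace_orthogonal_to_vectors)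
  have im_inner: "im x \<bullet> y = - (x \<bullet> im y)" for x y
    by (simp add: im_def inner_vec_def inner_complex_def sum_negf[symmetric])
  have W_im: "im y \<in> W" if "y \<in> W" for y
  proof -
    have "y \<bullet> v j = 0" "y \<bullet> im (v j) = 0" if "j \<noteq> k" for j
      using \<open>y \<in> W\<close> that by (auto simp: W_def T_def orthogonal_def inner_commute)
    moreover have "im (im x) = - x" for x by (simp add: im_def vec_eq_iff)
    ultimately have "v j \<bullet> im y = 0" "im (v j) \<bullet> im y = 0" if "j \<noteq> k" for j
      using that im_inner[of "v j" y] im_inner[of "im (v j)" y] by (auto simp: inner_commute)
    then show ?thesis by (auto simp: W_def T_def orthogonal_def)
  qed
  obtain B where B: "B \<subseteq> W" "pairwise orthogonal B" "\<And>x. x \<in> B \<Longrightarrow> norm x = 1"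
    "independent B" "card B = dim W" "span B = W"
    using orthonormal_basis_subspace[OF W] by metis
  have fin: "finite B" using B(4) by (rule independent_imp_finite)
  have "dim (span T) \<le> card T" by (simp add: dim_span dim_le_card' T_def)
  also have "card T \<le> card (v ` (UNIV - {k})) + card ((im \<circ> v) ` (UNIV - {k}))"
    unfolding T_def by (rule card_Un_le)
  also have "\<dots> \<le> (CARD('k) - 1) + (CARD('k) - 1)"
    by (intro add_mono order_trans[OF card_image_le]) auto
  finally have dT: "dim (span T) \<le> 2 * (CARD('k) - 1)" by simp
  have "W = {y \<in> UNIV. \<forall>x\<in>span T. orthogonal x y}"
    unfolding W_def by (auto intro: span_base) (metis orthogonal_commute orthogonal_to_span)
  then have "dim W + dim (span T) = DIM(complex ^ 'n)"
    using dim_subspace_orthogonal_to_vectors[of "span T" UNIV] by (simp del: DIM_cart dim_span)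
  then have "2 * CARD('n) \<le> card B + 2 * (CARD('k) - 1)"
    using dT B(5) by simp
  moreover obtain m where "CARD('k) = Suc m" using zero_less_card_finite gr0_conv_Suc by blast
  ultimately have card: "2 * CARD('n) + 2 \<le> card B + 2 * CARD('k)" by simp
  have ortho: "b \<bullet> c = (if b = c then 1 else 0)" if "b \<in> B" "c \<in> B" for b c
    using B that by (auto simp: pairwise_def orthogonal_def norm_eq_1)
  show thesis
  proof (rule that[OF B(2,3) fin card])
    fix x :: "complex ^ 'n"
    define q where "q = (\<Sum>b\<in>B. (x \<bullet> b)\<^sup>2)"
    assume "0 < (\<Sum>b\<in>B. (x \<bullet> b)\<^sup>2)"
    then have q: "0 < q" by (simp add: q_def)
    define u where "u = (\<Sum>b\<in>B. (x \<bullet> b) *\<^sub>R b)"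
    have uW: "u \<in> W" unfolding u_def B(6)[symmetric] by (intro span_sum span_scale span_base)
    have ub: "u \<bullet> b = x \<bullet> b" if "b \<in> B" for b
      using that fin by (simp add: u_def inner_sum_left ortho if_distrib cong: if_cong sum.cong)
    have uy: "u \<bullet> y = x \<bullet> y" if "y \<in> W" for y
      using that unfolding B(6)[symmetric]
    proof (induct rule: span_induct)
      show "subspace {y. u \<bullet> y = x \<bullet> y}"
        using subspace_hyperplane[of "u - x"] by (simp add: inner_diff_left)
    qed (use ub in simp)
    have uq: "u \<bullet> x = q"
      unfolding u_def q_def inner_sum_left
      by (intro sum.cong refl) (simp add: power2_eq_square inner_commute)
    have uu: "(norm u)\<^sup>2 = q"
      using uy[OF uW] uq by (simp add: power2_norm_eq_inner inner_commute)
    \<comment> \<open>As \<open>im u\<close> lies in \<open>W\<close>, x can be replaced by its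
      projection u, and u is orthogonal to \<open>im u\<close>. Hence the complex product of the
      conjugate of u with x is real and equals q.\<close>
    have "im u \<bullet> x = im u \<bullet> u" using uy[OF W_im[OF uW]] by (simp add: inner_commute)
    also have "im u \<bullet> u = 0" using im_inner[of u u] by (simp add: inner_commute)
    finally have iu: "im u \<bullet> x = 0" .
    define w where "w = (\<chi> a. complex_of_real (1 / q) * cnj (u $ a))"
    have dot: "(\<Sum>a\<in>UNIV. w $ a * y $ a) = complex_of_real (1 / q) * Complex (u \<bullet> y) (im u \<bullet> y)" for y
      unfolding im_def cnj_dot_product[symmetric] by (simp add: w_def sum_distrib_left mult.assoc)
    have "w v* of_columns (v(k := x)) = axis k 1"
    proof (subst vec_eq_iff, rule allI)
      fix j show "(w v* of_columns (v(k := x))) $ j = axis k 1 $ j"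
      proof (cases "j = k")
        case True
        then show ?thesis using q
          by (simp add: vector_matrix_mult_of_columns dot uq iu axis_def complex_eq_iff)
      next
        case False
        have "orthogonal (v j) u" "orthogonal (v j) (im u)"
          using uW W_im[OF uW] False by (auto simp: W_def T_def)
        then have "u \<bullet> v j = 0" "im u \<bullet> v j = 0"
          by (simp_all add: orthogonal_def inner_commute)
        then show ?thesis using False
          by (simp add: vector_matrix_mult_of_columns dot axis_def complex_eq_iff)
      qed
    qed
    moreover have "(norm w)\<^sup>2 = 1 / q"
    proof -
      have "norm w = \<bar>1 / q\<bar> * norm u"
      proof -
        have "w = (1 / q) *\<^sub>R (\<chi> a. cnj (u $ a))" by (simp add: w_def vec_eq_iff scaleR_conv_of_real[where 'a=complex])
        moreover have "norm (\<chi> a. cnj (u $ a)) = norm u" by (simp add: norm_vec_def)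
        ultimately show ?thesis by simp
      qed
      then show ?thesis using uu q by (simp add: power_mult_distrib power2_eq_square)
    qed
    ultimately show "\<exists>w. w v* of_columns (v(k := x)) = axis k 1 \<and> (norm w)\<^sup>2 = 1 / (\<Sum>b\<in>B. (x \<bullet> b)\<^sup>2)"
      unfolding q_def[symmetric] by blast
  qed
qed

text \<open>Projection along a compact set preserves closedness, and a closed set is a countable
  union of its compact intersections with balls.\<close>

lemma borel_of_closed_relation:
  fixes R :: "('a::euclidean_space \<times> 'b::euclidean_space) set"
  assumes "closed R" "closed C"
  shows "{y. \<exists>x\<in>C. (x, y) \<in> R} \<in> sets borel"
proof -
  have "{y. \<exists>x\<in>C. (x, y) \<in> R} = (\<Union>m::nat. {y. \<exists>x. x \<in> C \<inter> cball 0 (real m) \<and> (x, y) \<in> R})"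
  proof (intro equalityI subsetI)
    fix y assume "y \<in> {y. \<exists>x\<in>C. (x, y) \<in> R}"
    then obtain x where x: "x \<in> C" "(x, y) \<in> R" by blast
    obtain m :: nat where "norm x \<le> real m" using real_arch_simple by blast
    with x show "y \<in> (\<Union>m::nat. {y. \<exists>x. x \<in> C \<inter> cball 0 (real m) \<and> (x, y) \<in> R})" by auto
  qed auto
  moreover have "closed {y. \<exists>x. x \<in> C \<inter> cball 0 (real m) \<and> (x, y) \<in> R}" for m :: nat
    by (rule closed_compact_projection) (use assms in \<open>auto intro: closed_Int_compact\<close>)
  ultimately show ?thesis by auto
qed

text \<open>\<^const>\<open>pinv\<close> has a closed graph, and projections of closed sets along the
  \<open>\<sigma>\<close>-compact space of values are Borel. Where the Penrose equations had no solution, the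
  definite description would be a constant, so that existence is not needed here.\<close>
lemma borel_measurable_pinv [measurable]:
  "(pinv :: complex ^ 'b::finite ^ 'a::finite \<Rightarrow> complex ^ 'a ^ 'b) \<in> borel_measurable borel"
proof (rule borel_measurableI)
  fix S :: "(complex ^ 'a ^ 'b) set" assume "open S"
  define C where "C = - S"
  have C: "closed C" using \<open>open S\<close> unfolding C_def closed_def by simp
  define R where "R = {(X, A :: complex ^ 'b ^ 'a). is_pinv A X}"
  have R: "closed R"
  proof -
    have 1: "continuous_on UNIV (\<lambda>p. A p ** X p)"
      if "continuous_on UNIV A" "continuous_on UNIV X"
      for A :: "(complex ^ 'a ^ 'b) \<times> (complex ^ 'b ^ 'a) \<Rightarrow> complex ^ 'c::finite ^ 'd::finite"
        and X :: "(complex ^ 'a ^ 'b) \<times> (complex ^ 'b ^ 'a) \<Rightarrow> complex ^ 'e::finite ^ 'c"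
      unfolding matrix_matrix_mult_def using that by (intro continuous_intros)
    have 2: "continuous_on UNIV (\<lambda>p. conj_transpose (A p))"
      if "continuous_on UNIV A"
      for A :: "(complex ^ 'a ^ 'b) \<times> (complex ^ 'b ^ 'a) \<Rightarrow> complex ^ 'c::finite ^ 'd::finite"
      unfolding conj_transpose_def using that by (intro continuous_intros)
    have "R = {p. snd p ** fst p ** snd p = snd p} \<inter> {p. fst p ** snd p ** fst p = fst p}
        \<inter> {p. conj_transpose (snd p ** fst p) = snd p ** fst p}
        \<inter> {p. conj_transpose (fst p ** snd p) = fst p ** snd p}"
      by (auto simp: R_def is_pinv_def)
    moreover have "closed \<dots>"
      by (intro closed_Int closed_Collect_eq 1 2 continuous_on_fst continuous_on_snd continuous_on_id)
    ultimately show ?thesis by simp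
  qed
  define u where "u = (THE X :: complex ^ 'a ^ 'b. False)"
  have P: "pinv A = (if \<exists>X. is_pinv A X then (THE X. is_pinv A X) else u)" for A :: "complex ^ 'b ^ 'a"
    unfolding pinv_def is_pinv_def[symmetric] u_def by (auto intro!: arg_cong[where f=The])
  have "pinv -` C = {A. \<exists>X\<in>C. (X, A) \<in> R} \<union> (if u \<in> C then - {A. \<exists>X\<in>UNIV. (X, A) \<in> R} else {})"
  proof (intro set_eqI)
    fix A :: "complex ^ 'b ^ 'a"
    show "A \<in> pinv -` C \<longleftrightarrow> A \<in> {A. \<exists>X\<in>C. (X, A) \<in> R} \<union> (if u \<in> C then - {A. \<exists>X\<in>UNIV. (X, A) \<in> R} else {})"
    proof (cases "\<exists>X. is_pinv A X")
      case True
      then obtain X where X: "is_pinv A X" by blast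
      have "is_pinv A Y \<longleftrightarrow> Y = pinv A" for Y
        using pinv_eq[of A Y] pinv_eq[OF X] X by metis
      then show ?thesis by (simp add: R_def)
    next
      case False
      then show ?thesis using P[of A] by (simp add: R_def)
    qed
  qed
  also have "\<dots> \<in> sets borel"
    using borel_of_closed_relation[OF R C] borel_of_closed_relation[OF R closed_UNIV] by auto
  finally have "- (pinv -` C) \<in> sets borel" by auto
  also have "- (pinv -` C) = pinv -` S" by (auto simp: C_def)
  finally show "pinv -` S \<inter> space borel \<in> sets borel" by simp
qed

lemma borel_row_solvable [measurable]:
  "{A :: complex ^ 'b::finite ^ 'a::finite. \<exists>w. w v* A = axis k 1} \<in> sets borel"
proof -
  have "closed {p :: (complex ^ 'a) \<times> (complex ^ 'b ^ 'a). fst p v* snd p = axis k 1}"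
    unfolding vector_matrix_mult_def
    by (intro closed_Collect_eq continuous_intros)
  from borel_of_closed_relation[OF this closed_UNIV] show ?thesis by simp
qed

lemma measurable_row [measurable]:
  "row k \<in> (borel :: (complex ^ 'b::finite ^ 'a::finite) measure) \<rightarrow>\<^sub>M borel"
  unfolding row_def[abs_def]
  by (intro borel_measurable_continuous_onI continuous_intros)

lemma measurable_of_columns:
  fixes f :: "'w \<Rightarrow> 'b::finite \<Rightarrow> complex ^ 'a::finite"
  assumes "\<And>j. (\<lambda>x. f x j) \<in> borel_measurable M"
  shows "(\<lambda>x. of_columns (f x)) \<in> borel_measurable M"
  unfolding of_columns_def using assms
  by (intro borel_measurable_vec_lambda borel_measurable_vec_nth)

lemma measurable_vector_matrix_mult [measurable (raw)]:
  fixes f :: "'w \<Rightarrow> complex ^ 'a::finite" and g :: "'w \<Rightarrow> complex ^ 'b::finite ^ 'a"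
  assumes [measurable]: "f \<in> borel_measurable M" "g \<in> borel_measurable M"
  shows "(\<lambda>x. f x v* g x) \<in> borel_measurable M"
  unfolding vector_matrix_mult_def
  by (intro borel_measurable_vec_lambda) measurable

section \<open>Sums of independent complex normal vectors\<close>

context prob_space
begin

lemma has_CN_law_scaleR:
  fixes X :: "'a \<Rightarrow> complex ^ 'n::finite"
  assumes "has_CN_law M v X"
  shows "has_CN_law M (c\<^sup>2 * v) (\<lambda>\<omega>. c *\<^sub>R X \<omega>)"
proof -
  have v: "0 \<le> v" and [measurable]: "X \<in> borel_measurable M" and d: "distr M borel X = complex_normal_vec v"
    using assms by (auto simp: has_CN_law_def)
  have "distr M borel (\<lambda>\<omega>. c *\<^sub>R X \<omega>) = distr (distr M borel X) borel (\<lambda>x. c *\<^sub>R x)"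
    by (subst distr_distr) (auto simp: comp_def)
  also have "\<dots> = complex_normal_vec (c\<^sup>2 * v)" unfolding d by (rule complex_normal_vec_scaleR[OF v])
  finally show ?thesis using v by (simp add: has_CN_law_def)
qed

lemma has_CN_law_add:
  fixes X Y :: "'a \<Rightarrow> complex ^ 'n::finite"
  assumes X: "has_CN_law M a X" and Y: "has_CN_law M b Y"
    and indep: "distr M (borel \<Otimes>\<^sub>M borel) (\<lambda>\<omega>. (X \<omega>, Y \<omega>)) = distr M borel X \<Otimes>\<^sub>M distr M borel Y"
  shows "has_CN_law M (a + b) (\<lambda>\<omega>. X \<omega> + Y \<omega>)"
proof -
  have ab: "0 \<le> a" "0 \<le> b" and [measurable]: "X \<in> borel_measurable M" "Y \<in> borel_measurable M"
    and d: "distr M borel X = complex_normal_vec a" "distr M borel Y = complex_normal_vec b"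
    using X Y by (auto simp: has_CN_law_def)
  have "distr M borel (\<lambda>\<omega>. X \<omega> + Y \<omega>) = distr (distr M (borel \<Otimes>\<^sub>M borel) (\<lambda>\<omega>. (X \<omega>, Y \<omega>))) borel (\<lambda>(x, y). x + y)"
    by (subst distr_distr) (auto simp: comp_def)
  also have "\<dots> = complex_normal_vec (a + b)"
    unfolding indep d by (rule complex_normal_vec_add[OF ab])
  finally show ?thesis using ab by (simp add: has_CN_law_def)
qed

lemma has_CN_law_zero: "has_CN_law M 0 (\<lambda>\<omega>. 0)"
  by (simp add: has_CN_law_def complex_normal_vec_0)

text \<open>Functions of disjoint blocks of an independent family are independent. The conclusion is
  an equation between a joint law and a product measure, the form in which it can be rewritten under
  an integral before Fubini.\<close>

lemma indep_vars_distr_pair: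
  assumes ind: "indep_vars N X I" and AB: "A \<inter> B = {}" "A \<subseteq> I" "B \<subseteq> I"
    and f [measurable]: "f \<in> PiM A N \<rightarrow>\<^sub>M N1" and g [measurable]: "g \<in> PiM B N \<rightarrow>\<^sub>M N2"
  shows "distr M (N1 \<Otimes>\<^sub>M N2) (\<lambda>\<omega>. (f (\<lambda>i\<in>A. X i \<omega>), g (\<lambda>i\<in>B. X i \<omega>)))
    = distr M N1 (\<lambda>\<omega>. f (\<lambda>i\<in>A. X i \<omega>)) \<Otimes>\<^sub>M distr M N2 (\<lambda>\<omega>. g (\<lambda>i\<in>B. X i \<omega>))"
proof -
  have [measurable]: "(\<lambda>\<omega>. \<lambda>i\<in>A. X i \<omega>) \<in> M \<rightarrow>\<^sub>M PiM A N" "(\<lambda>\<omega>. \<lambda>i\<in>B. X i \<omega>) \<in> M \<rightarrow>\<^sub>M PiM B N"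
    and eq: "distr M (PiM A N) (\<lambda>\<omega>. \<lambda>i\<in>A. X i \<omega>) \<Otimes>\<^sub>M distr M (PiM B N) (\<lambda>\<omega>. \<lambda>i\<in>B. X i \<omega>)
      = distr M (PiM A N \<Otimes>\<^sub>M PiM B N) (\<lambda>\<omega>. (\<lambda>i\<in>A. X i \<omega>, \<lambda>i\<in>B. X i \<omega>))"
    using indep_var_restrict[OF ind AB] unfolding indep_var_distribution_eq by auto
  interpret D: prob_space "distr M N2 (\<lambda>\<omega>. g (\<lambda>i\<in>B. X i \<omega>))"
    by (rule prob_space_distr) measurable
  have "distr M N1 (\<lambda>\<omega>. f (\<lambda>i\<in>A. X i \<omega>)) \<Otimes>\<^sub>M distr M N2 (\<lambda>\<omega>. g (\<lambda>i\<in>B. X i \<omega>))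
    = distr (distr M (PiM A N) (\<lambda>\<omega>. \<lambda>i\<in>A. X i \<omega>)) N1 f \<Otimes>\<^sub>M distr (distr M (PiM B N) (\<lambda>\<omega>. \<lambda>i\<in>B. X i \<omega>)) N2 g"
    by (simp add: distr_distr comp_def)
  also have "\<dots> = distr (distr M (PiM A N) (\<lambda>\<omega>. \<lambda>i\<in>A. X i \<omega>) \<Otimes>\<^sub>M distr M (PiM B N) (\<lambda>\<omega>. \<lambda>i\<in>B. X i \<omega>)) (N1 \<Otimes>\<^sub>M N2) (\<lambda>(x, y). (f x, g y))"
  proof (rule pair_measure_distr)
    show "sigma_finite_measure (distr (distr M (PiM B N) (\<lambda>\<omega>. \<lambda>i\<in>B. X i \<omega>)) N2 g)"
      using D.sigma_finite_measure_axioms by (simp add: distr_distr comp_def)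
  qed simp_all
  also have "\<dots> = distr M (N1 \<Otimes>\<^sub>M N2) (\<lambda>\<omega>. (f (\<lambda>i\<in>A. X i \<omega>), g (\<lambda>i\<in>B. X i \<omega>)))"
    unfolding eq by (subst distr_distr) (auto simp: comp_def)
  finally show ?thesis ..
qed

lemma weighted_sum_measurable:
  fixes c :: "'i \<Rightarrow> real"
  assumes "J \<subseteq> A"
  shows "(\<lambda>\<rho>. \<Sum>i\<in>J. c i *\<^sub>R \<rho> i) \<in> PiM A (\<lambda>_. borel :: (complex ^ 'n::finite) measure) \<rightarrow>\<^sub>M borel"
  using assms by (intro borel_measurable_sum borel_measurable_scaleR borel_measurable_const measurable_component_singleton) auto

lemma has_CN_law_weighted_sum:
  fixes X :: "'i \<Rightarrow> 'a \<Rightarrow> complex ^ 'n::finite" and c v :: "'i \<Rightarrow> real"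
  assumes ind: "indep_vars (\<lambda>_. borel) X I" and J: "finite J" "J \<subseteq> I"
    and X: "\<And>i. i \<in> I \<Longrightarrow> has_CN_law M (v i) (X i)"
  shows "has_CN_law M (\<Sum>i\<in>J. (c i)\<^sup>2 * v i) (\<lambda>\<omega>. \<Sum>i\<in>J. c i *\<^sub>R X i \<omega>)"
  using J
proof (induct J rule: finite_induct)
  case empty
  then show ?case by (simp add: has_CN_law_zero)
next
  case (insert i J)
  \<comment> \<open>The new summand is written as a sum over a singleton, so that both components
    are weighted sums over disjoint blocks.\<close>
  have "distr M (borel \<Otimes>\<^sub>M borel) (\<lambda>\<omega>. ((\<lambda>\<rho>. \<Sum>i\<in>{i}. c i *\<^sub>R \<rho> i) (\<lambda>i\<in>{i}. X i \<omega>), (\<lambda>\<rho>. \<Sum>i\<in>J. c i *\<^sub>R \<rho> i) (\<lambda>i\<in>J. X i \<omega>)))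
    = distr M borel (\<lambda>\<omega>. (\<lambda>\<rho>. \<Sum>i\<in>{i}. c i *\<^sub>R \<rho> i) (\<lambda>i\<in>{i}. X i \<omega>)) \<Otimes>\<^sub>M distr M borel (\<lambda>\<omega>. (\<lambda>\<rho>. \<Sum>i\<in>J. c i *\<^sub>R \<rho> i) (\<lambda>i\<in>J. X i \<omega>))"
    using insert by (intro indep_vars_distr_pair[OF ind] weighted_sum_measurable) auto
  then have "distr M (borel \<Otimes>\<^sub>M borel) (\<lambda>\<omega>. (c i *\<^sub>R X i \<omega>, \<Sum>i\<in>J. c i *\<^sub>R X i \<omega>))
    = distr M borel (\<lambda>\<omega>. c i *\<^sub>R X i \<omega>) \<Otimes>\<^sub>M distr M borel (\<lambda>\<omega>. \<Sum>i\<in>J. c i *\<^sub>R X i \<omega>)"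
    by simp
  then show ?case
    using insert has_CN_law_add[OF has_CN_law_scaleR[OF X, of i "c i"]] by simp
qed

text \<open>X is the wanted channel, Y the rest of the pilot observation and Z the innovation. The
  residual of the regression of X on X + Y is independent of X + Y; scaling by \<alpha> and adding
  the independent Z preserves this. The factor \<kappa> is free because the estimate of another
  cell's channel is a different multiple of the same observation.\<close>

lemma distr_estimate_error:
  fixes X Y Z :: "'a \<Rightarrow> complex ^ 'n::finite" and \<kappa> \<alpha> :: real
  assumes X: "has_CN_law M a X" and Y: "has_CN_law M b Y" and Z: "has_CN_law M d Z" and b: "0 < b"
    and XY: "distr M (borel \<Otimes>\<^sub>M borel) (\<lambda>\<omega>. (X \<omega>, Y \<omega>)) = distr M borel X \<Otimes>\<^sub>M distr M borel Y"
    and XYZ: "distr M ((borel \<Otimes>\<^sub>M borel) \<Otimes>\<^sub>M borel) (\<lambda>\<omega>. ((X \<omega>, Y \<omega>), Z \<omega>))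
      = distr M (borel \<Otimes>\<^sub>M borel) (\<lambda>\<omega>. (X \<omega>, Y \<omega>)) \<Otimes>\<^sub>M distr M borel Z"
  shows "distr M (borel \<Otimes>\<^sub>M borel)
      (\<lambda>\<omega>. (\<kappa> *\<^sub>R (X \<omega> + Y \<omega>), \<alpha> *\<^sub>R (X \<omega> - (a / (a + b)) *\<^sub>R (X \<omega> + Y \<omega>)) + Z \<omega>))
    = complex_normal_vec (\<kappa>\<^sup>2 * (a + b)) \<Otimes>\<^sub>M complex_normal_vec (\<alpha>\<^sup>2 * (a * b / (a + b)) + d)"
proof -
  let ?N = "\<lambda>v. complex_normal_vec v :: (complex ^ 'n) measure"
  define c where "c = a / (a + b)"
  define w where "w = a * b / (a + b)"
  have a: "0 \<le> a" and d: "0 \<le> d" and [measurable]: "X \<in> borel_measurable M" "Y \<in> borel_measurable M" "Z \<in> borel_measurable M"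
    and law: "distr M borel X = ?N a" "distr M borel Y = ?N b" "distr M borel Z = ?N d"
    using X Y Z by (auto simp: has_CN_law_def)
  have w: "0 \<le> w" and ab: "0 \<le> a + b" using a b by (auto simp: w_def)
  interpret S: prob_space "?N (a + b)" by (rule prob_space_complex_normal_vec)
  interpret W: prob_space "?N w" by (rule prob_space_complex_normal_vec)
  interpret D: prob_space "?N d" by (rule prob_space_complex_normal_vec)
  interpret D': prob_space "?N (\<alpha>\<^sup>2 * w)" by (rule prob_space_complex_normal_vec)
  interpret V: prob_space "?N (\<alpha>\<^sup>2 * w + d)" by (rule prob_space_complex_normal_vec)
  have key: "(\<integral>\<^sup>+\<omega>. g (\<kappa> *\<^sub>R (X \<omega> + Y \<omega>), \<alpha> *\<^sub>R (X \<omega> - c *\<^sub>R (X \<omega> + Y \<omega>)) + Z \<omega>) \<partial>M)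
     = (\<integral>\<^sup>+p. g p \<partial>(?N (\<kappa>\<^sup>2 * (a + b)) \<Otimes>\<^sub>M ?N (\<alpha>\<^sup>2 * w + d)))"
    if [measurable]: "g \<in> borel_measurable (borel \<Otimes>\<^sub>M borel)" for g
  proof -
    \<comment> \<open>Z is integrated out first, which leaves a function of the regression pair to
      which the rotation applies.\<close>
    define H where "H p = (\<integral>\<^sup>+z. g (\<kappa> *\<^sub>R fst p, \<alpha> *\<^sub>R snd p + z) \<partial>?N d)" for p
    have [measurable]: "H \<in> borel_measurable (borel \<Otimes>\<^sub>M borel)"
      unfolding H_def[abs_def] by measurable
    have "(\<integral>\<^sup>+\<omega>. g (\<kappa> *\<^sub>R (X \<omega> + Y \<omega>), \<alpha> *\<^sub>R (X \<omega> - c *\<^sub>R (X \<omega> + Y \<omega>)) + Z \<omega>) \<partial>M)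
      = (\<integral>\<^sup>+p. g (\<kappa> *\<^sub>R (fst (fst p) + snd (fst p)), \<alpha> *\<^sub>R (fst (fst p) - c *\<^sub>R (fst (fst p) + snd (fst p))) + snd p)
          \<partial>distr M ((borel \<Otimes>\<^sub>M borel) \<Otimes>\<^sub>M borel) (\<lambda>\<omega>. ((X \<omega>, Y \<omega>), Z \<omega>)))"
      by (subst nn_integral_distr) auto
    also have "\<dots> = (\<integral>\<^sup>+p. \<integral>\<^sup>+z. g (\<kappa> *\<^sub>R (fst p + snd p), \<alpha> *\<^sub>R (fst p - c *\<^sub>R (fst p + snd p)) + z) \<partial>?N d \<partial>(?N a \<Otimes>\<^sub>M ?N b))"
      unfolding XYZ XY law by (subst D.nn_integral_fst[symmetric]) auto
    also have "\<dots> = (\<integral>\<^sup>+p. H (case p of (x, y) \<Rightarrow> (x + y, x - c *\<^sub>R (x + y))) \<partial>(?N a \<Otimes>\<^sub>M ?N b))"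
      by (simp add: H_def split_def)
    also have "\<dots> = (\<integral>\<^sup>+p. H p \<partial>distr (?N a \<Otimes>\<^sub>M ?N b) (borel \<Otimes>\<^sub>M borel) (\<lambda>(x, y). (x + y, x - c *\<^sub>R (x + y))))"
      by (rule nn_integral_distr[symmetric]) measurable
    also have "\<dots> = (\<integral>\<^sup>+p. H p \<partial>(?N (a + b) \<Otimes>\<^sub>M ?N w))"
      unfolding c_def w_def complex_normal_vec_rotate[OF a b] ..
    also have "\<dots> = (\<integral>\<^sup>+s. \<integral>\<^sup>+r. \<integral>\<^sup>+z. g (\<kappa> *\<^sub>R s, \<alpha> *\<^sub>R r + z) \<partial>?N d \<partial>?N w \<partial>?N (a + b))"
      by (subst W.nn_integral_fst[symmetric]) (auto simp: H_def)
    also have "\<dots> = (\<integral>\<^sup>+s. \<integral>\<^sup>+r. \<integral>\<^sup>+z. g (\<kappa> *\<^sub>R s, r + z) \<partial>?N d \<partial>?N (\<alpha>\<^sup>2 * w) \<partial>?N (a + b))"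
      unfolding complex_normal_vec_scaleR[OF w, of \<alpha>, symmetric]
      by (subst nn_integral_distr) auto
    also have "\<dots> = (\<integral>\<^sup>+s. \<integral>\<^sup>+p. g (\<kappa> *\<^sub>R s, case p of (r, z) \<Rightarrow> r + z) \<partial>(?N (\<alpha>\<^sup>2 * w) \<Otimes>\<^sub>M ?N d) \<partial>?N (a + b))"
      by (subst D.nn_integral_fst[symmetric]) auto
    also have "\<dots> = (\<integral>\<^sup>+s. \<integral>\<^sup>+u. g (\<kappa> *\<^sub>R s, u) \<partial>?N (\<alpha>\<^sup>2 * w + d) \<partial>?N (a + b))"
    proof -
      have "?N (\<alpha>\<^sup>2 * w + d) = distr (?N (\<alpha>\<^sup>2 * w) \<Otimes>\<^sub>M ?N d) borel (\<lambda>(x, y). x + y)"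
        using w d by (intro complex_normal_vec_add[symmetric]) auto
      then show ?thesis by (simp add: nn_integral_distr)
    qed
    also have "\<dots> = (\<integral>\<^sup>+s. \<integral>\<^sup>+u. g (s, u) \<partial>?N (\<alpha>\<^sup>2 * w + d) \<partial>?N (\<kappa>\<^sup>2 * (a + b)))"
      unfolding complex_normal_vec_scaleR[OF ab, of \<kappa>, symmetric]
      by (subst nn_integral_distr) auto
    also have "\<dots> = (\<integral>\<^sup>+p. g p \<partial>(?N (\<kappa>\<^sup>2 * (a + b)) \<Otimes>\<^sub>M ?N (\<alpha>\<^sup>2 * w + d)))"
      by (subst V.nn_integral_fst[symmetric]) auto
    finally show ?thesis .
  qed
  show ?thesis
    unfolding c_def[symmetric] w_def[symmetric]
  proof (rule measure_eqI)
    let ?f = "\<lambda>\<omega>. (\<kappa> *\<^sub>R (X \<omega> + Y \<omega>), \<alpha> *\<^sub>R (X \<omega> - c *\<^sub>R (X \<omega> + Y \<omega>)) + Z \<omega>)"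
    show "sets (distr M (borel \<Otimes>\<^sub>M borel) ?f) = sets (?N (\<kappa>\<^sup>2 * (a + b)) \<Otimes>\<^sub>M ?N (\<alpha>\<^sup>2 * w + d))"
      by (simp cong: sets_pair_measure_cong)
    fix A assume "A \<in> sets (distr M (borel \<Otimes>\<^sub>M borel) ?f)"
    then have [measurable]: "A \<in> sets (borel \<Otimes>\<^sub>M borel)" by simp
    have "emeasure (distr M (borel \<Otimes>\<^sub>M borel) ?f) A = (\<integral>\<^sup>+p. indicator A p \<partial>distr M (borel \<Otimes>\<^sub>M borel) ?f)"
      by simp
    also have "\<dots> = (\<integral>\<^sup>+\<omega>. indicator A (?f \<omega>) \<partial>M)" by (rule nn_integral_distr) measurable
    also have "\<dots> = (\<integral>\<^sup>+p. indicator A p \<partial>(?N (\<kappa>\<^sup>2 * (a + b)) \<Otimes>\<^sub>M ?N (\<alpha>\<^sup>2 * w + d)))"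
      by (rule key) measurable
    also have "\<dots> = emeasure (?N (\<kappa>\<^sup>2 * (a + b)) \<Otimes>\<^sub>M ?N (\<alpha>\<^sup>2 * w + d)) A"
      by (rule nn_integral_indicator) (simp cong: sets_pair_measure_cong)
    finally show "emeasure (distr M (borel \<Otimes>\<^sub>M borel) ?f) A = emeasure (?N (\<kappa>\<^sup>2 * (a + b)) \<Otimes>\<^sub>M ?N (\<alpha>\<^sup>2 * w + d)) A" .
  qed
qed

end

section \<open>Rate of the zero-forcing receiver\<close>

text \<open>\<open>S j\<close> stands for the estimated channel of terminal \<open>j\<close> and \<open>E i j\<close> for the prediction
  error of terminal \<open>j\<close> in cell \<open>i\<close>. Each error is assumed independent of the estimates, but not the
  errors of each other: those of the same terminal index in different cells are dependent, because these
  terminals share a pilot.\<close>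
locale zero_forcing = prob_space M for M :: "'w measure" +
  fixes S :: "'k::finite \<Rightarrow> 'w \<Rightarrow> complex ^ 'n::finite"
    and E :: "'c::finite \<Rightarrow> 'k \<Rightarrow> 'w \<Rightarrow> complex ^ 'n"
    and b :: "'k \<Rightarrow> real" and v :: "'c \<Rightarrow> 'k \<Rightarrow> real"
  assumes b_pos: "\<And>j. 0 < b j" and v_nonneg: "\<And>i j. 0 \<le> v i j"
    and S_measurable [measurable]: "\<And>j. S j \<in> borel_measurable M"
    and E_measurable [measurable]: "\<And>i j. E i j \<in> borel_measurable M"
    and joint_law: "\<And>i j. distr M (PiM (UNIV - {j}) (\<lambda>_. borel) \<Otimes>\<^sub>M (borel \<Otimes>\<^sub>M borel))
        (\<lambda>\<omega>. (\<lambda>j'\<in>UNIV - {j}. S j' \<omega>, (S j \<omega>, E i j \<omega>)))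
      = distr M (PiM (UNIV - {j}) (\<lambda>_. borel)) (\<lambda>\<omega>. \<lambda>j'\<in>UNIV - {j}. S j' \<omega>)
        \<Otimes>\<^sub>M (complex_normal_vec (b j) \<Otimes>\<^sub>M complex_normal_vec (v i j))"
    and less: "CARD('k) < CARD('n)"
begin

text \<open>Conditioning on the columns other than j is carried out as Fubini's theorem over this
  law.\<close>

definition others :: "'k \<Rightarrow> ('k \<Rightarrow> complex ^ 'n) measure" where
  "others j = distr M (PiM (UNIV - {j}) (\<lambda>_. borel)) (\<lambda>\<omega>. \<lambda>j'\<in>UNIV - {j}. S j' \<omega>)"

lemma sets_others [simp, measurable_cong]: "sets (others j) = sets (PiM (UNIV - {j}) (\<lambda>_. borel))"
  by (simp add: others_def)

lemma prob_space_others: "prob_space (others j)"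
  unfolding others_def by (rule prob_space_distr) measurable

lemma nn_integral_split:
  assumes F [measurable]: "F \<in> borel_measurable (PiM (UNIV - {j}) (\<lambda>_. borel) \<Otimes>\<^sub>M (borel \<Otimes>\<^sub>M borel))"
  shows "(\<integral>\<^sup>+\<omega>. F (\<lambda>j'\<in>UNIV - {j}. S j' \<omega>, (S j \<omega>, E i j \<omega>)) \<partial>M)
    = (\<integral>\<^sup>+y. \<integral>\<^sup>+u. \<integral>\<^sup>+x. F (y, (u, x)) \<partial>complex_normal_vec (v i j) \<partial>complex_normal_vec (b j) \<partial>others j)"
proof -
  interpret O: prob_space "others j" by (rule prob_space_others)
  interpret B: prob_space "complex_normal_vec (b j) :: (complex ^ 'n) measure" by (rule prob_space_complex_normal_vec)
  interpret V: prob_space "complex_normal_vec (v i j) :: (complex ^ 'n) measure" by (rule prob_space_complex_normal_vec)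
  let ?BV = "(complex_normal_vec (b j) :: (complex ^ 'n) measure) \<Otimes>\<^sub>M (complex_normal_vec (v i j) :: (complex ^ 'n) measure)"
  interpret P: pair_prob_space "complex_normal_vec (b j) :: (complex ^ 'n) measure" "complex_normal_vec (v i j) :: (complex ^ 'n) measure" ..
  have eq: "others j \<Otimes>\<^sub>M ?BV = distr M (PiM (UNIV - {j}) (\<lambda>_. borel) \<Otimes>\<^sub>M (borel \<Otimes>\<^sub>M borel))
      (\<lambda>\<omega>. (\<lambda>j'\<in>UNIV - {j}. S j' \<omega>, (S j \<omega>, E i j \<omega>)))"
    by (simp add: joint_law others_def)
  have "(\<integral>\<^sup>+\<omega>. F (\<lambda>j'\<in>UNIV - {j}. S j' \<omega>, (S j \<omega>, E i j \<omega>)) \<partial>M) = (\<integral>\<^sup>+p. F p \<partial>(others j \<Otimes>\<^sub>M ?BV))"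
    unfolding eq by (subst nn_integral_distr) auto
  also have "\<dots> = (\<integral>\<^sup>+y. \<integral>\<^sup>+p. F (y, p) \<partial>?BV \<partial>others j)"
    by (rule P.P.nn_integral_fst[symmetric]) measurable
  also have "\<dots> = (\<integral>\<^sup>+y. \<integral>\<^sup>+u. \<integral>\<^sup>+x. F (y, (u, x)) \<partial>complex_normal_vec (v i j) \<partial>complex_normal_vec (b j) \<partial>others j)"
  proof (rule nn_integral_cong)
    fix y' assume "y' \<in> space (others j)"
    then have [measurable]: "(\<lambda>p. F (y', p)) \<in> borel_measurable (borel \<Otimes>\<^sub>M borel)"
      by (intro measurable_compose[OF _ F] measurable_Pair1') (simp add: others_def)
    show "(\<integral>\<^sup>+p. F (y', p) \<partial>?BV) = (\<integral>\<^sup>+u. \<integral>\<^sup>+x. F (y', (u, x)) \<partial>complex_normal_vec (v i j) \<partial>complex_normal_vec (b j))"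
      by (rule V.nn_integral_fst[symmetric]) measurable
  qed
  finally show ?thesis .
qed

definition G :: "'w \<Rightarrow> complex ^ 'k ^ 'n" where "G \<omega> = of_columns (\<lambda>j. S j \<omega>)"

lemma G_measurable [measurable]: "G \<in> borel_measurable M"
  unfolding G_def[abs_def] by (rule measurable_of_columns) measurable

lemma of_columns_upd_measurable [measurable]:
  "(\<lambda>p. of_columns ((fst p)(j := snd p))) \<in>
     PiM (UNIV - {j}) (\<lambda>_. borel) \<Otimes>\<^sub>M borel \<rightarrow>\<^sub>M (borel :: (complex ^ 'k ^ 'n) measure)"
proof (rule measurable_of_columns)
  fix j' show "(\<lambda>p. ((fst p)(j := snd p)) j') \<in> borel_measurable (PiM (UNIV - {j}) (\<lambda>_. borel :: (complex ^ 'n) measure) \<Otimes>\<^sub>M borel)"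
    by (cases "j' = j") (auto intro!: measurable_compose[OF measurable_fst] measurable_component_singleton)
qed

lemma of_columns_upd_fst_measurable [measurable]:
  "(\<lambda>p. of_columns ((fst p)(j := fst (snd p)))) \<in>
     PiM (UNIV - {j}) (\<lambda>_. borel) \<Otimes>\<^sub>M (borel \<Otimes>\<^sub>M (borel :: (complex ^ 'n) measure)) \<rightarrow>\<^sub>M (borel :: (complex ^ 'k ^ 'n) measure)"
proof -
  have "(\<lambda>p. (fst p, fst (snd p))) \<in> PiM (UNIV - {j}) (\<lambda>_. borel :: (complex ^ 'n) measure) \<Otimes>\<^sub>M (borel \<Otimes>\<^sub>M (borel :: (complex ^ 'n) measure))
      \<rightarrow>\<^sub>M PiM (UNIV - {j}) (\<lambda>_. borel) \<Otimes>\<^sub>M (borel :: (complex ^ 'n) measure)" by measurable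
  from measurable_compose[OF this of_columns_upd_measurable] show ?thesis by simp
qed

lemma G_eq: "G \<omega> = of_columns ((\<lambda>j'\<in>UNIV - {j}. S j' \<omega>)(j := S j \<omega>))"
  unfolding G_def by (rule arg_cong[where f=of_columns]) auto

lemma nn_integral_split_G:
  assumes [measurable]: "f \<in> borel_measurable borel"
  shows "(\<integral>\<^sup>+\<omega>. f (G \<omega>) \<partial>M)
    = (\<integral>\<^sup>+y. \<integral>\<^sup>+u. f (of_columns (y(j := u))) \<partial>complex_normal_vec (b j) \<partial>others j)"
proof -
  \<comment> \<open>The joint law always carries an error. Any cell may be chosen, since that
    variable integrates to 1.\<close>
  fix i :: 'c
  interpret V: prob_space "complex_normal_vec (v i j) :: (complex ^ 'n) measure" by (rule prob_space_complex_normal_vec)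
  have [measurable]: "(\<lambda>p. f (of_columns ((fst p)(j := fst (snd p))))) \<in> borel_measurable (PiM (UNIV - {j}) (\<lambda>_. borel) \<Otimes>\<^sub>M (borel \<Otimes>\<^sub>M (borel :: (complex ^ 'n) measure)))"
    by (rule measurable_compose[OF of_columns_upd_fst_measurable assms])
  show ?thesis
    unfolding G_eq[of _ j]
    using nn_integral_split[of "\<lambda>p. f (of_columns ((fst p)(j := fst (snd p))))" j i]
    by (simp add: V.emeasure_space_1[simplified])
qed

text \<open>The row w is a function of the estimates alone. For fixed estimates the error is
  integrated first, and its second moment depends on w only through the norm.\<close>

lemma nn_integral_split_err:
  assumes w [measurable]: "w \<in> borel_measurable borel"
  shows "(\<integral>\<^sup>+\<omega>. ennreal ((cmod (\<Sum>a\<in>UNIV. w (G \<omega>) $ a * E i j \<omega> $ a))\<^sup>2) \<partial>M)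
    = ennreal (v i j) * (\<integral>\<^sup>+\<omega>. ennreal ((norm (w (G \<omega>)))\<^sup>2) \<partial>M)"
proof -
  let ?H = "\<lambda>p. w (of_columns ((fst p)(j := fst (snd p))))"
  have [measurable]: "?H \<in> borel_measurable (PiM (UNIV - {j}) (\<lambda>_. borel) \<Otimes>\<^sub>M (borel \<Otimes>\<^sub>M (borel :: (complex ^ 'n) measure)))"
    by (rule measurable_compose[OF of_columns_upd_fst_measurable w])
  have "(\<integral>\<^sup>+\<omega>. ennreal ((cmod (\<Sum>a\<in>UNIV. w (G \<omega>) $ a * E i j \<omega> $ a))\<^sup>2) \<partial>M)
     = (\<integral>\<^sup>+y. \<integral>\<^sup>+u. \<integral>\<^sup>+x. ennreal ((cmod (\<Sum>a\<in>UNIV. w (of_columns (y(j := u))) $ a * x $ a))\<^sup>2)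
          \<partial>complex_normal_vec (v i j) \<partial>complex_normal_vec (b j) \<partial>others j)"
    unfolding G_eq[of _ j]
    using nn_integral_split[of "\<lambda>p. ennreal ((cmod (\<Sum>a\<in>UNIV. ?H p $ a * snd (snd p) $ a))\<^sup>2)" j i]
    by simp
  also have "\<dots> = (\<integral>\<^sup>+y. \<integral>\<^sup>+u. ennreal (v i j * (norm (w (of_columns (y(j := u)))))\<^sup>2) \<partial>complex_normal_vec (b j) \<partial>others j)"
    by (simp add: complex_normal_vec_second_moment v_nonneg)
  also have "\<dots> = (\<integral>\<^sup>+\<omega>. ennreal (v i j * (norm (w (G \<omega>)))\<^sup>2) \<partial>M)"
    by (rule nn_integral_split_G[symmetric]) measurable
  also have "\<dots> = ennreal (v i j) * (\<integral>\<^sup>+\<omega>. ennreal ((norm (w (G \<omega>)))\<^sup>2) \<partial>M)"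
    by (subst nn_integral_cmult[symmetric]) (auto simp: ennreal_mult' v_nonneg)
  finally show ?thesis .
qed

text \<open>For every fixed choice of the other columns the mean of 1 / q is finite, so q is
  positive almost surely in the remaining column, and then an explicit zero-forcing row exists. Full
  column rank follows by taking all k.\<close>

lemma AE_row_solvable: "AE \<omega> in M. \<exists>w. w v* G \<omega> = axis k 1"
proof -
  let ?R = "{A :: complex ^ 'k ^ 'n. \<exists>w. w v* A = axis k 1}"
  have inner: "(\<integral>\<^sup>+u. indicator (- ?R) (of_columns (y'(k := u))) \<partial>complex_normal_vec (b k)) = 0" for y'
  proof -
    obtain B :: "(complex ^ 'n) set"
      where B: "pairwise orthogonal B" "\<And>b. b \<in> B \<Longrightarrow> norm b = 1" "finite B"
      "2 * CARD('n) + 2 \<le> card B + 2 * CARD('k)"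
      "\<And>x. 0 < (\<Sum>b\<in>B. (x \<bullet> b)\<^sup>2) \<Longrightarrow>
       \<exists>w. w v* of_columns (y'(k := x)) = axis k 1 \<and> (norm w)\<^sup>2 = 1 / (\<Sum>b\<in>B. (x \<bullet> b)\<^sup>2)"
      using zero_forcing_row_exists[where v=y' and k=k] by blast
    have card: "2 < card B" using B(4) less by linarith
    have "(\<integral>\<^sup>+x. inverse (ennreal (\<Sum>b\<in>B. (x \<bullet> b)\<^sup>2)) \<partial>complex_normal_vec (b k)) \<noteq> \<infinity>"
      using complex_normal_vec_inverse_quadratic[OF B(1,2,3) b_pos card, of k] by (auto simp: top_unique)
    then have "AE x in complex_normal_vec (b k). inverse (ennreal (\<Sum>b\<in>B. (x \<bullet> b)\<^sup>2)) \<noteq> \<infinity>"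
      by (rule nn_integral_PInf_AE[rotated]) measurable
    then have "AE x in complex_normal_vec (b k). (indicator (- ?R) (of_columns (y'(k := x))) :: ennreal) = 0"
    proof eventually_elim
      case (elim x)
      then have "(\<Sum>b\<in>B. (x \<bullet> b)\<^sup>2) \<noteq> 0" by auto
      then have "0 < (\<Sum>b\<in>B. (x \<bullet> b)\<^sup>2)" using sum_nonneg[of B "\<lambda>b. (x \<bullet> b)\<^sup>2"] by simp
      then have "of_columns (y'(k := x)) \<in> ?R" using B(5)[of x] by blast
      then show ?case by (simp add: indicator_def)
    qed
    then have "(\<integral>\<^sup>+u. indicator (- ?R) (of_columns (y'(k := u))) \<partial>complex_normal_vec (b k)) = (\<integral>\<^sup>+u. 0 \<partial>(complex_normal_vec (b k) :: (complex ^ 'n) measure))"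
      by (rule nn_integral_cong_AE)
    then show ?thesis by simp
  qed
  have R [measurable]: "- ?R \<in> sets borel" using borel_row_solvable by (rule borel_comp)
  have "(\<integral>\<^sup>+\<omega>. indicator (- ?R) (G \<omega>) \<partial>M) = 0"
    by (subst nn_integral_split_G[of _ k]) (simp_all add: inner)
  then have "AE \<omega> in M. (indicator (- ?R) (G \<omega>) :: ennreal) = 0"
    by (subst (asm) nn_integral_0_iff_AE) measurable
  then show ?thesis by eventually_elim (auto simp: indicator_def split: if_splits)
qed

lemma AE_left_inverse: "AE \<omega> in M. \<exists>B. B ** G \<omega> = mat 1"
  unfolding left_inverse_iff_rows by (subst AE_all_countable) (simp add: AE_row_solvable)

lemma nn_integral_norm_row_le:
  "(\<integral>\<^sup>+\<omega>. ennreal ((norm (row k (pinv (G \<omega>))))\<^sup>2) \<partial>M) \<le> ennreal (1 / ((real CARD('n) - real CARD('k)) * b k))"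
proof -
  let ?R = "{A :: complex ^ 'k ^ 'n. \<exists>B. B ** A = mat 1}"
  \<comment> \<open>The comparison with an explicit row requires full column rank, which may fail
    for particular values of the other columns. The indicator excludes these matrices at no cost, as
    they form a null event.\<close>
  let ?f = "\<lambda>A. indicator ?R A * ennreal ((norm (row k (pinv A)))\<^sup>2)"
  have "?R = (\<Inter>k. {A. \<exists>w. w v* A = axis k 1})" by (auto simp: left_inverse_iff_rows)
  then have R [measurable]: "?R \<in> sets borel" by (simp add: borel_row_solvable sets.countable_INT'')
  interpret O: prob_space "others k" by (rule prob_space_others)
  have inner: "(\<integral>\<^sup>+u. ?f (of_columns (y'(k := u))) \<partial>complex_normal_vec (b k)) \<le> ennreal (1 / ((real CARD('n) - real CARD('k)) * b k))" for y'
  proof -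
    obtain B :: "(complex ^ 'n) set"
      where B: "pairwise orthogonal B" "\<And>b. b \<in> B \<Longrightarrow> norm b = 1" "finite B"
      "2 * CARD('n) + 2 \<le> card B + 2 * CARD('k)"
      "\<And>x. 0 < (\<Sum>b\<in>B. (x \<bullet> b)\<^sup>2) \<Longrightarrow>
       \<exists>w. w v* of_columns (y'(k := x)) = axis k 1 \<and> (norm w)\<^sup>2 = 1 / (\<Sum>b\<in>B. (x \<bullet> b)\<^sup>2)"
      using zero_forcing_row_exists[where v=y' and k=k] by blast
    have card: "2 < card B" using B(4) less by linarith
    \<comment> \<open>If q = 0 the right-hand side is top, and if the matrix has no left inverse the
      left-hand side is 0; only the remaining case uses the explicit row.\<close>
    have pw: "?f (of_columns (y'(k := x))) \<le> inverse (ennreal (\<Sum>b\<in>B. (x \<bullet> b)\<^sup>2))" for x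
    proof (cases "of_columns (y'(k := x)) \<in> ?R \<and> (\<Sum>b\<in>B. (x \<bullet> b)\<^sup>2) \<noteq> 0")
      case True
      then have q: "0 < (\<Sum>b\<in>B. (x \<bullet> b)\<^sup>2)" using sum_nonneg[of B "\<lambda>b. (x \<bullet> b)\<^sup>2"] by simp
      obtain w where w: "w v* of_columns (y'(k := x)) = axis k 1" "(norm w)\<^sup>2 = 1 / (\<Sum>b\<in>B. (x \<bullet> b)\<^sup>2)"
        using B(5)[OF q] by blast
      obtain C where "C ** of_columns (y'(k := x)) = mat 1" using True by blast
      then have "norm (row k (pinv (of_columns (y'(k := x))))) \<le> norm w"
        using w(1) by (rule norm_row_pinv_le)
      then have "(norm (row k (pinv (of_columns (y'(k := x))))))\<^sup>2 \<le> 1 / (\<Sum>b\<in>B. (x \<bullet> b)\<^sup>2)"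
        unfolding w(2)[symmetric] by (simp add: power_mono)
      then show ?thesis using True q
        by (simp add: inverse_ennreal inverse_eq_divide ennreal_leI)
    qed auto
    have "(\<integral>\<^sup>+u. ?f (of_columns (y'(k := u))) \<partial>complex_normal_vec (b k))
       \<le> (\<integral>\<^sup>+x. inverse (ennreal (\<Sum>b\<in>B. (x \<bullet> b)\<^sup>2)) \<partial>complex_normal_vec (b k))"
      by (intro nn_integral_mono pw)
    also have "\<dots> \<le> ennreal (2 / (b k * (real (card B) - 2)))"
      by (rule complex_normal_vec_inverse_quadratic[OF B(1,2,3) b_pos card])
    also have "\<dots> \<le> ennreal (1 / ((real CARD('n) - real CARD('k)) * b k))"
    proof (rule ennreal_leI)
      \<comment> \<open>With t = N - K the dimension bound reads card B - 2 >= 2 t, and the factor 2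
        cancels against the numerator.\<close>
      define t where "t = real CARD('n) - real CARD('k)"
      have "real (2 * CARD('n) + 2) \<le> real (card B + 2 * CARD('k))"
        using B(4) by (simp only: of_nat_le_iff)
      then have "2 * t \<le> real (card B) - 2" by (simp add: t_def)
      then have "b k * (2 * t) \<le> b k * (real (card B) - 2)"
        using b_pos[of k] by (intro mult_left_mono) auto
      moreover have "0 < t" using less by (simp add: t_def)
      ultimately have "2 / (b k * (real (card B) - 2)) \<le> 2 / (b k * (2 * t))"
        using b_pos[of k] card by (intro divide_left_mono mult_pos_pos) auto
      then have "2 / (b k * (real (card B) - 2)) \<le> 1 / (t * b k)"
        by (simp add: mult.commute)
      then show "2 / (b k * (real (card B) - 2)) \<le> 1 / ((real CARD('n) - real CARD('k)) * b k)"
        by (simp only: t_def)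
    qed
    finally show ?thesis .
  qed
  have "(\<integral>\<^sup>+\<omega>. ennreal ((norm (row k (pinv (G \<omega>))))\<^sup>2) \<partial>M) = (\<integral>\<^sup>+\<omega>. ?f (G \<omega>) \<partial>M)"
  proof (rule nn_integral_cong_AE)
    show "AE \<omega> in M. ennreal ((norm (row k (pinv (G \<omega>))))\<^sup>2) = ?f (G \<omega>)"
      using AE_left_inverse by eventually_elim (simp add: indicator_def)
  qed
  also have "\<dots> = (\<integral>\<^sup>+y. \<integral>\<^sup>+u. ?f (of_columns (y(k := u))) \<partial>complex_normal_vec (b k) \<partial>others k)"
    by (rule nn_integral_split_G) measurable
  also have "\<dots> \<le> (\<integral>\<^sup>+y. ennreal (1 / ((real CARD('n) - real CARD('k)) * b k)) \<partial>others k)"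
    by (intro nn_integral_mono inner)
  also have "\<dots> = ennreal (1 / ((real CARD('n) - real CARD('k)) * b k))"
    by (simp add: O.emeasure_space_1)
  finally show ?thesis .
qed

text \<open>Supplies the dominating function for the rate. The squared norm is a sum of squared
  coordinates, each a second moment with a unit vector as weight.\<close>

lemma integrable_norm_sq_S: "integrable M (\<lambda>\<omega>. (norm (S j \<omega>))\<^sup>2)"
proof (rule integrableI_nonneg)
  fix i :: 'c
  have eq: "ennreal ((norm x)\<^sup>2) = (\<Sum>a\<in>UNIV. ennreal ((cmod (\<Sum>a'\<in>UNIV. axis a 1 $ a' * x $ a'))\<^sup>2))" for x :: "complex ^ 'n"
    by (simp add: sum_ennreal norm_vec_def L2_set_def sum_nonneg axis_def if_distrib if_distribR cong: if_cong)
  interpret B: prob_space "complex_normal_vec (b j) :: (complex ^ 'n) measure" by (rule prob_space_complex_normal_vec)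
  interpret V: prob_space "complex_normal_vec (v i j) :: (complex ^ 'n) measure" by (rule prob_space_complex_normal_vec)
  interpret O: prob_space "others j" by (rule prob_space_others)
  have "(\<integral>\<^sup>+\<omega>. ennreal ((norm (S j \<omega>))\<^sup>2) \<partial>M)
     = (\<integral>\<^sup>+y. \<integral>\<^sup>+u. \<integral>\<^sup>+x. ennreal ((norm (u :: complex ^ 'n))\<^sup>2) \<partial>(complex_normal_vec (v i j) :: (complex ^ 'n) measure)
          \<partial>complex_normal_vec (b j) \<partial>others j)"
    using nn_integral_split[of "\<lambda>p. ennreal ((norm (fst (snd p)))\<^sup>2)" j i] by simp
  also have "\<dots> = (\<integral>\<^sup>+u. ennreal ((norm (u :: complex ^ 'n))\<^sup>2) \<partial>complex_normal_vec (b j))"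
    by (simp add: V.emeasure_space_1[simplified] O.emeasure_space_1)
  also have "\<dots> = (\<Sum>a\<in>UNIV. ennreal (b j * (norm (axis a (1::complex) :: complex ^ 'n))\<^sup>2))"
    unfolding eq by (subst nn_integral_sum) (auto simp: complex_normal_vec_second_moment less_imp_le[OF b_pos])
  also have "\<dots> < \<infinity>" by (simp add: less_top[symmetric] ennreal_mult_eq_top_iff)
  finally show "(\<integral>\<^sup>+\<omega>. ennreal ((norm (S j \<omega>))\<^sup>2) \<partial>M) < \<infinity>" .
qed auto

lemma zf_sinr_measurable [measurable]:
  assumes [measurable]: "\<And>i. A i \<in> borel_measurable M" "\<And>i. B i \<in> borel_measurable M"
  shows "(\<lambda>\<omega>. zf_sinr p \<alpha> (\<lambda>i. A i \<omega>) (\<lambda>i. B i \<omega> :: complex ^ 'k ^ 'n) l k) \<in> borel_measurable M"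
  unfolding zf_sinr_def by measurable

lemma integral_norm_row:
  fixes k :: 'k
  defines "Q \<equiv> (\<lambda>\<omega>. (norm (row k (pinv (G \<omega>))))\<^sup>2)"
  shows "integrable M Q" "(\<integral>\<omega>. Q \<omega> \<partial>M) \<le> 1 / ((real CARD('n) - real CARD('k)) * b k)"
    "integrable M (\<lambda>\<omega>. (cmod (\<Sum>a\<in>UNIV. row k (pinv (G \<omega>)) $ a * E i j \<omega> $ a))\<^sup>2)"
    "(\<integral>\<omega>. (cmod (\<Sum>a\<in>UNIV. row k (pinv (G \<omega>)) $ a * E i j \<omega> $ a))\<^sup>2 \<partial>M) = v i j * (\<integral>\<omega>. Q \<omega> \<partial>M)"
proof -
  define q0 where "q0 = 1 / ((real CARD('n) - real CARD('k)) * b k)"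
  have q0: "0 \<le> q0" using less b_pos[of k] by (simp add: q0_def)
  have [measurable]: "Q \<in> borel_measurable M" unfolding Q_def by measurable
  have Q0: "0 \<le> Q \<omega>" for \<omega> by (simp add: Q_def)
  have le: "(\<integral>\<^sup>+\<omega>. ennreal (Q \<omega>) \<partial>M) \<le> ennreal q0"
    using nn_integral_norm_row_le[of k] by (simp add: Q_def q0_def)
  then show iQ: "integrable M Q"
    using Q0 by (intro integrableI_nonneg) (auto simp: less_top[symmetric] top_unique)
  have "ennreal (\<integral>\<omega>. Q \<omega> \<partial>M) \<le> ennreal q0"
    using le Q0 iQ by (subst (asm) nn_integral_eq_integral) auto
  then show "(\<integral>\<omega>. Q \<omega> \<partial>M) \<le> 1 / ((real CARD('n) - real CARD('k)) * b k)"
    using q0 by (simp add: ennreal_le_iff q0_def[symmetric])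
  define T where "T = (\<lambda>\<omega>. (cmod (\<Sum>a\<in>UNIV. row k (pinv (G \<omega>)) $ a * E i j \<omega> $ a))\<^sup>2)"
  have [measurable]: "T \<in> borel_measurable M" unfolding T_def by measurable
  have T0: "0 \<le> T \<omega>" for \<omega> by (simp add: T_def)
  have "(\<integral>\<^sup>+\<omega>. ennreal (T \<omega>) \<partial>M) = ennreal (v i j) * (\<integral>\<^sup>+\<omega>. ennreal (Q \<omega>) \<partial>M)"
    unfolding T_def Q_def by (rule nn_integral_split_err[where w="\<lambda>A. row k (pinv A)"]) measurable
  also have "\<dots> = ennreal (v i j * (\<integral>\<omega>. Q \<omega> \<partial>M))"
    using Q0 iQ by (subst nn_integral_eq_integral) (auto simp: ennreal_mult' v_nonneg)
  finally have T: "(\<integral>\<^sup>+\<omega>. ennreal (T \<omega>) \<partial>M) = ennreal (v i j * (\<integral>\<omega>. Q \<omega> \<partial>M))" .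
  show iT: "integrable M (\<lambda>\<omega>. (cmod (\<Sum>a\<in>UNIV. row k (pinv (G \<omega>)) $ a * E i j \<omega> $ a))\<^sup>2)"
    unfolding T_def[symmetric] using T0 T by (intro integrableI_nonneg) auto
  show "(\<integral>\<omega>. (cmod (\<Sum>a\<in>UNIV. row k (pinv (G \<omega>)) $ a * E i j \<omega> $ a))\<^sup>2 \<partial>M) = v i j * (\<integral>\<omega>. Q \<omega> \<partial>M)"
    unfolding T_def[symmetric]
    using T T0 v_nonneg Q0 by (subst integral_eq_nn_integral) (auto intro!: mult_nonneg_nonneg integral_nonneg_AE)
qed

end

section \<open>Convexity and the rate bound from Jensen's inequality\<close>

lemma convex_on_log2_one_plus_inverse: "convex_on {0<..} (\<lambda>t::real. log 2 (1 + 1 / t))"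
proof (rule f''_ge0_imp_convex)
  show "convex {0::real<..}" by simp
  fix t :: real assume "t \<in> {0<..}"
  then have t: "0 < t" by simp
  then have nz: "1 + 1 / t \<noteq> 0" "0 < 1 + 1 / t" "t\<^sup>2 + t \<noteq> 0" "t \<noteq> 0"
    using add_pos_pos[of 1 "1 / t"] add_pos_pos[of "t\<^sup>2" t] by auto
  have "((\<lambda>t. ln (1 + 1 / t) / ln 2) has_real_derivative (1 / (1 + 1 / t) * (- (1 / (t * t)))) / ln 2) (at t)"
    using t nz by (auto intro!: derivative_eq_intros simp: divide_inverse)
  moreover have "(1 / (1 + 1 / t) * (- (1 / (t * t)))) / ln 2 = - 1 / ((t\<^sup>2 + t) * ln 2)"
    using t nz by (simp add: divide_simps power2_eq_square) (simp add: algebra_simps)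
  ultimately show "((\<lambda>t. log 2 (1 + 1 / t)) has_real_derivative - 1 / ((t\<^sup>2 + t) * ln 2)) (at t)"
    unfolding log_def by simp
  show "((\<lambda>t. - 1 / ((t\<^sup>2 + t) * ln 2)) has_real_derivative (2 * t + 1) * ln 2 / (((t\<^sup>2 + t) * ln 2) * ((t\<^sup>2 + t) * ln 2))) (at t)"
    using nz by (auto intro!: derivative_eq_intros)
  show "0 \<le> (2 * t + 1) * ln 2 / (((t\<^sup>2 + t) * ln 2) * ((t\<^sup>2 + t) * ln 2))"
    using t by (intro divide_nonneg_nonneg mult_nonneg_nonneg) auto
qed

lemma zf_sinr_nonneg: "0 < p \<Longrightarrow> 0 \<le> zf_sinr p \<alpha> A B l k"
  unfolding zf_sinr_def
  by (intro divide_nonneg_nonneg add_nonneg_nonneg mult_nonneg_nonneg sum_nonneg) auto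

context zero_forcing
begin

text \<open>The estimates from cell i are multiples of those from cell l, because all cells reuse
  the same pilots; \<open>r i j\<close> is the ratio, hence 1 for i = l. Zero forcing therefore
  passes exactly \<open>r i k\<close> from cell i, and this pilot contamination makes the
  interference term the constant \<open>C\<close>.\<close>

theorem zero_forcing_rate_ge:
  fixes r :: "'c \<Rightarrow> 'k \<Rightarrow> real" and p \<alpha> :: real and l :: 'c and k :: 'k
  assumes p: "0 < p" and \<alpha>: "\<alpha> \<noteq> 0" and r: "\<And>j. r l j = 1"
  shows "log 2 (1 + 1 / ((\<Sum>i\<in>UNIV - {l}. (r i k)\<^sup>2)
        + 1 / ((real CARD('n) - real CARD('k)) * \<alpha>\<^sup>2 * b k) * ((\<Sum>i\<in>UNIV. \<Sum>j\<in>UNIV. v i j) + 1 / p)))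
    \<le> (\<integral>\<omega>. log 2 (1 + zf_sinr p \<alpha> (\<lambda>i. of_columns (\<lambda>j. r i j *\<^sub>R S j \<omega>))
          (\<lambda>i. of_columns (\<lambda>j. E i j \<omega>)) l k) \<partial>M)"
proof -
  define C where "C = (\<Sum>i\<in>UNIV - {l}. (r i k)\<^sup>2)"
  define Q where "Q = (\<lambda>\<omega>. (norm (row k (pinv (G \<omega>))))\<^sup>2)"
  define T where "T i j \<omega> = (cmod (\<Sum>a\<in>UNIV. row k (pinv (G \<omega>)) $ a * E i j \<omega> $ a))\<^sup>2" for i j \<omega>
  \<comment> \<open>Almost surely the reciprocal of the SINR, divided through by \<alpha>^2 p; it is
    affine in \<open>Q\<close> and the \<open>T i j\<close>.\<close>
  define Y where "Y \<omega> = C + 1 / \<alpha>\<^sup>2 * (\<Sum>i\<in>UNIV. \<Sum>j\<in>UNIV. T i j \<omega>) + 1 / (\<alpha>\<^sup>2 * p) * Q \<omega>" for \<omega>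
  define Z where "Z \<omega> = zf_sinr p \<alpha> (\<lambda>i. of_columns (\<lambda>j. r i j *\<^sub>R S j \<omega>)) (\<lambda>i. of_columns (\<lambda>j. E i j \<omega>)) l k" for \<omega>
  define q0 where "q0 = 1 / ((real CARD('n) - real CARD('k)) * b k)"
  define x0 where "x0 = C + 1 / ((real CARD('n) - real CARD('k)) * \<alpha>\<^sup>2 * b k) * ((\<Sum>i\<in>UNIV. \<Sum>j\<in>UNIV. v i j) + 1 / p)"
  have \<alpha>2: "0 < \<alpha>\<^sup>2" using \<alpha> by simp
  have C: "0 \<le> C" unfolding C_def by (intro sum_nonneg) auto
  have [measurable]: "Q \<in> borel_measurable M" "T i j \<in> borel_measurable M" for i j
    unfolding Q_def T_def[abs_def] by measurable
  have [measurable]: "Y \<in> borel_measurable M" unfolding Y_def[abs_def] by measurable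
  have [measurable]: "Z \<in> borel_measurable M"
    unfolding Z_def[abs_def] by (intro zf_sinr_measurable measurable_of_columns) measurable
  have Q0: "0 \<le> Q \<omega>" and T0: "0 \<le> T i j \<omega>" for i j \<omega> by (auto simp: Q_def T_def)
  note int = integral_norm_row[of k, folded Q_def, folded T_def q0_def]
  have iY: "integrable M Y"
    unfolding Y_def[abs_def] using int
    by (intro Bochner_Integration.integrable_add integrable_mult_right Bochner_Integration.integrable_sum) auto
  \<comment> \<open>By linearity only the mean of each single \<open>T i j\<close> enters, so
    dependence among the errors of different cells does not matter.\<close>
  have EY: "expectation Y \<le> x0"
  proof -
    have "expectation Y = C + 1 / \<alpha>\<^sup>2 * (\<Sum>i\<in>UNIV. \<Sum>j\<in>UNIV. v i j * expectation Q) + 1 / (\<alpha>\<^sup>2 * p) * expectation Q"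
      unfolding Y_def[abs_def] using int
      by (simp add: Bochner_Integration.integral_sum prob_space del: times_divide_eq_left)
    also have "\<dots> = C + (1 / \<alpha>\<^sup>2 * ((\<Sum>i\<in>UNIV. \<Sum>j\<in>UNIV. v i j) + 1 / p)) * expectation Q"
      by (simp add: sum_distrib_right[symmetric] distrib_right distrib_left)
    also have "\<dots> \<le> C + (1 / \<alpha>\<^sup>2 * ((\<Sum>i\<in>UNIV. \<Sum>j\<in>UNIV. v i j) + 1 / p)) * q0"
      using p v_nonneg int(2) by (intro add_left_mono mult_left_mono mult_nonneg_nonneg add_nonneg_nonneg sum_nonneg) auto
    also have "\<dots> = x0" by (simp add: x0_def q0_def)
    finally show ?thesis .
  qed
  have main: "AE \<omega> in M. 0 < Y \<omega> \<and> Z \<omega> = 1 / Y \<omega> \<and> Z \<omega> \<le> \<alpha>\<^sup>2 * p * (norm (S k \<omega>))\<^sup>2"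
    using AE_left_inverse
  proof eventually_elim
    case (elim \<omega>)
    then obtain B where "B ** G \<omega> = mat 1" by blast
    then have "pinv (G \<omega>) ** G \<omega> = mat 1" by (rule is_pinv_pinv)
    then have "row k (pinv (G \<omega>)) v* G \<omega> = row k (mat 1)" by (simp add: row_matrix_mult[symmetric])
    then have RG: "(\<Sum>a\<in>UNIV. row k (pinv (G \<omega>)) $ a * S j \<omega> $ a) = (if j = k then 1 else 0)" for j
      unfolding G_def vec_eq_iff vector_matrix_mult_of_columns by (simp add: row_def mat_def)
    have Gl: "of_columns (\<lambda>j. r l j *\<^sub>R S j \<omega>) = G \<omega>" by (simp add: r G_def)
    have interf: "(norm (row k (pinv (G \<omega>)) v* of_columns (\<lambda>j. r i j *\<^sub>R S j \<omega>)))\<^sup>2 = (r i k)\<^sup>2" for i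
    proof -
      have "(row k (pinv (G \<omega>)) v* of_columns (\<lambda>j. r i j *\<^sub>R S j \<omega>)) = axis k (complex_of_real (r i k))"
      proof -
        have "(\<Sum>a\<in>UNIV. row k (pinv (G \<omega>)) $ a * (r i j *\<^sub>R S j \<omega>) $ a)
            = complex_of_real (r i j) * (\<Sum>a\<in>UNIV. row k (pinv (G \<omega>)) $ a * S j \<omega> $ a)" for j
          by (simp add: sum_distrib_left scaleR_conv_of_real[where 'a=complex] mult.left_commute)
        then show ?thesis
          unfolding vec_eq_iff vector_matrix_mult_of_columns by (simp add: RG axis_def)
      qed
      then show ?thesis
        by (simp add: power2_norm_eq_inner inner_axis_axis) (simp add: inner_complex_def power2_eq_square)
    qed
    have err: "(norm (row k (pinv (G \<omega>)) v* of_columns (\<lambda>j. E i j \<omega>)))\<^sup>2 = (\<Sum>j\<in>UNIV. T i j \<omega>)" for i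
      by (simp add: norm_vec_def L2_set_def sum_nonneg vector_matrix_mult_of_columns T_def)
    \<comment> \<open>The zero-forcing row has product 1 with the column of terminal k.
      Cauchy-Schwarz then makes \<open>Q\<close> positive and bounds 1 / Q by the squared norm of
      that column, which in turn bounds the SINR.\<close>
    have one: "1 \<le> norm (row k (pinv (G \<omega>))) * norm (S k \<omega>)"
      using norm_sum_mult_le[of "row k (pinv (G \<omega>))" "S k \<omega>"] RG[of k] by simp
    then have Qpos: "0 < Q \<omega>" by (cases "row k (pinv (G \<omega>)) = 0") (auto simp: Q_def)
    have "1\<^sup>2 \<le> (norm (row k (pinv (G \<omega>))) * norm (S k \<omega>))\<^sup>2" using one by (rule power_mono) simp
    then have one': "1 \<le> Q \<omega> * (norm (S k \<omega>))\<^sup>2" by (simp add: Q_def power_mult_distrib)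
    have TT: "0 \<le> (\<Sum>i\<in>UNIV. \<Sum>j\<in>UNIV. T i j \<omega>)" by (intro sum_nonneg T0)
    have Yge: "1 / (\<alpha>\<^sup>2 * p) * Q \<omega> \<le> Y \<omega>" using C TT \<alpha>2 by (simp add: Y_def)
    moreover have "0 < 1 / (\<alpha>\<^sup>2 * p) * Q \<omega>" using Qpos \<alpha>2 p by simp
    ultimately have Ypos: "0 < Y \<omega>" by linarith
    have "Z \<omega> = \<alpha>\<^sup>2 * p / (\<alpha>\<^sup>2 * p * C + p * (\<Sum>i\<in>UNIV. \<Sum>j\<in>UNIV. T i j \<omega>) + Q \<omega>)"
      unfolding Z_def zf_sinr_def Gl interf err C_def Q_def ..
    also have "\<alpha>\<^sup>2 * p * C + p * (\<Sum>i\<in>UNIV. \<Sum>j\<in>UNIV. T i j \<omega>) + Q \<omega> = \<alpha>\<^sup>2 * p * Y \<omega>"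
      unfolding Y_def using \<alpha>2 p by (simp add: distrib_left)
    also have "\<alpha>\<^sup>2 * p / (\<alpha>\<^sup>2 * p * Y \<omega>) = 1 / Y \<omega>" using \<alpha>2 p by simp
    finally have ZY: "Z \<omega> = 1 / Y \<omega>" .
    have "1 / Y \<omega> \<le> 1 / (1 / (\<alpha>\<^sup>2 * p) * Q \<omega>)"
      using Qpos \<alpha>2 p by (intro divide_left_mono Yge mult_pos_pos Ypos) simp_all
    also have "\<dots> = \<alpha>\<^sup>2 * p * (1 / Q \<omega>)" by simp
    also have "\<dots> \<le> \<alpha>\<^sup>2 * p * (norm (S k \<omega>))\<^sup>2"
      using one' Qpos p by (intro mult_left_mono) (auto simp: divide_le_eq mult.commute)
    finally show ?case using Ypos ZY by simp
  qed
  \<comment> \<open>Domination uses ln (1 + Z) <= Z and the bound of \<open>Z\<close> by a multiple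
    of the squared norm of the column.\<close>
  have iL: "integrable M (\<lambda>\<omega>. log 2 (1 + Z \<omega>))"
  proof (rule Bochner_Integration.integrable_bound)
    show "integrable M (\<lambda>\<omega>. (\<alpha>\<^sup>2 * p / ln 2) * (norm (S k \<omega>))\<^sup>2)"
      by (intro integrable_mult_right integrable_norm_sq_S)
    show "(\<lambda>\<omega>. log 2 (1 + Z \<omega>)) \<in> borel_measurable M" by measurable
    show "AE \<omega> in M. norm (log 2 (1 + Z \<omega>)) \<le> norm ((\<alpha>\<^sup>2 * p / ln 2) * (norm (S k \<omega>))\<^sup>2)"
      using main
    proof eventually_elim
      case (elim \<omega>)
      have Z0: "0 \<le> Z \<omega>" unfolding Z_def using p by (rule zf_sinr_nonneg)
      have "ln (1 + Z \<omega>) \<le> \<alpha>\<^sup>2 * p * (norm (S k \<omega>))\<^sup>2"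
        using ln_add_one_self_le_self[OF Z0] elim by linarith
      then have "ln (1 + Z \<omega>) / ln 2 \<le> \<alpha>\<^sup>2 * p * (norm (S k \<omega>))\<^sup>2 / ln 2"
        by (intro divide_right_mono) auto
      then show ?case using Z0 p by (simp add: log_def)
    qed
  qed
  have AEq: "AE \<omega> in M. log 2 (1 + Z \<omega>) = log 2 (1 + 1 / Y \<omega>)"
    using main by eventually_elim simp
  have iqY: "integrable M (\<lambda>\<omega>. log 2 (1 + 1 / Y \<omega>))"
    using iL AEq by (subst integrable_cong_AE[symmetric]) auto
  have Ypos: "AE \<omega> in M. 0 < Y \<omega>" using main by eventually_elim simp
  \<comment> \<open>A positive mean makes the decreasing function applicable at
    \<open>expectation Y\<close>, so that the upper bound \<open>x0\<close> on the mean can be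
    inserted.\<close>
  have EYpos: "0 < expectation Y" using iY Ypos by (rule expectation_greater)
  have "log 2 (1 + 1 / x0) \<le> log 2 (1 + 1 / expectation Y)"
  proof -
    have "1 / x0 \<le> 1 / expectation Y" using EY EYpos by (intro divide_left_mono) auto
    moreover have "0 < 1 / x0" using EY EYpos by simp
    ultimately show ?thesis by (subst log_le_cancel_iff) linarith+
  qed
  also have "\<dots> \<le> expectation (\<lambda>\<omega>. log 2 (1 + 1 / Y \<omega>))"
    using iY Ypos iqY convex_on_log2_one_plus_inverse
    by (intro jensens_inequality[where I="{0<..}" and a=0]) auto
  also have "\<dots> = expectation (\<lambda>\<omega>. log 2 (1 + Z \<omega>))"
    using AEq by (intro integral_cong_AE) auto
  finally show ?thesis by (simp add: x0_def C_def Z_def)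
qed

end

section \<open>The delayed channel model as an instance\<close>

theorem proposition2:
  fixes M :: "'w measure"
    and \<beta> :: "'c::finite \<Rightarrow> 'c \<Rightarrow> 'k::finite \<Rightarrow> real"
    and h e :: "int \<Rightarrow> 'c \<Rightarrow> 'c \<Rightarrow> 'k \<Rightarrow> 'w \<Rightarrow> complex ^ 'n::finite"
    and z :: "int \<Rightarrow> 'c \<Rightarrow> 'k \<Rightarrow> 'w \<Rightarrow> complex ^ 'n"
    and \<tau> :: nat and p\<^sub>r f\<^sub>D T\<^sub>s \<alpha> :: real
    and n :: int and l :: 'c and k :: 'k
  assumes "prob_space M"
    and "CARD('k) \<le> CARD('n)"
    and "CARD('k) \<le> \<tau>"
    and "0 < p\<^sub>r"
    and "0 \<le> f\<^sub>D" and "0 < T\<^sub>s" and "\<alpha> = bessel_J0 (2 * pi * f\<^sub>D * T\<^sub>s)"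
    and "\<And>l i j. 0 \<le> \<beta> l i j"
    and "\<And>l j. 0 < \<beta> l l j"
    and "\<And>n l i j. has_CN_law M 1 (h n l i j)"
    and "\<And>n l j. has_CN_law M 1 (z n l j)"
    and "\<And>n l i j. has_CN_law M ((1 - \<alpha>\<^sup>2) * \<beta> l i j) (e n l i j)"
    and "\<And>n l i j \<omega>. \<omega> \<in> space M \<Longrightarrow>
           channel \<beta> h n l i j \<omega> = \<alpha> *\<^sub>R channel \<beta> h (n - 1) l i j \<omega> + e n l i j \<omega>"
    and "\<And>n l. prob_space.indep_vars M (\<lambda>_. borel) (source_var h z e n l) UNIV"
  shows "ergodic_rate M \<tau> p\<^sub>r \<alpha> \<beta> h z e n l k
           \<ge> rate_lower_bound CARD('n) \<tau> p\<^sub>r \<alpha> \<beta> l k"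
proof (cases "CARD('n) = CARD('k) \<or> \<alpha> = 0")
  case True
  \<comment> \<open>Both degenerate cases have bound 0, and the integral of a nonnegative function
    is nonnegative.\<close>
  have "0 \<le> ergodic_rate M \<tau> p\<^sub>r \<alpha> \<beta> h z e n l k"
  proof -
    have log0: "0 \<le> log 2 (1 + x)" if "0 \<le> x" for x :: real
      using that by (subst zero_le_log_cancel_iff) auto
    then show ?thesis
      unfolding ergodic_rate_def using \<open>0 < p\<^sub>r\<close>
      by (intro integral_nonneg_AE AE_I2 log0 zf_sinr_nonneg)
  qed
  then show ?thesis using True by (simp add: rate_lower_bound_def)
next
  case False
  then have less: "CARD('k) < CARD('n)" and \<alpha>: "\<alpha> \<noteq> 0" using assms(2) by auto
  interpret prob_space M by fact
  define pt where "pt = real \<tau> * p\<^sub>r"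
  have "0 < \<tau>" using \<open>CARD('k) \<le> \<tau>\<close> zero_less_card_finite[where 'a='k] by linarith
  then have pt: "0 < pt" using \<open>0 < p\<^sub>r\<close> by (simp add: pt_def)
  \<comment> \<open>The law of the innovation includes that its variance is nonnegative; with a
    positive \<beta> this bounds \<alpha>.\<close>
  have \<alpha>1: "\<alpha>\<^sup>2 \<le> 1"
  proof -
    have "0 \<le> (1 - \<alpha>\<^sup>2) * \<beta> l l k" using assms(12)[of l l k n] by (simp add: has_CN_law_def)
    then show ?thesis using assms(9)[of l k] by (simp add: zero_le_mult_iff)
  qed
  define src where "src = source_var h z e n l"
  have ind: "indep_vars (\<lambda>_. borel) src UNIV" unfolding src_def by (rule assms(14))
  define c where "c x = (case x of Fading i j \<Rightarrow> sqrt (\<beta> l i j) | Innovation i j \<Rightarrow> 1 | Pilot_Noise j \<Rightarrow> 1 / sqrt pt)" for x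
  define vs where "vs x = (case x of Innovation i j \<Rightarrow> (1 - \<alpha>\<^sup>2) * \<beta> l i j | _ \<Rightarrow> 1)" for x :: "('c, 'k) source"
  have src_law: "has_CN_law M (vs x) (src x)" for x
    using assms(10,11,12) by (cases x) (auto simp: src_def vs_def)
  define s where "s j = 1 / pt + (\<Sum>i\<in>UNIV. \<beta> l i j)" for j
  \<comment> \<open>The sources entering the observation \<open>T j\<close> of the j-th pilot.
    Blocks of different pilots are disjoint, which gives independent columns. Every estimate for
    terminal index j is a multiple of \<open>T j\<close>, whose variance per entry is
    \<open>s j\<close>.\<close>
  define blk where "blk j = (insert (Pilot_Noise j) (range (\<lambda>i. Fading i j)) :: ('c, 'k) source set)" for j :: 'k
  have fin: "finite (blk j)" for j by (simp add: blk_def)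
  have inj: "inj (\<lambda>i. Fading i j :: ('c, 'k) source)" for j by (simp add: inj_def)
  have np: "Pilot_Noise j \<notin> range (\<lambda>i. Fading i j :: ('c, 'k) source)" for j by auto
  define T where "T j \<omega> = (\<Sum>x\<in>blk j. c x *\<^sub>R src x \<omega>)" for j \<omega>
  have T_eq: "T j \<omega> = (\<Sum>i\<in>UNIV. channel \<beta> h (n - 1) l i j \<omega>) + (1 / sqrt pt) *\<^sub>R z (n - 1) l j \<omega>" for j \<omega>
    unfolding T_def blk_def using np[of j]
    by (simp add: sum.reindex[OF inj] c_def src_def channel_def add.commute)
  have s_eq: "(\<Sum>x\<in>blk j. (c x)\<^sup>2 * vs x) = s j" for j
    unfolding blk_def s_def using np[of j] pt assms(8)
    by (simp add: sum.reindex[OF inj] c_def vs_def power_divide)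
  have s_pos: "0 < s j" for j
    unfolding s_def using pt assms(8) by (intro add_pos_nonneg sum_nonneg) auto
  have est: "channel_est pt \<beta> h z (n - 1) l i j \<omega> = (\<beta> l i j / s j) *\<^sub>R T j \<omega>" for i j \<omega>
    unfolding channel_est_def T_eq s_def by (simp add: divide_inverse)
  have bh: "beta_hat pt \<beta> l i j = (\<beta> l i j)\<^sup>2 / s j" for i j
    by (simp add: beta_hat_def s_def add.commute)
  define S where "S j \<omega> = channel_est pt \<beta> h z (n - 1) l l j \<omega>" for j \<omega>
  define E where "E i j \<omega> = delayed_err \<alpha> pt \<beta> h z e n l i j \<omega>" for i j \<omega>
  define b where "b j = beta_hat pt \<beta> l l j" for j
  define v where "v i j = \<beta> l i j - \<alpha>\<^sup>2 * beta_hat pt \<beta> l i j" for i j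
  define F where "F i j = (Fading i j :: ('c, 'k) source)" for i j
  define R where "R i j = blk j - {F i j}" for i j
  have Fblk: "F i j \<in> blk j" for i j by (simp add: F_def blk_def)
  \<comment> \<open>Splits the observation into the channel of cell i and the rest, to which the
    regression lemma applies with variances \<beta> and s - \<beta>.\<close>
  have decomp: "T j \<omega> = c (F i j) *\<^sub>R src (F i j) \<omega> + (\<Sum>x\<in>R i j. c x *\<^sub>R src x \<omega>)" for i j \<omega>
    unfolding T_def R_def by (rule sum.remove[OF fin Fblk])
  have chan: "channel \<beta> h (n - 1) l i j \<omega> = c (F i j) *\<^sub>R src (F i j) \<omega>" for i j \<omega>
    by (simp add: channel_def c_def src_def F_def)
  have S_eq: "S j \<omega> = (\<beta> l l j / s j) *\<^sub>R T j \<omega>" for j \<omega>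
    by (simp add: S_def est)
  have E_eq: "E i j \<omega> = \<alpha> *\<^sub>R (c (F i j) *\<^sub>R src (F i j) \<omega> - (\<beta> l i j / s j) *\<^sub>R T j \<omega>) + src (Innovation i j) \<omega>" for i j \<omega>
    by (simp add: E_def delayed_err_def est chan src_def)
  have src_meas [measurable]: "src x \<in> borel_measurable M" for x
    using src_law[of x] by (simp add: has_CN_law_def)
  have T_meas [measurable]: "T j \<in> borel_measurable M" for j
    unfolding T_def[abs_def] by measurable
  have pair: "distr M (borel \<Otimes>\<^sub>M borel) (\<lambda>\<omega>. (S j \<omega>, E i j \<omega>)) = complex_normal_vec (b j) \<Otimes>\<^sub>M complex_normal_vec (v i j)" for i j
  proof -
    let ?X = "\<lambda>\<omega>. c (F i j) *\<^sub>R src (F i j) \<omega>"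
    let ?Y = "\<lambda>\<omega>. \<Sum>x\<in>R i j. c x *\<^sub>R src x \<omega>"
    let ?Z = "src (Innovation i j)"
    have X: "has_CN_law M (\<beta> l i j) ?X"
      using has_CN_law_scaleR[OF src_law[of "F i j"], of "c (F i j)"] assms(8)
      by (simp add: c_def vs_def F_def)
    have "(\<Sum>x\<in>R i j. (c x)\<^sup>2 * vs x) = s j - \<beta> l i j"
      using sum.remove[OF fin Fblk[of i j], of "\<lambda>x. (c x)\<^sup>2 * vs x"] assms(8)
      unfolding s_eq R_def by (simp add: F_def c_def vs_def)
    then have Y: "has_CN_law M (s j - \<beta> l i j) ?Y"
      using has_CN_law_weighted_sum[OF ind _ _ src_law, of "R i j" c] fin by (simp add: R_def)
    have Z: "has_CN_law M ((1 - \<alpha>\<^sup>2) * \<beta> l i j) ?Z"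
      using src_law[of "Innovation i j"] by (simp add: vs_def)
    have "\<beta> l i j \<le> (\<Sum>i\<in>UNIV. \<beta> l i j)"
      using assms(8) by (intro member_le_sum) auto
    moreover have "0 < 1 / pt" using pt by simp
    \<comment> \<open>The rest always contains the pilot noise of variance 1 / pt, so its variance
      is strictly positive even if all other links vanish.\<close>
    ultimately have pos: "0 < s j - \<beta> l i j" unfolding s_def by linarith
    have "distr M (borel \<Otimes>\<^sub>M borel) (\<lambda>\<omega>. ((\<lambda>\<rho>. \<Sum>x\<in>{F i j}. c x *\<^sub>R \<rho> x) (\<lambda>x\<in>{F i j}. src x \<omega>), (\<lambda>\<rho>. \<Sum>x\<in>R i j. c x *\<^sub>R \<rho> x) (\<lambda>x\<in>R i j. src x \<omega>)))
      = distr M borel (\<lambda>\<omega>. (\<lambda>\<rho>. \<Sum>x\<in>{F i j}. c x *\<^sub>R \<rho> x) (\<lambda>x\<in>{F i j}. src x \<omega>)) \<Otimes>\<^sub>M distr M borel (\<lambda>\<omega>. (\<lambda>\<rho>. \<Sum>x\<in>R i j. c x *\<^sub>R \<rho> x) (\<lambda>x\<in>R i j. src x \<omega>))"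
      by (intro indep_vars_distr_pair[OF ind] weighted_sum_measurable) (auto simp: R_def)
    then have XY: "distr M (borel \<Otimes>\<^sub>M borel) (\<lambda>\<omega>. (?X \<omega>, ?Y \<omega>)) = distr M borel ?X \<Otimes>\<^sub>M distr M borel ?Y"
      by simp
    let ?f = "\<lambda>\<rho>. (\<Sum>x\<in>{F i j}. c x *\<^sub>R \<rho> x, \<Sum>x\<in>R i j. c x *\<^sub>R \<rho> x)"
    let ?g = "\<lambda>\<rho>. \<Sum>x\<in>{Innovation i j}. 1 *\<^sub>R \<rho> x"
    have "distr M ((borel \<Otimes>\<^sub>M borel) \<Otimes>\<^sub>M borel) (\<lambda>\<omega>. (?f (\<lambda>x\<in>blk j. src x \<omega>), ?g (\<lambda>x\<in>{Innovation i j}. src x \<omega>)))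
      = distr M (borel \<Otimes>\<^sub>M borel) (\<lambda>\<omega>. ?f (\<lambda>x\<in>blk j. src x \<omega>)) \<Otimes>\<^sub>M distr M borel (\<lambda>\<omega>. ?g (\<lambda>x\<in>{Innovation i j}. src x \<omega>))"
      using Fblk by (intro indep_vars_distr_pair[OF ind] measurable_Pair weighted_sum_measurable) (auto simp: R_def blk_def)
    moreover have "?f (\<lambda>x\<in>blk j. src x \<omega>) = (?X \<omega>, ?Y \<omega>)" for \<omega>
      using Fblk by (auto simp: R_def intro!: sum.cong)
    moreover have "?g (\<lambda>x\<in>{Innovation i j}. src x \<omega>) = ?Z \<omega>" for \<omega> by simp
    ultimately have XYZ: "distr M ((borel \<Otimes>\<^sub>M borel) \<Otimes>\<^sub>M borel) (\<lambda>\<omega>. ((?X \<omega>, ?Y \<omega>), ?Z \<omega>))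
      = distr M (borel \<Otimes>\<^sub>M borel) (\<lambda>\<omega>. (?X \<omega>, ?Y \<omega>)) \<Otimes>\<^sub>M distr M borel ?Z"
      by (simp only:)
    \<comment> \<open>The two variances produced by the regression lemma are identified with
      \<beta>-hat and with \<beta> - \<alpha>^2 \<beta>-hat.\<close>
    have "(\<beta> l l j / s j)\<^sup>2 * s j = b j"
      using s_pos[of j] by (simp add: b_def bh power_divide power2_eq_square)
    moreover have "\<alpha>\<^sup>2 * (\<beta> l i j * (s j - \<beta> l i j) / s j) + (1 - \<alpha>\<^sup>2) * \<beta> l i j = v i j"
      using s_pos[of j] by (simp add: v_def bh field_simps power2_eq_square)
    ultimately show ?thesis
      using distr_estimate_error[OF X Y Z pos XY XYZ, of "\<beta> l l j / s j" \<alpha>]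
      by (simp add: S_eq E_eq decomp[of j _ i, symmetric])
  qed
  have joint: "distr M (PiM (UNIV - {j}) (\<lambda>_. borel) \<Otimes>\<^sub>M (borel \<Otimes>\<^sub>M borel))
        (\<lambda>\<omega>. (\<lambda>j'\<in>UNIV - {j}. S j' \<omega>, (S j \<omega>, E i j \<omega>)))
      = distr M (PiM (UNIV - {j}) (\<lambda>_. borel)) (\<lambda>\<omega>. \<lambda>j'\<in>UNIV - {j}. S j' \<omega>)
        \<Otimes>\<^sub>M distr M (borel \<Otimes>\<^sub>M borel) (\<lambda>\<omega>. (S j \<omega>, E i j \<omega>))" for i j
  proof -
    \<comment> \<open>The sources of the other pilots form \<open>A\<close>; those of pilot j
      together with its innovation form \<open>B\<close>. The other columns depend on
      \<open>A\<close> only, and the column and error of terminal j on \<open>B\<close>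
      only.\<close>
    define A where "A = (\<Union>j'\<in>UNIV - {j}. blk j')"
    define B where "B = insert (Innovation i j) (blk j)"
    let ?S = "\<lambda>j \<rho>. (\<beta> l l j / s j) *\<^sub>R (\<Sum>x\<in>blk j. c x *\<^sub>R \<rho> x)"
    let ?f = "\<lambda>\<rho>. \<lambda>j'\<in>UNIV - {j}. ?S j' \<rho>"
    let ?g = "\<lambda>\<rho>. (?S j \<rho>, \<alpha> *\<^sub>R (c (F i j) *\<^sub>R \<rho> (F i j) - (\<beta> l i j / s j) *\<^sub>R (\<Sum>x\<in>blk j. c x *\<^sub>R \<rho> x)) + \<rho> (Innovation i j))"
    have f: "?f \<in> PiM A (\<lambda>_. borel :: (complex ^ 'n) measure) \<rightarrow>\<^sub>M PiM (UNIV - {j}) (\<lambda>_. borel)"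
      by (intro measurable_restrict borel_measurable_scaleR borel_measurable_const weighted_sum_measurable) (auto simp: A_def)
    have g: "?g \<in> PiM B (\<lambda>_. borel :: (complex ^ 'n) measure) \<rightarrow>\<^sub>M borel \<Otimes>\<^sub>M borel"
      using Fblk
      by (intro measurable_Pair borel_measurable_add borel_measurable_diff borel_measurable_scaleR borel_measurable_const
          weighted_sum_measurable measurable_component_singleton) (auto simp: B_def)
    have AB: "A \<inter> B = {}" by (auto simp: A_def B_def blk_def)
    have fS: "?f (\<lambda>x\<in>A. src x \<omega>) = (\<lambda>j'\<in>UNIV - {j}. S j' \<omega>)" for \<omega>
    proof (rule restrict_ext)
      fix j' assume "j' \<in> UNIV - {j}"
      then have "(\<Sum>x\<in>blk j'. c x *\<^sub>R (\<lambda>x\<in>A. src x \<omega>) x) = T j' \<omega>"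
        unfolding T_def by (intro sum.cong) (auto simp: A_def)
      then show "?S j' (\<lambda>x\<in>A. src x \<omega>) = S j' \<omega>" by (simp add: S_eq)
    qed
    have gS: "?g (\<lambda>x\<in>B. src x \<omega>) = (S j \<omega>, E i j \<omega>)" for \<omega>
    proof -
      have "(\<Sum>x\<in>blk j. c x *\<^sub>R (\<lambda>x\<in>B. src x \<omega>) x) = T j \<omega>"
        unfolding T_def by (intro sum.cong) (auto simp: B_def)
      then show ?thesis using Fblk[of i j] by (simp add: S_eq E_eq B_def)
    qed
    from indep_vars_distr_pair[OF ind AB subset_UNIV subset_UNIV f g]
    show ?thesis unfolding fS gS .
  qed
  have v0: "0 \<le> v i j" for i j
  proof -
    have "\<beta> l i j \<le> (\<Sum>i\<in>UNIV. \<beta> l i j)" using assms(8) by (intro member_le_sum) auto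
    moreover have "0 < 1 / pt" using pt by simp
    ultimately have "\<beta> l i j \<le> s j" unfolding s_def by linarith
    then have "\<beta> l i j * \<beta> l i j \<le> \<beta> l i j * s j" using assms(8) by (intro mult_left_mono) auto
    then have "(\<beta> l i j)\<^sup>2 / s j \<le> \<beta> l i j"
      using s_pos[of j] by (simp add: divide_le_eq power2_eq_square)
    moreover have "\<alpha>\<^sup>2 * ((\<beta> l i j)\<^sup>2 / s j) \<le> 1 * ((\<beta> l i j)\<^sup>2 / s j)"
      using \<alpha>1 s_pos[of j] by (intro mult_right_mono) auto
    ultimately show ?thesis by (simp add: v_def bh)
  qed
  have b0: "0 < b j" for j
    using assms(9)[of l j] s_pos[of j] by (simp add: b_def bh)
  interpret Z: zero_forcing M S E b v
  proof
    show "S j \<in> borel_measurable M" for j unfolding S_eq[abs_def] by measurable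
    show "E i j \<in> borel_measurable M" for i j unfolding E_eq[abs_def] by measurable
  qed (use b0 v0 less joint in \<open>auto simp: pair\<close>)
  \<comment> \<open>Estimates for the same pilot are multiples of one observation, so their ratio is
    deterministic; this is the matrix D_i of the model.\<close>
  have "channel_est pt \<beta> h z (n - 1) l i j \<omega> = (\<beta> l i j / \<beta> l l j) *\<^sub>R S j \<omega>" for i j \<omega>
    using assms(9)[of l j] by (simp add: S_def est)
  then show ?thesis
    using Z.zero_forcing_rate_ge[OF \<open>0 < p\<^sub>r\<close> \<alpha>, of "\<lambda>i j. \<beta> l i j / \<beta> l l j" l k] assms(9)[of l] False
    by (simp add: ergodic_rate_def rate_lower_bound_def pt_def[symmetric] Let_def E_def b_def v_def less_imp_neq[symmetric])
qed

end
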